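(* The low-order refined discretization $\widetilde{A}_C = P^{\intercal}\widetilde{A}P$ is spectrally equivalent to the high-order conforming discretization $A_C = P^{\intercal}\widehat{A}P$; that is, $u^{\intercal}A_Cu \approx u^{\intercal}\widetilde{A}_Cu$ for all $u\in V_C$ (identified with its vector of degrees of freedom).
   Context: Let $\Omega\subseteq\mathbb{R}^2$ be the spatial domain and $\mathcal{T}$ a mesh of $\Omega$ consisting of non-overlapping quadrilateral elements $\kappa$; the mesh may be irregular (nonconforming, with hanging nodes). Let $\widehat\kappa=[0,1]^2$ and let $\mathcal{Q}_p(\widehat\kappa)$ be the bivariate polynomials of degree at most $p$ in each variable. Each $\kappa$ has a mapping $T_\kappa:\widehat\kappa\to\kappa$ and a polynomial degree $p_\kappa$. Set $V_h=\{v_h\in L^2(\Omega): v_h|_\kappa\circ T_\kappa\in\mathcal{Q}_{p_\kappa}(\widehat\kappa)\ \forall \kappa\in\mathcal{T}\}$ and $V_C=V_h\cap H^1(\Omega)$. Standing assumptions: the mesh is quasi-uniform, and the ratio of polynomial degrees in elements sharing a common edge is bounded. The space $V_h$ is equipped with the nodal basis associated with the tensor-product Gauss–Lobatto nodes of each element (mapped by $T_\kappa$). $P:V_C\to V_h$ is (the matrix of) the natural injection. $\widehat A$ is the matrix, in this basis of $V_h$, of the bilinear form $\widehat{\mathcal{A}}(u,v)=\int_\Omega\nabla_hu\cdot\nabla_hv\,d\boldsymbol x$, with $\nabla_h$ the elementwise gradient; it is block diagonal with blocks $\widehat A_\kappa$, $\kappa\in\mathcal{T}$. Thus $A_C=P^{\intercal}\widehat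 AP$ is the matrix of the form $\mathcal{A}_C(u,v)=\int_\Omega\nabla u\cdot\nabla v\,d\boldsymbol x$ on $V_C$. For each $\kappa$, the low-order refined mesh $\widetilde\kappa$ is the image under $T_\kappa$ of the Cartesian mesh of $\widehat\kappa$ whose vertices are the $(p_\kappa+1)^2$ tensor-product Gauss–Lobatto nodes. $\widetilde A_\kappa$ is the bilinear ($p=1$) finite element stiffness matrix on the mesh $\widetilde\kappa$, with degrees of freedom the values at the vertices of $\widetilde\kappa$, i.e. at the same Gauss–Lobatto nodes as for $\widehat A_\kappa$. $\widetilde A$ is the block diagonal matrix with blocks $\widetilde A_\kappa$. $a\lesssim b$ means $a\le Cb$ with $C$ independent of mesh size and polynomial degree (and penalty parameter), but possibly depending on the level of irregularity of the mesh and on the ratio of polynomial degrees in neighboring elements; $a\approx b$ means $a\lesssim b$ and $b\lesssim a$. *)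

theory Defs
  imports "HOL-Analysis.Analysis" "HOL-Computational_Algebra.Polynomial"
begin

definition legendre :: "nat \<Rightarrow> real poly" where
  "legendre n = smult (1 / (2 ^ n * fact n)) ((pderiv ^^ n) ([:-1, 0, 1:] ^ n))"

text \<open>
  The \<open>p + 1\<close> Gauss--Lobatto nodes on \<open>[-1, 1]\<close> are the two end points and the zeros of the
  derivative of the Legendre polynomial of degree \<open>p\<close>. They are listed in increasing order and
  moved to \<open>[0, 1]\<close>; the index \<open>i\<close> ranges over \<open>0, \<dots>, p\<close>, with \<open>p \<ge> 1\<close>.
\<close>

definition gl_node :: "nat \<Rightarrow> nat \<Rightarrow> real" where
  "gl_node p i =
     (1 + sorted_list_of_set {\<xi>. poly ([:-1, 0, 1:] * pderiv (legendre p)) \<xi> = 0} ! i) / 2"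

definition lagrange :: "nat \<Rightarrow> nat \<Rightarrow> real \<Rightarrow> real" where
  "lagrange p i x = (\<Prod>j\<in>{0..p} - {i}. (x - gl_node p j) / (gl_node p i - gl_node p j))"

text \<open>
  \<open>hat p i\<close> is the continuous piecewise linear function on \<open>[0, 1]\<close> with value \<open>1\<close> at the node
  \<open>i\<close> and \<open>0\<close> at the other nodes. Products of two of them are the bilinear nodal basis on the
  Cartesian grid of tensor-product nodes.
\<close>

definition hat :: "nat \<Rightarrow> nat \<Rightarrow> real \<Rightarrow> real" where
  "hat p i x =
     (if 0 < i \<and> gl_node p (i - 1) \<le> x \<and> x \<le> gl_node p i
        then (x - gl_node p (i - 1)) / (gl_node p i - gl_node p (i - 1))
      else if i < p \<and> gl_node p i \<le> x \<and> x \<le> gl_node p (i + 1)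
        then (gl_node p (i + 1) - x) / (gl_node p (i + 1) - gl_node p i)
      else 0)"

type_synonym point = "real ^ 2"

definition grad :: "(point \<Rightarrow> real) \<Rightarrow> point \<Rightarrow> point" where
  "grad f x = (\<chi> i. frechet_derivative f (at x) (axis i 1))"

primrec Ck :: "nat \<Rightarrow> (point \<Rightarrow> real) \<Rightarrow> bool" where
  "Ck 0 f \<longleftrightarrow> continuous_on UNIV f"
| "Ck (Suc k) f \<longleftrightarrow> (\<forall>x. f differentiable at x) \<and> (\<forall>i. Ck k (\<lambda>x. grad f x $ i))"

definition test_functions :: "point set \<Rightarrow> (point \<Rightarrow> real) set" where
  "test_functions \<Omega> =
     {\<phi>. (\<forall>k. Ck k \<phi>) \<and> (\<exists>K. compact K \<and> K \<subseteq> \<Omega> \<and> (\<forall>x. x \<notin> K \<longrightarrow> \<phi> x = 0))}"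

text \<open>
  Elements of \<open>L\<^sup>2(\<Omega>)\<close> are represented by functions on the plane; two representatives that
  agree almost everywhere in \<open>\<Omega>\<close> stand for the same element, and all notions below respect this.
\<close>

definition L2 :: "point set \<Rightarrow> (point \<Rightarrow> real) set" where
  "L2 \<Omega> = {v. set_borel_measurable lebesgue \<Omega> v \<and> set_integrable lebesgue \<Omega> (\<lambda>x. (v x)\<^sup>2)}"

definition ae_eq_on :: "point set \<Rightarrow> (point \<Rightarrow> real) \<Rightarrow> (point \<Rightarrow> real) \<Rightarrow> bool" where
  "ae_eq_on \<Omega> v w \<longleftrightarrow> (AE x in lebesgue. x \<in> \<Omega> \<longrightarrow> v x = w x)"

definition H1 :: "point set \<Rightarrow> (point \<Rightarrow> real) set" where
  "H1 \<Omega> =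
     {v \<in> L2 \<Omega>. \<exists>g :: point \<Rightarrow> point. \<forall>i.
        (\<lambda>x. g x $ i) \<in> L2 \<Omega> \<and>
        (\<forall>\<phi>\<in>test_functions \<Omega>.
           (LINT x:\<Omega>|lebesgue. v x * grad \<phi> x $ i) = - (LINT x:\<Omega>|lebesgue. g x $ i * \<phi> x))}"

definition Q_poly :: "nat \<Rightarrow> (point \<Rightarrow> real) set" where
  "Q_poly p = {q. \<exists>c :: nat \<Rightarrow> nat \<Rightarrow> real. \<forall>y. q y = (\<Sum>i\<le>p. \<Sum>j\<le>p. c i j * y $ 1 ^ i * y $ 2 ^ j)}"

text \<open>
  A mesh is a set \<open>\<T>\<close> of closed elements \<open>\<kappa>\<close>; the maps \<open>T \<kappa>\<close> and the degrees \<open>p \<kappa>\<close> are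
  indexed by the elements themselves.
\<close>

type_synonym element = "point set"

definition ref_square :: "point set" where
  "ref_square = {y. \<forall>i. 0 \<le> y $ i \<and> y $ i \<le> 1}"

definition element_map :: "(point \<Rightarrow> point) \<Rightarrow> element \<Rightarrow> bool" where
  "element_map F \<kappa> \<longleftrightarrow>
     F ` ref_square = \<kappa> \<and> inj_on F ref_square \<and>
     (\<exists>D :: point \<Rightarrow> real ^ 2 ^ 2. continuous_on ref_square D \<and>
        (\<forall>y\<in>ref_square. invertible (D y) \<and>
           (F has_derivative (\<lambda>v. D y *v v)) (at y within ref_square)))"

text \<open>
  No matching of edges is required, so arbitrary hanging nodes are allowed. The condition
  \<open>interior \<kappa> \<subseteq> \<Omega>\<close> excludes domains from which a part of an element has been removed.
\<close>

definition hp_mesh ::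
  "point set \<Rightarrow> element set \<Rightarrow> (element \<Rightarrow> point \<Rightarrow> point) \<Rightarrow> (element \<Rightarrow> nat) \<Rightarrow> bool" where
  "hp_mesh \<Omega> \<T> T p \<longleftrightarrow>
     open \<Omega> \<and> finite \<T> \<and> closure \<Omega> = \<Union>\<T> \<and>
     (\<forall>\<kappa>\<in>\<T>. element_map (T \<kappa>) \<kappa> \<and> interior \<kappa> \<subseteq> \<Omega> \<and> 1 \<le> p \<kappa>) \<and>
     (\<forall>\<kappa>\<in>\<T>. \<forall>\<kappa>'\<in>\<T>. \<kappa> \<noteq> \<kappa>' \<longrightarrow> interior \<kappa> \<inter> interior \<kappa>' = {})"

text \<open>
  Quasi-uniformity comprises shape regularity, which for mapped quadrilaterals means that the
  Jacobian matrix of \<open>T \<kappa>\<close> and its inverse are bounded by \<open>\<sigma> diam \<kappa>\<close> and \<open>\<sigma> / diam \<kappa>\<close>.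
\<close>

definition quasi_uniform :: "real \<Rightarrow> element set \<Rightarrow> (element \<Rightarrow> point \<Rightarrow> point) \<Rightarrow> bool" where
  "quasi_uniform \<sigma> \<T> T \<longleftrightarrow>
     (\<forall>\<kappa>\<in>\<T>. \<forall>\<kappa>'\<in>\<T>. diameter \<kappa> \<le> \<sigma> * diameter \<kappa>') \<and>
     (\<forall>\<kappa>\<in>\<T>. \<forall>y\<in>ref_square. \<forall>D. (T \<kappa> has_derivative D) (at y within ref_square) \<longrightarrow>
        (\<forall>v. norm (D v) \<le> \<sigma> * diameter \<kappa> * norm v \<and> diameter \<kappa> * norm v \<le> \<sigma> * norm (D v)))"

definition edges :: "(point \<Rightarrow> point) \<Rightarrow> point set set" where
  "edges F = {F ` {y \<in> ref_square. y $ i = s} | i s. s \<in> {0, 1}}"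

definition vertices :: "(point \<Rightarrow> point) \<Rightarrow> point set" where
  "vertices F = F ` {y. \<forall>i. y $ i \<in> {0, 1}}"

text \<open>The level of irregularity is the largest number of hanging nodes on an edge.\<close>

definition irregularity_le :: "nat \<Rightarrow> element set \<Rightarrow> (element \<Rightarrow> point \<Rightarrow> point) \<Rightarrow> bool" where
  "irregularity_le l \<T> T \<longleftrightarrow>
     (\<forall>\<kappa>\<in>\<T>. \<forall>e\<in>edges (T \<kappa>).
        card {x \<in> e. x \<notin> vertices (T \<kappa>) \<and> (\<exists>\<kappa>'\<in>\<T>. x \<in> vertices (T \<kappa>'))} \<le> l)"

text \<open>
  In a nonconforming mesh two elements share an edge if an edge of one and an edge of the other
  have a nondegenerate piece in common.
\<close>

definition share_edge :: "(element \<Rightarrow> point \<Rightarrow> point) \<Rightarrow> element \<Rightarrow> element \<Rightarrow> bool" where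
  "share_edge T \<kappa> \<kappa>' \<longleftrightarrow> \<kappa> \<noteq> \<kappa>' \<and>
     (\<exists>e\<in>edges (T \<kappa>). \<exists>e'\<in>edges (T \<kappa>'). \<exists>\<gamma>. arc \<gamma> \<and> path_image \<gamma> \<subseteq> e \<inter> e')"

definition degree_ratio_le ::
  "real \<Rightarrow> element set \<Rightarrow> (element \<Rightarrow> point \<Rightarrow> point) \<Rightarrow> (element \<Rightarrow> nat) \<Rightarrow> bool" where
  "degree_ratio_le \<rho> \<T> T p \<longleftrightarrow>
     (\<forall>\<kappa>\<in>\<T>. \<forall>\<kappa>'\<in>\<T>. share_edge T \<kappa> \<kappa>' \<longrightarrow> real (p \<kappa>) \<le> \<rho> * real (p \<kappa>'))"

definition V_h ::
  "point set \<Rightarrow> element set \<Rightarrow> (element \<Rightarrow> point \<Rightarrow> point) \<Rightarrow> (element \<Rightarrow> nat) \<Rightarrow> (point \<Rightarrow> real) set"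
  where
  "V_h \<Omega> \<T> T p =
     {v \<in> L2 \<Omega>. \<forall>\<kappa>\<in>\<T>. \<exists>q\<in>Q_poly (p \<kappa>). ae_eq_on ref_square (v \<circ> T \<kappa>) q}"

definition V_C ::
  "point set \<Rightarrow> element set \<Rightarrow> (element \<Rightarrow> point \<Rightarrow> point) \<Rightarrow> (element \<Rightarrow> nat) \<Rightarrow> (point \<Rightarrow> real) set"
  where
  "V_C \<Omega> \<T> T p = V_h \<Omega> \<T> T p \<inter> H1 \<Omega>"

text \<open>The degree of freedom \<open>(\<kappa>, i, j)\<close> belongs to the node \<open>T \<kappa> (x\<^sub>i, x\<^sub>j)\<close> of \<open>\<kappa>\<close>.\<close>

type_synonym dof = "element \<times> nat \<times> nat"

definition dofs :: "element set \<Rightarrow> (element \<Rightarrow> nat) \<Rightarrow> dof set" where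
  "dofs \<T> p = (SIGMA \<kappa>:\<T>. {0..p \<kappa>} \<times> {0..p \<kappa>})"

definition push_forward ::
  "(element \<Rightarrow> point \<Rightarrow> point) \<Rightarrow> element \<Rightarrow> (point \<Rightarrow> real) \<Rightarrow> point \<Rightarrow> real" where
  "push_forward T \<kappa> f x = (if x \<in> \<kappa> then f (inv_into ref_square (T \<kappa>) x) else 0)"

fun nodal_basis ::
  "(element \<Rightarrow> point \<Rightarrow> point) \<Rightarrow> (element \<Rightarrow> nat) \<Rightarrow> dof \<Rightarrow> point \<Rightarrow> real" where
  "nodal_basis T p (\<kappa>, i, j) =
     push_forward T \<kappa> (\<lambda>y. lagrange (p \<kappa>) i (y $ 1) * lagrange (p \<kappa>) j (y $ 2))"

fun lor_basis ::
  "(element \<Rightarrow> point \<Rightarrow> point) \<Rightarrow> (element \<Rightarrow> nat) \<Rightarrow> dof \<Rightarrow> point \<Rightarrow> real" where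
  "lor_basis T p (\<kappa>, i, j) =
     push_forward T \<kappa> (\<lambda>y. hat (p \<kappa>) i (y $ 1) * hat (p \<kappa>) j (y $ 2))"

definition is_basis :: "point set \<Rightarrow> (point \<Rightarrow> real) set \<Rightarrow> nat \<Rightarrow> (nat \<Rightarrow> point \<Rightarrow> real) \<Rightarrow> bool" where
  "is_basis \<Omega> V m \<phi> \<longleftrightarrow>
     (\<forall>a<m. \<phi> a \<in> V) \<and>
     (\<forall>c. ae_eq_on \<Omega> (\<lambda>x. \<Sum>a<m. c a * \<phi> a x) (\<lambda>x. 0) \<longrightarrow> (\<forall>a<m. c a = 0)) \<and>
     (\<forall>v\<in>V. \<exists>c. ae_eq_on \<Omega> v (\<lambda>x. \<Sum>a<m. c a * \<phi> a x))"

text \<open>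
  Matrices and vectors are functions on explicit finite index sets: \<open>dofs \<T> p\<close> for \<open>V_h\<close> and
  \<open>{..<m}\<close> for \<open>V_C\<close> with a basis \<open>\<phi> 0, \<dots>, \<phi> (m - 1)\<close>.
\<close>

definition injection_matrix ::
  "point set \<Rightarrow> element set \<Rightarrow> (element \<Rightarrow> point \<Rightarrow> point) \<Rightarrow> (element \<Rightarrow> nat) \<Rightarrow>
   nat \<Rightarrow> (nat \<Rightarrow> point \<Rightarrow> real) \<Rightarrow> (dof \<Rightarrow> nat \<Rightarrow> real) \<Rightarrow> bool" where
  "injection_matrix \<Omega> \<T> T p m \<phi> P \<longleftrightarrow>
     (\<forall>a<m. ae_eq_on \<Omega> (\<phi> a) (\<lambda>x. \<Sum>d\<in>dofs \<T> p. P d a * nodal_basis T p d x))"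

text \<open>
  The elementwise gradient is the classical gradient in the interiors of the elements; its value
  on the null set formed by the element boundaries is irrelevant.
\<close>

definition broken_grad :: "element set \<Rightarrow> (point \<Rightarrow> real) \<Rightarrow> point \<Rightarrow> point" where
  "broken_grad \<T> v x = (if \<exists>\<kappa>\<in>\<T>. x \<in> interior \<kappa> then grad v x else 0)"

definition A_hat ::
  "point set \<Rightarrow> element set \<Rightarrow> (element \<Rightarrow> point \<Rightarrow> point) \<Rightarrow> (element \<Rightarrow> nat) \<Rightarrow>
   dof \<Rightarrow> dof \<Rightarrow> real" where
  "A_hat \<Omega> \<T> T p d d' =
     (LINT x:\<Omega>|lebesgue.
        broken_grad \<T> (nodal_basis T p d) x \<bullet> broken_grad \<T> (nodal_basis T p d') x)"

text \<open>
  The stiffness matrix on the refined mesh is assembled cell by cell. The cells are the images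
  under \<open>T \<kappa>\<close> of the Cartesian cells, and the shape functions are mapped by the same \<open>T \<kappa>\<close>. If
  \<open>T \<kappa>\<close> is bilinear, then the cells are straight-sided and these are the usual isoparametric
  bilinear shape functions, because the bilinear map onto a cell is the restriction of \<open>T \<kappa>\<close>
  composed with an affine map.
\<close>

definition lor_cell ::
  "(element \<Rightarrow> point \<Rightarrow> point) \<Rightarrow> (element \<Rightarrow> nat) \<Rightarrow> element \<Rightarrow> nat \<Rightarrow> nat \<Rightarrow> point set" where
  "lor_cell T p \<kappa> a b =
     T \<kappa> ` {y. gl_node (p \<kappa>) a < y $ 1 \<and> y $ 1 < gl_node (p \<kappa>) (a + 1) \<and>
              gl_node (p \<kappa>) b < y $ 2 \<and> y $ 2 < gl_node (p \<kappa>) (b + 1)}"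

definition A_tilde ::
  "(element \<Rightarrow> point \<Rightarrow> point) \<Rightarrow> (element \<Rightarrow> nat) \<Rightarrow> dof \<Rightarrow> dof \<Rightarrow> real" where
  "A_tilde T p d d' =
     (if fst d = fst d'
      then \<Sum>a<p (fst d). \<Sum>b<p (fst d).
        (LINT x:lor_cell T p (fst d) a b|lebesgue.
           grad (lor_basis T p d) x \<bullet> grad (lor_basis T p d') x)
      else 0)"

definition restrict_matrix ::
  "'i set \<Rightarrow> ('i \<Rightarrow> 'j \<Rightarrow> real) \<Rightarrow> ('i \<Rightarrow> 'i \<Rightarrow> real) \<Rightarrow> 'j \<Rightarrow> 'j \<Rightarrow> real" where
  "restrict_matrix I P A a b = (\<Sum>d\<in>I. \<Sum>d'\<in>I. P d a * A d d' * P d' b)"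

definition quad_form :: "'j set \<Rightarrow> ('j \<Rightarrow> 'j \<Rightarrow> real) \<Rightarrow> ('j \<Rightarrow> real) \<Rightarrow> real" where
  "quad_form J A u = (\<Sum>a\<in>J. \<Sum>b\<in>J. u a * A a b * u b)"

end

theory Submission
  imports Defs
begin

text \<open>
  The equivalence holds element by element, for all vectors of degrees of freedom. Since the Jacobian matrices are
  uniformly well conditioned, both element forms are comparable with the forms on the reference
  square, and these are sums of Kronecker products of a one-dimensional stiffness and mass matrix.
  It remains to compare the spectral and the piecewise linear matrices in one dimension.

  With \<open>L\<close> the Legendre polynomial of degree \<open>p\<close> and \<open>\<lambda> = p (p + 1)\<close>, the nodes are the zeros of
  \<open>v = (1 - x\<^sup>2) L'\<close>, which satisfies \<open>v'' + \<lambda> / (1 - x\<^sup>2) v = 0\<close>, and the quadrature weights are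
  \<open>2 / (\<lambda> L(x)\<^sup>2)\<close>. Sturm comparison gives the size of the gaps between nodes, and monotone energies
  of the equation in Liouville normal form give the size of \<open>L\<close> at the nodes; hence weights and gaps
  are comparable, which settles the mass matrices. For the stiffness matrices one inequality is
  Cauchy--Schwarz. The other is the \<open>H\<^sup>1\<close> stability of interpolation: subtract from the data the
  truncated Legendre series of the derivative and apply to the rest the inverse and approximation
  inequalities in the norm with weight \<open>1 / (1 - x\<^sup>2)\<close>, in which the quadrature is exact. It is
  enough to treat polynomial data, because Bernstein polynomials converge uniformly and do not
  increase the \<open>H\<^sup>1\<close> seminorm.
\<close>

section \<open>Legendre polynomials\<close>

text \<open>The obstacle is the clustering of the nodes at the end points, where the gaps shrink
  from size 1/p to size 1/p^2. Markov's inequality bounds derivatives by p^2, which is p times too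
  much away from the ends, so an unweighted argument cannot give a constant free of p. The weight 1
  / (1 - x^2) follows the clustering: the \<open>lobatto n\<close> are orthogonal both for the
  weighted product and for the H^1 product, and the squared norms differ exactly by
  \<open>lam n\<close>. Modes n >= p enter the approximation inequality and modes n < p the inverse
  inequality with the same factor \<open>lam p\<close>, which cancels. The weighted square of d = (1
  - x^2) S' is the polynomial d S', so it is never a quotient and quadrature can be exact for it.

  In two dimensions the one-dimensional inequalities have to survive Kronecker products. That
  requires semidefinite factors, and for this reason all four matrices are kept as Gram matrices of
  polynomials over cells. On a mapped element the Dirichlet integral in the plane is invariant under
  scaling, so the diameter cancels and only \<sigma> is left in the constant.\<close>

definition poly_integral :: "real \<Rightarrow> real \<Rightarrow> real poly \<Rightarrow> real" where
  "poly_integral a b f = integral {a..b} (poly f)"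

lemma poly_integrable_on [simp]: "poly (f :: real poly) integrable_on {a..b}"
  by (intro integrable_continuous_interval continuous_intros)

lemma poly_ext: "(\<And>x. poly f x = poly g x) \<Longrightarrow> f = (g :: real poly)"
  by (simp add: poly_eq_poly_eq_iff[symmetric] fun_eq_iff)

lemma poly_integral_0 [simp]: "poly_integral a b 0 = 0"
  using integral_0[of "{a..b}"] by (simp add: poly_integral_def flip: integral_cong[of _ "\<lambda>_. 0"])

lemma poly_integral_add: "poly_integral a b (f + g) = poly_integral a b f + poly_integral a b g"
  unfolding poly_integral_def poly_add by (rule integral_add) simp_all

lemma poly_integral_diff: "poly_integral a b (f - g) = poly_integral a b f - poly_integral a b g"
  unfolding poly_integral_def poly_diff by (rule integral_diff) simp_all

lemma poly_integral_smult: "poly_integral a b (smult c f) = c * poly_integral a b f"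
  unfolding poly_integral_def poly_smult by simp

lemma poly_integral_minus: "poly_integral a b (- f) = - poly_integral a b f"
  using poly_integral_smult[of a b "-1" f] by simp

lemma poly_integral_sum: "poly_integral a b (\<Sum>i\<in>A. f i) = (\<Sum>i\<in>A. poly_integral a b (f i))"
  by (induction A rule: infinite_finite_induct) (simp_all add: poly_integral_add)

lemma poly_integral_mono:
  "(\<And>x. x \<in> {a..b} \<Longrightarrow> poly f x \<le> poly g x) \<Longrightarrow> poly_integral a b f \<le> poly_integral a b g"
  unfolding poly_integral_def by (rule integral_le) simp_all

lemma poly_integral_nonneg: "(\<And>x. x \<in> {a..b} \<Longrightarrow> 0 \<le> poly f x) \<Longrightarrow> 0 \<le> poly_integral a b f"
  using poly_integral_mono[of a b 0 f] by simp

lemma poly_integral_square_nonneg: "0 \<le> poly_integral a b (f\<^sup>2)"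
  by (rule poly_integral_nonneg) simp

lemma poly_integral_const: "a \<le> b \<Longrightarrow> poly_integral a b [:c:] = c * (b - a)" (is "_ \<Longrightarrow> ?thesis")
proof -
  have "poly [:c:] = (\<lambda>_. c)" by auto
  then show "a \<le> b \<Longrightarrow> ?thesis" by (simp add: poly_integral_def mult.commute)
qed

lemma poly_integral_pderiv: "a \<le> b \<Longrightarrow> poly_integral a b (pderiv f) = poly f b - poly f a"
  unfolding poly_integral_def
  by (intro integral_unique fundamental_theorem_of_calculus)
    (auto simp flip: has_real_derivative_iff_has_vector_derivative
      intro: DERIV_subset[OF poly_DERIV])

lemma poly_integral_by_parts:
  assumes "a \<le> b"
  shows "poly_integral a b (f * pderiv g) = poly f b * poly g b - poly f a * poly g a - poly_integral a b (pderiv f * g)"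
  using poly_integral_pderiv[OF assms, of "f * g"]
  by (simp add: pderiv_mult poly_integral_add mult.commute)

lemma poly_integral_combine: "a \<le> c \<Longrightarrow> c \<le> b \<Longrightarrow> poly_integral a c f + poly_integral c b f = poly_integral a b f"
  unfolding poly_integral_def by (rule Henstock_Kurzweil_Integration.integral_combine) simp_all

lemma poly_integral_power2_sum: "poly_integral a b ((f + g)\<^sup>2) = poly_integral a b (f\<^sup>2) + 2 * poly_integral a b (f * g) + poly_integral a b (g\<^sup>2)"
proof -
  have "(f + g)\<^sup>2 = f\<^sup>2 + smult 2 (f * g) + g\<^sup>2"
    by (rule poly_ext) (simp add: power2_eq_square algebra_simps)
  then show ?thesis by (simp add: poly_integral_add poly_integral_smult)
qed

lemma poly_integral_power2_sum_le: "poly_integral a b ((f + g)\<^sup>2) \<le> 2 * poly_integral a b (f\<^sup>2) + 2 * poly_integral a b (g\<^sup>2)"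
proof -
  have "poly_integral a b ((f + g)\<^sup>2) \<le> poly_integral a b (smult 2 (f\<^sup>2) + smult 2 (g\<^sup>2))"
  proof (rule poly_integral_mono)
    fix x
    have "(u + v)\<^sup>2 \<le> 2 * u\<^sup>2 + 2 * v\<^sup>2" for u v :: real
      using sum_squares_bound[of u v] by (simp add: power2_sum)
    then show "poly ((f + g)\<^sup>2) x \<le> poly (smult 2 (f\<^sup>2) + smult 2 (g\<^sup>2)) x"
      by simp
  qed
  then show ?thesis by (simp add: poly_integral_add poly_integral_smult)
qed

text \<open>Cauchy-Schwarz against the constant 1, obtained from the nonnegative variance of
  \<open>f\<close> about its mean \<open>m\<close>.\<close>

lemma poly_integral_square_le:
  assumes "a \<le> b"
  shows "(poly_integral a b f)\<^sup>2 \<le> (b - a) * poly_integral a b (f\<^sup>2)"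
proof (cases "a = b")
  case True
  then show ?thesis by (simp add: poly_integral_def)
next
  case False
  with assms have ab: "b - a > 0" by simp
  define m where "m = poly_integral a b f / (b - a)"
  have "0 \<le> poly_integral a b ((f + [:-m:])\<^sup>2)" by (rule poly_integral_square_nonneg)
  also have "\<dots> = poly_integral a b (f\<^sup>2) - 2 * m * poly_integral a b f + m\<^sup>2 * (b - a)"
  proof -
    have "(f + [:-m:])\<^sup>2 = f\<^sup>2 - smult (2 * m) f + [:m\<^sup>2:]"
      by (rule poly_ext) (simp add: power2_eq_square algebra_simps)
    then show ?thesis using poly_integral_const[OF assms, of "m\<^sup>2"]
      by (simp add: poly_integral_add poly_integral_diff poly_integral_smult)
  qed
  also have "\<dots> = poly_integral a b (f\<^sup>2) - (poly_integral a b f)\<^sup>2 / (b - a)"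
  proof -
    have "poly_integral a b f = m * (b - a)" using ab by (simp add: m_def)
    then show ?thesis using ab by (simp add: power2_eq_square)
  qed
  finally show ?thesis using ab by (simp add: field_simps)
qed

text \<open>Each derivative costs one power of the linear factor, and the cofactor at
  \<open>a\<close> collects the falling factorial. For k < n this gives the zeros of the derivatives
  of \<open>bump n\<close> at the end points; for k = n it gives the normalization of the Legendre
  polynomials.\<close>

lemma higher_pderiv_linear_power_mult:
  "k \<le> n \<Longrightarrow> \<exists>h. (pderiv ^^ k) ([:-a, 1:] ^ n * g) = [:-a, 1:] ^ (n - k) * (h :: real poly)
     \<and> poly h a = (\<Prod>i<k. real (n - i)) * poly g a"
proof (induction k arbitrary: n g)
  case 0
  then show ?case by auto
next
  case (Suc k)
  then obtain m where n: "n = Suc m" "k \<le> m" by (cases n) auto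
  define g' where "g' = smult (real n) g + [:-a, 1:] * pderiv g"
  have d: "pderiv ([:-a, 1:] ^ n * g) = [:-a, 1:] ^ m * g'"
    unfolding n pderiv_mult pderiv_power_Suc g'_def
    by (simp add: algebra_simps pderiv_pCons n)
  obtain h where h: "(pderiv ^^ k) ([:-a, 1:] ^ m * g') = [:-a, 1:] ^ (m - k) * h"
    "poly h a = (\<Prod>i<k. real (m - i)) * poly g' a"
    using Suc.IH[OF n(2)] by blast
  have "poly g' a = real n * poly g a" by (simp add: g'_def)
  moreover have "(\<Prod>i<Suc k. real (n - i)) = real n * (\<Prod>i<k. real (m - i))"
    by (subst prod.lessThan_Suc_shift) (simp add: n)
  ultimately show ?case
    using h d n by (auto simp: funpow_swap1 simp del: mult_pCons_left)
qed

section \<open>Rodrigues' formula, orthogonality and the Legendre equation\<close>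

abbreviation bump :: "nat \<Rightarrow> real poly" where
  "bump n \<equiv> [:-1, 0, 1:] ^ n"

lemma bump_eq: "bump n = [:-1, 1:] ^ n * [:1, 1:] ^ n"
  by (simp flip: power_mult_distrib)

lemma prod_diff_fact: "(\<Prod>i<n. real (n - i)) = fact n"
  by (simp only: fact_prod_rev of_nat_prod atLeast0LessThan)

lemma poly_higher_pderiv_bump_less:
  assumes "k < n"
  shows "poly ((pderiv ^^ k) (bump n)) 1 = 0" "poly ((pderiv ^^ k) (bump n)) (-1) = 0"
proof -
  show "poly ((pderiv ^^ k) (bump n)) 1 = 0"
    using higher_pderiv_linear_power_mult[of k n 1 "[:1, 1:] ^ n"] assms
    by (auto simp: bump_eq simp del: mult_pCons_left)
  show "poly ((pderiv ^^ k) (bump n)) (-1) = 0"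
    using higher_pderiv_linear_power_mult[of k n "-1" "[:-1, 1:] ^ n"] assms
    by (auto simp: bump_eq mult.commute[of "[:-1,1:] ^ n"] simp del: mult_pCons_left)
qed

lemma legendre_at_1 [simp]: "poly (legendre n) 1 = 1"
proof -
  have "poly ((pderiv ^^ n) (bump n)) 1 = fact n * 2 ^ n"
    using higher_pderiv_linear_power_mult[of n n 1 "[:1, 1:] ^ n"]
    unfolding prod_diff_fact bump_eq by (auto simp del: mult_pCons_left)
  then show ?thesis by (simp add: legendre_def)
qed

lemma legendre_uminus: "poly (legendre n) (-x) = (-1) ^ n * poly (legendre n) x"
proof -
  have "pcompose ((pderiv ^^ k) f) [:0, -1:] = smult ((-1) ^ k) ((pderiv ^^ k) (pcompose f [:0, -1:]))"
    for k and f :: "real poly"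
  proof (induction k)
    case (Suc k)
    have "pcompose (pderiv h) [:0, -1:] = - pderiv (pcompose h [:0, -1:])" for h :: "real poly"
      by (simp add: pderiv_pcompose pderiv_pCons)
    then show ?case using Suc by (simp add: pderiv_smult)
  qed simp
  moreover have "pcompose (bump n) [:0, -1:] = bump n"
    by (rule poly_ext) (simp add: poly_pcompose)
  ultimately have "pcompose ((pderiv ^^ n) (bump n)) [:0, -1:] = smult ((-1) ^ n) ((pderiv ^^ n) (bump n))"
    by simp
  from arg_cong[OF this, of "\<lambda>f. poly f x"] show ?thesis
    by (simp add: legendre_def poly_pcompose)
qed

lemma legendre_at_minus_1 [simp]: "poly (legendre n) (-1) = (-1) ^ n"
  using legendre_uminus[of n 1] by simp

lemma degree_legendre [simp]: "degree (legendre n) = n"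
  by (simp add: legendre_def degree_higher_pderiv degree_power_eq)

lemma legendre_nonzero [simp]: "legendre n \<noteq> 0"
  using legendre_at_1[of n] by (metis poly_0 zero_neq_one)

text \<open>Repeated integration by parts; no boundary terms arise, because all derivatives of
  \<open>bump n\<close> of order below n vanish at both ends.\<close>

lemma poly_integral_higher_pderiv_bump:
  "k \<le> n \<Longrightarrow> poly_integral (-1) 1 (f * (pderiv ^^ n) (bump n))
     = (-1) ^ k * poly_integral (-1) 1 ((pderiv ^^ k) f * (pderiv ^^ (n - k)) (bump n))"
proof (induction k)
  case (Suc k)
  then have "n - k = Suc (n - Suc k)" by simp
  then have "poly_integral (-1) 1 ((pderiv ^^ k) f * (pderiv ^^ (n - k)) (bump n))
      = - poly_integral (-1) 1 ((pderiv ^^ Suc k) f * (pderiv ^^ (n - Suc k)) (bump n))"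
    using poly_higher_pderiv_bump_less[of "n - Suc k" n] Suc.prems by (simp add: poly_integral_by_parts)
  with Suc show ?case by simp
qed simp

lemma legendre_orthogonal:
  assumes "degree f < n"
  shows "poly_integral (-1) 1 (f * legendre n) = 0"
proof -
  have "(pderiv ^^ n) f = 0"
    using assms
    by (cases n) (auto simp: pderiv_eq_0_iff degree_higher_pderiv)
  then show ?thesis
    using poly_integral_higher_pderiv_bump[of n n f] by (simp add: legendre_def poly_integral_smult)
qed

text \<open>\<open>B = bump n\<close> satisfies the first-order equation (x^2 - 1) B' = 2 n x B. The
  claim is its derivative of order k + 1, and k = n is the Legendre equation up to scaling.\<close>

lemma higher_pderiv_bump_ode:
  "[:-1, 0, 1:] * (pderiv ^^ Suc (Suc k)) (bump n)
     + smult (2 * (real k + 1 - real n)) ([:0, 1:] * (pderiv ^^ Suc k) (bump n))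
     + smult ((real k + 1) * real k - 2 * real n * (real k + 1)) ((pderiv ^^ k) (bump n)) = 0"
proof (induction k)
  case 0
  have "[:-1, 0, 1:] * pderiv (bump n) = smult (2 * real n) ([:0, 1:] * bump n)"
  proof (cases n)
    case (Suc m)
    have "pderiv [:-1, 0, 1::real:] = smult 2 [:0, 1:]"
      by (simp add: pderiv_pCons)
    then show ?thesis
      unfolding Suc pderiv_power_Suc by (intro poly_ext) (simp add: algebra_simps)
  qed simp
  then have *: "poly (pderiv ([:-1, 0, 1:] * pderiv (bump n))) x = poly (pderiv (smult (2 * real n) ([:0, 1:] * bump n))) x" for x
    by simp
  have 1: "pderiv [:-1, 0, 1::real:] = smult 2 [:0, 1:]" "pderiv [:0, 1::real:] = 1"
    by (simp_all add: pderiv_pCons one_pCons)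
  show ?case
  proof (rule poly_ext)
    fix x
    show "poly ([:-1, 0, 1:] * (pderiv ^^ Suc (Suc 0)) (bump n)
     + smult (2 * (real 0 + 1 - real n)) ([:0, 1:] * (pderiv ^^ Suc 0) (bump n))
     + smult ((real 0 + 1) * real 0 - 2 * real n * (real 0 + 1)) ((pderiv ^^ 0) (bump n))) x = poly 0 x"
      using *[of x] unfolding pderiv_mult pderiv_smult 1
      by (simp add: algebra_simps del: mult_pCons_left mult_pCons_right)
  qed
next
  case (Suc k)
  define A where "A = (pderiv ^^ k) (bump n)"
  have 1: "pderiv [:-1, 0, 1::real:] = smult 2 [:0, 1:]" "pderiv [:0, 1::real:] = 1"
    by (simp_all add: pderiv_pCons one_pCons)
  have *: "poly (pderiv ([:-1, 0, 1:] * pderiv (pderiv A)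
     + smult (2 * (real k + 1 - real n)) ([:0, 1:] * pderiv A)
     + smult ((real k + 1) * real k - 2 * real n * (real k + 1)) A)) x = 0" for x
    using Suc by (simp add: A_def)
  have "[:-1, 0, 1:] * pderiv (pderiv (pderiv A))
     + smult (2 * (real (Suc k) + 1 - real n)) ([:0, 1:] * pderiv (pderiv A))
     + smult ((real (Suc k) + 1) * real (Suc k) - 2 * real n * (real (Suc k) + 1)) (pderiv A) = 0"
  proof (rule poly_ext)
    fix x
    show "poly ([:-1, 0, 1:] * pderiv (pderiv (pderiv A))
     + smult (2 * (real (Suc k) + 1 - real n)) ([:0, 1:] * pderiv (pderiv A))
     + smult ((real (Suc k) + 1) * real (Suc k) - 2 * real n * (real (Suc k) + 1)) (pderiv A)) x = poly 0 x"
      using *[of x] unfolding pderiv_add pderiv_mult pderiv_smult 1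
      by (simp add: algebra_simps del: mult_pCons_left mult_pCons_right)
  qed
  then show ?case by (simp add: A_def)
qed

definition lam :: "nat \<Rightarrow> real" where
  "lam n = real n * (real n + 1)"

lemma legendre_ode:
  "[:-1, 0, 1:] * pderiv (pderiv (legendre n)) + smult 2 ([:0, 1:] * pderiv (legendre n))
     = smult (lam n) (legendre n)"
proof -
  define A where "A = (pderiv ^^ n) (bump n)"
  define c :: real where "c = 1 / (2 ^ n * fact n)"
  have "[:-1, 0, 1:] * pderiv (pderiv A) + smult 2 ([:0, 1:] * pderiv A) + smult (- lam n) A = 0"
    using higher_pderiv_bump_ode[of n n] by (simp add: A_def lam_def algebra_simps)
  then have *: "poly ([:-1, 0, 1:] * pderiv (pderiv A) + smult 2 ([:0, 1:] * pderiv A) + smult (- lam n) A) x = 0" for x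
    by simp
  have **: "legendre n = smult c A"
    by (simp add: legendre_def A_def c_def)
  show ?thesis
  proof (rule poly_ext)
    fix x
    show "poly ([:-1, 0, 1:] * pderiv (pderiv (legendre n)) + smult 2 ([:0, 1:] * pderiv (legendre n))) x
      = poly (smult (lam n) (legendre n)) x"
      using arg_cong[OF *[of x], of "\<lambda>y. c * y"] by (simp add: ** pderiv_smult algebra_simps)
  qed
qed

lemma legendre_ode_poly:
  "(1 - x\<^sup>2) * poly (pderiv (pderiv (legendre n))) x = 2 * x * poly (pderiv (legendre n)) x - lam n * poly (legendre n) x"
  using arg_cong[OF legendre_ode[of n], of "\<lambda>f. poly f x"]
  by (simp add: algebra_simps power2_eq_square)

definition lobatto :: "nat \<Rightarrow> real poly" where
  "lobatto n = [:1, 0, -1:] * pderiv (legendre n)"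

lemma poly_lobatto: "poly (lobatto n) x = (1 - x\<^sup>2) * poly (pderiv (legendre n)) x"
  by (simp add: lobatto_def power2_eq_square algebra_simps)

text \<open>The Legendre equation in divergence form. It makes the nodes the zeros of a function
  whose derivative is again a Legendre polynomial.\<close>

lemma pderiv_lobatto: "pderiv (lobatto n) = smult (- lam n) (legendre n)"
proof -
  have "poly (pderiv (lobatto n)) x = poly (smult (- lam n) (legendre n)) x" for x
    using legendre_ode_poly[where x = x and n = n]
    unfolding lobatto_def pderiv_mult
    by (simp add: pderiv_pCons algebra_simps power2_eq_square del: mult_pCons_left mult_pCons_right)
  then show ?thesis by (rule poly_ext)
qed

text \<open>The leading coefficient of x L' is n times that of L, so x L' - n L has degree below n
  and is orthogonal to L. Integrating x L L' by parts, with L^2 = 1 at both ends, gives a second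
  equation for the same integral.\<close>

lemma poly_integral_legendre_square: "poly_integral (-1) 1 ((legendre n)\<^sup>2) = 2 / (2 * real n + 1)"
proof -
  define L where "L = legendre n"
  define R where "R = [:0, 1:] * pderiv L - smult (real n) L"
  have "poly_integral (-1) 1 (R * L) = 0"
  proof (cases "n = 0")
    case True
    then have "pderiv L = 0" by (simp add: L_def pderiv_eq_0_iff)
    then show ?thesis by (simp add: R_def True)
  next
    case False
    have "degree R \<le> n"
      unfolding R_def using False
      by (intro degree_diff_le order.trans[OF degree_mult_le])
        (auto simp: L_def degree_pderiv)
    moreover have "coeff R n = 0"
      using False by (cases n) (auto simp: R_def coeff_pderiv L_def)
    ultimately have "degree R < n"
      using False by (metis eq_zero_or_degree_less degree_0 neq0_conv)
    then show ?thesis unfolding L_def by (rule legendre_orthogonal)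
  qed
  moreover have "R * L = [:0, 1:] * L * pderiv L - smult (real n) (L\<^sup>2)"
    by (intro poly_ext) (simp add: R_def algebra_simps power2_eq_square)
  ultimately have 1: "poly_integral (-1) 1 ([:0, 1:] * L * pderiv L) = real n * poly_integral (-1) 1 (L\<^sup>2)"
    by (simp add: poly_integral_diff poly_integral_smult)
  have "pderiv ([:0, 1:] * L) * L = L\<^sup>2 + [:0, 1:] * L * pderiv L"
    by (intro poly_ext) (simp add: pderiv_mult pderiv_pCons algebra_simps power2_eq_square del: mult_pCons_left)
  then have "poly_integral (-1) 1 ([:0, 1:] * L * pderiv L) = 2 - poly_integral (-1) 1 (L\<^sup>2) - poly_integral (-1) 1 ([:0, 1:] * L * pderiv L)"
    by (subst poly_integral_by_parts)
      (simp_all add: poly_integral_add L_def flip: power_mult_distrib power_mult)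
  with 1 have "(2 * real n + 1) * poly_integral (-1) 1 (L\<^sup>2) = 2"
    by (simp add: algebra_simps)
  then show ?thesis by (simp add: L_def field_simps)
qed

lemma legendre_orthogonal':
  "poly_integral (-1) 1 (legendre m * legendre n) = (if m = n then 2 / (2 * real n + 1) else 0)"
proof -
  consider "m = n" | "m < n" | "n < m" by linarith
  then show ?thesis
  proof cases
    case 1
    then show ?thesis using poly_integral_legendre_square[of n] by (simp add: power2_eq_square)
  next
    case 2
    then show ?thesis using legendre_orthogonal[of "legendre m" n] by simp
  next
    case 3
    then show ?thesis using legendre_orthogonal[of "legendre n" m] by (simp add: mult.commute)
  qed
qed

text \<open>\<open>lobatto n\<close> vanishes at both ends, so only \<open>pderiv_lobatto\<close>
  contributes. Both the exactness of the quadrature and the diagonalization in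
  \<open>weighted_series\<close> rest on this identity.\<close>

lemma poly_integral_lobatto_mult:
  "poly_integral (-1) 1 (lobatto n * pderiv f) = lam n * poly_integral (-1) 1 (legendre n * f)"
  by (subst poly_integral_by_parts) (simp_all add: poly_lobatto pderiv_lobatto poly_integral_smult poly_integral_minus)

section \<open>Gauss--Lobatto quadrature\<close>

lemma Min_le_Max: "finite A \<Longrightarrow> A \<noteq> {} \<Longrightarrow> Min A \<le> Max A"
  by (meson Max_ge Max_in Min_le)

text \<open>Rolle's theorem with a count. Confining \<open>Y\<close> strictly between the extreme
  points keeps the zero found to the right of \<open>Max A\<close> distinct from the earlier
  ones.\<close>

lemma rolle_card:
  fixes f :: "real poly"
  assumes "finite Z" "Z \<noteq> {}" "\<And>z. z \<in> Z \<Longrightarrow> poly f z = 0"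
  shows "\<exists>Y. finite Y \<and> card Y = card Z - 1 \<and> Y \<subseteq> {Min Z<..<Max Z} \<and> (\<forall>y\<in>Y. poly (pderiv f) y = 0)"
  using assms
proof (induction Z rule: finite_linorder_max_induct)
  case (insert b A)
  show ?case
  proof (cases "A = {}")
    case True
    then show ?thesis by (intro exI[of _ "{}"]) auto
  next
    case False
    then obtain Y where Y: "finite Y" "card Y = card A - 1" "Y \<subseteq> {Min A<..<Max A}"
      "\<forall>y\<in>Y. poly (pderiv f) y = 0"
      using insert by blast
    have mb: "Max A < b" using insert False by simp
    have "poly f (Max A) = 0" "poly f b = 0"
      using insert.prems insert.hyps(1) False by (auto intro: Max_in)
    then obtain y where y: "Max A < y" "y < b" "poly (pderiv f) y = 0"
      using poly_MVT[OF mb, of f] mb by auto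
    have "Min (insert b A) = Min A" "Max (insert b A) = b"
      using mb Min_le_Max[OF insert.hyps(1) False]
      by (simp_all add: Min_insert[OF insert.hyps(1) False] Max_insert[OF insert.hyps(1) False] min_def max_def
          del: Max_less_iff Max_insert Min_insert)
    moreover have "y \<notin> Y" using Y(3) y(1) by auto
    moreover have "b \<notin> A" using insert.hyps by auto
    moreover have "card A \<noteq> 0" using insert.hyps False by simp
    moreover have "Min A < y" using y Min_le_Max[OF insert.hyps(1) False] by simp
    moreover have "Suc (card A - 1) = card A"
      using insert.hyps False by (metis Suc_pred' card_gt_0_iff)
    note facts = calculation this
    show ?thesis
    proof (intro exI[of _ "insert y Y"] conjI)
      show "insert y Y \<subseteq> {Min (insert b A)<..<Max (insert b A)}"
        using Y(3) y mb facts by fastforce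
    qed (use Y y insert.hyps(1) facts(3-) in \<open>simp_all add: card_insert_if\<close>)
  qed
qed simp

lemma higher_pderiv_bump_roots:
  "k \<le> n \<Longrightarrow> \<exists>Z. finite Z \<and> card Z = k \<and> Z \<subseteq> {-1<..<1} \<and> (\<forall>z\<in>Z. poly ((pderiv ^^ k) (bump n)) z = 0)"
proof (induction k)
  case (Suc k)
  then obtain Z where Z: "finite Z" "card Z = k" "Z \<subseteq> {-1<..<1}"
    "\<forall>z\<in>Z. poly ((pderiv ^^ k) (bump n)) z = 0"
    by auto
  \<comment> \<open>For k < n the end points are still zeros of the k-th derivative, so k + 2 zeros
    are available and Rolle leaves k + 1 of them.\<close>
  define Z' where "Z' = insert (-1) (insert 1 Z)"
  have c: "card Z' = k + 2" and f: "finite Z'" "Z' \<noteq> {}"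
    using Z by (auto simp: Z'_def card_insert_if)
  have m: "Min Z' = -1" "Max Z' = 1"
    using Z f(1) unfolding Z'_def by (intro Min_eqI Max_eqI; auto simp: subset_iff less_imp_le)+
  have "poly ((pderiv ^^ k) (bump n)) z = 0" if "z \<in> Z'" for z
    using that Z poly_higher_pderiv_bump_less[of k n] Suc.prems by (auto simp: Z'_def)
  from rolle_card[OF f this] show ?case by (simp add: c m)
next
  case 0
  show ?case by (rule exI[of _ "{}"]) simp
qed

definition gl_points :: "nat \<Rightarrow> real set" where
  "gl_points p = {x. poly (lobatto p) x = 0}"

lemma lobatto_nonzero: "1 \<le> p \<Longrightarrow> lobatto p \<noteq> 0"
  by (auto simp: lobatto_def pderiv_eq_0_iff simp del: mult_pCons_left)

lemma degree_lobatto: "1 \<le> p \<Longrightarrow> degree (lobatto p) = p + 1"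
  unfolding lobatto_def
  by (subst degree_mult_eq) (auto simp: degree_pderiv pderiv_eq_0_iff)

text \<open>The p interior zeros of the Legendre polynomial separate p - 1 zeros of its derivative.
  With the two end points this exhausts the degree p + 1 of \<open>lobatto p\<close>, so there are
  no further nodes.\<close>

lemma gl_eq:
  assumes "1 \<le> p"
  shows "finite (gl_points p)" "card (gl_points p) = p + 1" "gl_points p \<subseteq> {-1..1}" "1 \<in> gl_points p" "-1 \<in> gl_points p"
proof -
  obtain Z where Z: "finite Z" "card Z = p" "Z \<subseteq> {-1<..<1}" "\<forall>z\<in>Z. poly ((pderiv ^^ p) (bump p)) z = 0"
    using higher_pderiv_bump_roots[of p p] by auto
  then have "Z \<noteq> {}" using assms by auto
  moreover have "poly (legendre p) z = 0" if "z \<in> Z" for z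
    using Z that by (simp add: legendre_def)
  ultimately obtain Y where Y: "finite Y" "card Y = p - 1" "Y \<subseteq> {Min Z<..<Max Z}"
    "\<forall>y\<in>Y. poly (pderiv (legendre p)) y = 0"
    using rolle_card[of Z "legendre p"] Z by metis
  have "Min Z \<in> Z" "Max Z \<in> Z" using Z \<open>Z \<noteq> {}\<close> by auto
  with Y Z have Y1: "Y \<subseteq> {-1<..<1}" by fastforce
  let ?Y = "insert (-1) (insert 1 Y)"
  have c: "card ?Y = p + 1" using Y Y1 assms by (auto simp: card_insert_if)
  have sub: "?Y \<subseteq> gl_points p" using Y by (auto simp: gl_points_def poly_lobatto)
  show fin: "finite (gl_points p)"
    unfolding gl_points_def using poly_roots_finite[OF lobatto_nonzero[OF assms]] .
  have "card (gl_points p) \<le> p + 1"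
    using card_poly_roots_bound[OF lobatto_nonzero[OF assms]] degree_lobatto[OF assms] by (simp add: gl_points_def)
  with c sub fin have "gl_points p = ?Y" by (metis card_subset_eq card_mono le_antisym)
  then show "card (gl_points p) = p + 1" "gl_points p \<subseteq> {-1..1}" "1 \<in> gl_points p" "-1 \<in> gl_points p"
    using c Y1 by auto
qed

lemma gl_cases:
  assumes "z \<in> gl_points p"
  obtains "z = 1" | "z = -1" | "z \<noteq> 1" "z \<noteq> -1" "poly (pderiv (legendre p)) z = 0"
  using assms by (auto simp: gl_points_def poly_lobatto power2_eq_1_iff)

lemma gl_uminus: "x \<in> gl_points p \<Longrightarrow> - x \<in> gl_points p"
proof -
  have "legendre p = smult ((-1) ^ p) (pcompose (legendre p) [:0, -1:])"
    by (rule poly_ext) (simp add: poly_pcompose legendre_uminus flip: power_mult_distrib)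
  then have "pderiv (legendre p) = smult ((-1) ^ p) (pcompose (pderiv (legendre p)) [:0, -1:] * [:-1:])"
    using pderiv_smult[of "(-1) ^ p" "pcompose (legendre p) [:0, -1:]"]
    by (simp add: pderiv_pcompose pderiv_pCons)
  from arg_cong[OF this, of "\<lambda>f. poly f x"]
  show "x \<in> gl_points p \<Longrightarrow> - x \<in> gl_points p"
    by (auto simp: gl_points_def poly_lobatto poly_pcompose)
qed

text \<open>Indexed by the node rather than by its number: the quadrature does not need the order of
  the nodes.\<close>

definition lagrange_at :: "nat \<Rightarrow> real \<Rightarrow> real poly" where
  "lagrange_at p z = (\<Prod>y\<in>gl_points p - {z}. smult (1 / (z - y)) [:-y, 1:])"

lemma poly_lag:
  assumes "1 \<le> p" "z \<in> gl_points p" "y \<in> gl_points p"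
  shows "poly (lagrange_at p z) y = (if y = z then 1 else 0)"
proof (cases "y = z")
  case True
  have "poly (lagrange_at p z) z = (\<Prod>y\<in>gl_points p - {z}. poly (smult (1 / (z - y)) [:-y, 1:]) z)"
    by (simp only: lagrange_at_def poly_prod)
  also have "\<dots> = (\<Prod>y\<in>gl_points p - {z}. 1)"
    by (rule prod.cong) (auto simp: divide_simps)
  finally show ?thesis using True by simp
next
  case False
  then show ?thesis using assms gl_eq(1)[of p] by (auto simp: lagrange_at_def poly_prod intro!: prod_zero)
qed

lemma degree_lag: "1 \<le> p \<Longrightarrow> z \<in> gl_points p \<Longrightarrow> degree (lagrange_at p z) \<le> p"
proof -
  assume p: "1 \<le> p" "z \<in> gl_points p"
  have "degree (lagrange_at p z) \<le> (\<Sum>y\<in>gl_points p - {z}. degree (smult (1 / (z - y)) [:-y, 1:]))"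
    unfolding lagrange_at_def by (rule degree_prod_sum_le[unfolded o_def]) (use gl_eq(1)[OF p(1)] in auto)
  also have "\<dots> \<le> (\<Sum>y\<in>gl_points p - {z}. 1)"
    by (rule sum_mono) (auto intro: order.trans[OF degree_smult_le])
  also have "\<dots> = p" using gl_eq[OF p(1)] p by (simp add: card_Diff_singleton)
  finally show ?thesis .
qed

lemma lag_interpolation:
  assumes p: "1 \<le> p" and f: "degree f \<le> p"
  shows "f = (\<Sum>z\<in>gl_points p. smult (poly f z) (lagrange_at p z))"
proof -
  define g where "g = f - (\<Sum>z\<in>gl_points p. smult (poly f z) (lagrange_at p z))"
  have "degree g \<le> p"
    unfolding g_def
    by (intro degree_diff_le f degree_sum_le gl_eq(1)[OF p] order.trans[OF degree_smult_le] degree_lag p)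
  moreover have "gl_points p \<subseteq> {x. poly g x = 0}"
  proof
    fix x assume x: "x \<in> gl_points p"
    have "(\<Sum>z\<in>gl_points p. poly f z * poly (lagrange_at p z) x) = (\<Sum>z\<in>gl_points p. if z = x then poly f z else 0)"
      by (rule sum.cong) (auto simp: poly_lag[OF p _ x])
    also have "\<dots> = poly f x" using gl_eq(1)[OF p] x by (simp add: sum.delta)
    finally show "x \<in> {x. poly g x = 0}" by (simp add: g_def poly_sum)
  qed
  ultimately have "g = 0"
    using card_poly_roots_bound[of g] gl_eq(2)[OF p] card_mono[of "{x. poly g x = 0}" "gl_points p"]
      poly_roots_finite[of g] by fastforce
  then show ?thesis by (simp add: g_def)
qed

lemma poly_antiderivative: "\<exists>F :: real poly. pderiv F = f \<and> degree F \<le> Suc (degree f)"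
proof -
  define F where "F = (\<Sum>i\<le>degree f. monom (coeff f i / real (Suc i)) (Suc i))"
  have "pderiv F = (\<Sum>i\<le>degree f. monom (coeff f i) i)"
    unfolding F_def higher_pderiv_sum[of 1, simplified] by (rule sum.cong) (auto simp: pderiv_monom)
  also have "\<dots> = f" by (rule poly_as_sum_of_monoms)
  finally have "pderiv F = f" .
  moreover have "degree F \<le> Suc (degree f)"
    unfolding F_def by (rule degree_sum_le) (auto intro: order.trans[OF degree_monom_le])
  ultimately show ?thesis by blast
qed

text \<open>Division by \<open>lobatto p\<close> leaves a remainder that interpolation reproduces.
  The multiple of \<open>lobatto p\<close> integrates to 0: its quotient has an antiderivative of
  degree below p, which \<open>poly_integral_lobatto_mult\<close> pairs with the Legendre
  polynomial.\<close>

lemma poly_integral_eq_sum_lag: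
  assumes p: "1 \<le> p" and f: "degree f \<le> 2 * p - 1"
  shows "poly_integral (-1) 1 f = (\<Sum>z\<in>gl_points p. poly_integral (-1) 1 (lagrange_at p z) * poly f z)"
proof -
  define q r where "q = f div lobatto p" and "r = f mod lobatto p"
  have fqr: "f = lobatto p * q + r" by (simp add: q_def r_def)
  have dr: "degree r \<le> p"
    using degree_mod_less[OF lobatto_nonzero[OF p], of f] degree_lobatto[OF p] by (auto simp: r_def)
  have "poly_integral (-1) 1 (lobatto p * q) = 0"
  proof (cases "q = 0")
    case False
    have "degree f = degree (lobatto p * q)"
      using dr degree_lobatto[OF p] False lobatto_nonzero[OF p]
      by (subst fqr, intro degree_add_eq_left) (simp add: degree_mult_eq)
    also have "\<dots> = p + 1 + degree q"
      using False lobatto_nonzero[OF p] degree_lobatto[OF p] by (simp add: degree_mult_eq)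
    finally have "Suc (degree q) < p" using f p by simp
    then obtain F where F: "pderiv F = q" "degree F < p"
      using poly_antiderivative[of q] by (metis order.strict_trans1)
    then show ?thesis
      using poly_integral_lobatto_mult[of p F] legendre_orthogonal[of F p] by (simp add: mult.commute)
  qed simp
  then have "poly_integral (-1) 1 f = poly_integral (-1) 1 r"
    by (subst fqr) (simp add: poly_integral_add)
  also have "\<dots> = (\<Sum>z\<in>gl_points p. poly_integral (-1) 1 (lagrange_at p z) * poly r z)"
    by (subst lag_interpolation[OF p dr]) (simp add: poly_integral_sum poly_integral_smult mult.commute)
  also have "\<dots> = (\<Sum>z\<in>gl_points p. poly_integral (-1) 1 (lagrange_at p z) * poly f z)"
    by (rule sum.cong) (auto simp: gl_points_def fqr)
  finally show ?thesis .
qed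

lemma lam_pos: "1 \<le> p \<Longrightarrow> 0 < lam p"
  by (simp add: lam_def)

text \<open>The quadrature formula isolates one weight when it is applied to an \<open>f\<close> of
  admissible degree that vanishes at all other nodes. The \<open>f\<close> below are chosen so that
  integration by parts reduces their integral to end point values.\<close>

lemma lag_weight:
  assumes p: "1 \<le> p" and z: "z \<in> gl_points p"
  shows "poly_integral (-1) 1 (lagrange_at p z) * (lam p * (poly (legendre p) z)\<^sup>2) = 2"
proof -
  define L where "L = legendre p"
  have quad: "poly_integral (-1) 1 f = poly_integral (-1) 1 (lagrange_at p z) * poly f z"
    if "degree f \<le> 2 * p - 1" "\<And>y. y \<in> gl_points p \<Longrightarrow> y \<noteq> z \<Longrightarrow> poly f y = 0" for f
  proof -
    have "poly_integral (-1) 1 f = (\<Sum>y\<in>gl_points p. if y = z then poly_integral (-1) 1 (lagrange_at p z) * poly f z else 0)"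
      unfolding poly_integral_eq_sum_lag[OF p that(1)] by (rule sum.cong) (auto simp: that(2))
    then show ?thesis using gl_eq(1)[OF p] z by simp
  qed
  have pp: "lam p > 0" by (rule lam_pos[OF p])
  have sg: "((- 1 :: real) ^ p)\<^sup>2 = 1" by (simp flip: power_mult_distrib power_mult)
  have dL': "degree (pderiv L) = p - 1" by (simp add: L_def degree_pderiv)
  have end_case: "poly_integral (-1) 1 (lagrange_at p z) * (lam p * (poly (legendre p) z)\<^sup>2) = 2"
    if zs: "z = s" and s: "s = 1 \<or> s = -1" for s :: real
  proof -
    \<comment> \<open>The linear factor removes the opposite end point, L' removes the interior
      nodes. The second L' is what is integrated by parts; the other factors have derivative of
      degree below p, orthogonal to L.\<close>
    define f where "f = [:1, s:] * pderiv L * pderiv L"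
    have "degree f \<le> degree [:1, s:] + (p - 1) + (p - 1)"
      unfolding f_def using dL' degree_mult_le[of "[:1, s:] * pderiv L" "pderiv L"] degree_mult_le[of "[:1, s:]" "pderiv L"]
      by linarith
    then have df: "degree f \<le> 2 * p - 1" using p s by auto
    have "poly f y = 0" if "y \<in> gl_points p" "y \<noteq> z" for y
      using that(1) by (rule gl_cases) (use that s zs in \<open>auto simp: f_def L_def\<close>)
    from quad[OF df this] have q: "poly_integral (-1) 1 f = poly_integral (-1) 1 (lagrange_at p z) * poly f z" .
    have L's: "poly (pderiv L) s = s * lam p * poly L s / 2"
      using legendre_ode_poly[of s p] s by (auto simp: L_def)
    have "degree (pderiv ([:1, s:] * pderiv L)) < p"
      using degree_mult_le[of "[:1, s:]" "pderiv L"] dL' p s by (auto simp: degree_pderiv)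
    then have "poly_integral (-1) 1 (pderiv ([:1, s:] * pderiv L) * L) = 0"
      unfolding L_def by (rule legendre_orthogonal)
    note 0 = this
    have "poly_integral (-1) 1 f = lam p"
      using s
    proof
      assume "s = 1"
      then show ?thesis
        using L's 0 unfolding f_def
        by (subst poly_integral_by_parts) (simp_all add: L_def del: mult_pCons_left)
    next
      assume s1: "s = -1"
      then have "2 * poly (pderiv L) (-1) * poly L (-1) = - lam p * (poly L (-1))\<^sup>2"
        using L's by (simp add: power2_eq_square)
      then have "2 * poly (pderiv L) (-1) * poly L (-1) = - lam p"
        using sg by (simp add: L_def)
      then show ?thesis
        using s1 0 unfolding f_def
        by (subst poly_integral_by_parts) (simp_all del: mult_pCons_left)
    qed
    moreover have "poly f z = (lam p)\<^sup>2 * (poly L z)\<^sup>2 / 2"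
    proof -
      have "(poly (pderiv L) s)\<^sup>2 = (lam p)\<^sup>2 * (poly L s)\<^sup>2 / 4"
        using s by (auto simp: L's power_mult_distrib power_divide)
      moreover have "poly f s = 2 * (poly (pderiv L) s)\<^sup>2"
        using s by (auto simp: f_def power2_eq_square)
      ultimately show ?thesis by (simp add: zs)
    qed
    ultimately have "lam p * (poly_integral (-1) 1 (lagrange_at p z) * (lam p * (poly L z)\<^sup>2)) = lam p * 2"
      using q by (simp add: power2_eq_square algebra_simps)
    then show ?thesis using pp by (simp add: L_def)
  qed
  from z show ?thesis
  proof (cases rule: gl_cases)
    case 1
    then show ?thesis using end_case by blast
  next
    case 2
    then show ?thesis using end_case by blast
  next
    case 3
    have z1: "-1 < z" "z < 1" using gl_eq(3)[OF p] z 3 by (force simp: subset_iff)+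
    have "[:-z, 1:] dvd lobatto p" using z by (simp add: gl_points_def dvd_iff_poly_eq_0)
    then obtain g where g: "lobatto p = [:-z, 1:] * g" by (auto elim: dvdE)
    have gdeg: "degree g = p"
    proof -
      have "g \<noteq> 0" using g lobatto_nonzero[OF p] by auto
      then have "degree (lobatto p) = 1 + degree g" unfolding g by (subst degree_mult_eq) auto
      then show ?thesis using degree_lobatto[OF p] by simp
    qed
    have v: "poly (lobatto p) y = (y - z) * poly g y" for y by (simp add: g algebra_simps)
    have g': "pderiv (lobatto p) = g + [:-z, 1:] * pderiv g"
      unfolding g pderiv_mult by (simp add: pderiv_pCons)
    have v': "- lam p * poly L y = poly g y + (y - z) * poly (pderiv g) y" for y
      using arg_cong[OF g', of "\<lambda>f. poly f y"] by (simp add: pderiv_lobatto L_def algebra_simps del: pderiv_eq_0_iff)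
    have g0: "poly g y = 0" if "y \<in> gl_points p" "y \<noteq> z" for y
      using v[of y] that by (simp add: gl_points_def)
    have g1: "poly g 1 = 0" "poly g (-1) = 0" using g0 gl_eq(4,5)[OF p] z1 by auto
    have p2: "2 \<le> p" using gl_eq(1,2,4,5)[OF p] z 3 card_mono[of "gl_points p" "{z, 1, -1}"] by auto
    \<comment> \<open>Two integrations by parts move both derivatives to \<open>g\<close>, which
      vanishes at the ends; \<open>g''\<close> has degree p - 2 and is orthogonal to L, so only the
      boundary values of \<open>g' L\<close> remain.\<close>
    define f where "f = g * pderiv (pderiv L)"
    have df: "degree f \<le> 2 * p - 1"
      using degree_mult_le[of g "pderiv (pderiv L)"] gdeg dL' by (simp add: f_def degree_pderiv)
    have "poly f y = 0" if "y \<in> gl_points p" "y \<noteq> z" for y using g0[OF that] by (simp add: f_def)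
    from quad[OF df this] have q: "poly_integral (-1) 1 f = poly_integral (-1) 1 (lagrange_at p z) * poly f z" .
    have "poly_integral (-1) 1 (pderiv (pderiv g) * L) = 0"
      unfolding L_def by (rule legendre_orthogonal) (use gdeg p2 in \<open>simp add: degree_pderiv\<close>)
    then have "poly_integral (-1) 1 f = - (poly (pderiv g) 1 - poly (pderiv g) (-1) * poly L (-1))"
      unfolding f_def by (simp add: poly_integral_by_parts g1 L_def)
    moreover have "poly (pderiv g) 1 = - lam p / (1 - z)"
      using v'[of 1] g1 z1 by (simp add: L_def field_simps)
    moreover have "poly (pderiv g) (-1) * poly L (-1) = lam p / (1 + z)"
    proof -
      have "poly (pderiv g) (-1) * (1 + z) = lam p * poly L (-1)"
        using v'[of "-1"] g1 by (simp add: algebra_simps)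
      then have "poly (pderiv g) (-1) = lam p * poly L (-1) / (1 + z)"
        using z1 by (simp add: eq_divide_eq)
      then show ?thesis using sg by (simp add: L_def power2_eq_square)
    qed
    ultimately have I: "poly_integral (-1) 1 f = lam p / (1 - z) + lam p / (1 + z)" by simp
    have zz: "1 - z\<^sup>2 > 0" using z1 by (simp add: abs_square_less_1 abs_less_iff)
    have I1: "(1 - z\<^sup>2) * poly_integral (-1) 1 f = 2 * lam p"
    proof -
      have "1 - z\<^sup>2 = (1 - z) * (1 + z)" by (simp add: power2_eq_square algebra_simps)
      moreover have "u * w * (c / u + c / w) = c * w + c * u" if "u \<noteq> 0" "w \<noteq> 0" for u w c :: real
        using that by (simp add: distrib_left)
      from this[of "1 - z" "1 + z" "lam p"]
      have "(1 - z) * (1 + z) * (lam p / (1 - z) + lam p / (1 + z)) = lam p * (1 + z) + lam p * (1 - z)"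
        using z1 by simp
      ultimately show ?thesis by (simp only: I) (simp add: algebra_simps)
    qed
    have I2: "(1 - z\<^sup>2) * poly f z = (lam p)\<^sup>2 * (poly L z)\<^sup>2"
    proof -
      have "(1 - z\<^sup>2) * poly (pderiv (pderiv L)) z = - lam p * poly L z"
        using legendre_ode_poly[of z p] 3 by (simp add: L_def)
      moreover have "poly g z = - lam p * poly L z" using v'[of z] by simp
      moreover have "(1 - z\<^sup>2) * poly f z = poly g z * ((1 - z\<^sup>2) * poly (pderiv (pderiv L)) z)"
        by (simp add: f_def)
      ultimately show ?thesis by (simp only:) (simp add: power2_eq_square)
    qed
    have "lam p * (poly_integral (-1) 1 (lagrange_at p z) * (lam p * (poly L z)\<^sup>2))
        = poly_integral (-1) 1 (lagrange_at p z) * ((lam p)\<^sup>2 * (poly L z)\<^sup>2)"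
      by (simp add: power2_eq_square)
    also have "\<dots> = (1 - z\<^sup>2) * poly_integral (-1) 1 f"
      unfolding q I2[symmetric] by simp
    finally have "lam p * (poly_integral (-1) 1 (lagrange_at p z) * (lam p * (poly L z)\<^sup>2)) = lam p * 2"
      using I1 by simp
    then show ?thesis using pp by (simp add: L_def)
  qed
qed

definition gl_weight :: "nat \<Rightarrow> real \<Rightarrow> real" where
  "gl_weight p z = 2 / (lam p * (poly (legendre p) z)\<^sup>2)"

lemma legendre_gl_nonzero: "1 \<le> p \<Longrightarrow> z \<in> gl_points p \<Longrightarrow> poly (legendre p) z \<noteq> 0"
  using lag_weight[of p z] by auto

lemma wt_pos: "1 \<le> p \<Longrightarrow> z \<in> gl_points p \<Longrightarrow> 0 < gl_weight p z"
  using legendre_gl_nonzero[of p z] lam_pos[of p] by (simp add: gl_weight_def)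

lemma gl_quadrature:
  assumes p: "1 \<le> p" and f: "degree f \<le> 2 * p - 1"
  shows "poly_integral (-1) 1 f = (\<Sum>z\<in>gl_points p. gl_weight p z * poly f z)"
  unfolding poly_integral_eq_sum_lag[OF assms]
proof (rule sum.cong[OF refl])
  fix z assume z: "z \<in> gl_points p"
  then have "poly_integral (-1) 1 (lagrange_at p z) = gl_weight p z"
    using lag_weight[OF p z] legendre_gl_nonzero[OF p z] lam_pos[OF p] by (simp add: gl_weight_def eq_divide_eq)
  then show "poly_integral (-1) 1 (lagrange_at p z) * poly f z = gl_weight p z * poly f z" by simp
qed

text \<open>The square of a polynomial of degree p exceeds the exactness by one degree. Splitting
  off the multiple \<open>a\<close> of L isolates the error: on L^2 the quadrature gives 2 / p
  instead of 2 / (2 p + 1), a ratio between 1 and 3.\<close>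

lemma gl_discrete_norm:
  assumes p: "1 \<le> p" and f: "degree f \<le> p"
  shows "poly_integral (-1) 1 (f\<^sup>2) \<le> (\<Sum>z\<in>gl_points p. gl_weight p z * (poly f z)\<^sup>2)"
    and "(\<Sum>z\<in>gl_points p. gl_weight p z * (poly f z)\<^sup>2) \<le> 3 * poly_integral (-1) 1 (f\<^sup>2)"
proof -
  define L where "L = legendre p"
  define a where "a = coeff f p / coeff L p"
  define r where "r = f - smult a L"
  have lc: "coeff L p \<noteq> 0" unfolding L_def by (metis degree_legendre leading_coeff_0_iff legendre_nonzero)
  have "degree r \<le> p" unfolding r_def
    by (intro degree_diff_le f order.trans[OF degree_smult_le]) (simp add: L_def)
  moreover have "coeff r p = 0" using lc by (simp add: r_def a_def)
  ultimately have dr: "degree r < p"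
    using p by (metis eq_zero_or_degree_less degree_0 less_le_trans zero_less_one)
  have f': "f = r + smult a L" by (simp add: r_def)
  have rL: "poly_integral (-1) 1 (r * L) = 0" unfolding L_def by (rule legendre_orthogonal[OF dr])
  have "poly_integral (-1) 1 (f\<^sup>2) = poly_integral (-1) 1 (r\<^sup>2) + a\<^sup>2 * (2 / (2 * real p + 1))"
  proof -
    have "(smult a L)\<^sup>2 = smult (a\<^sup>2) (L\<^sup>2)" by (simp add: power2_eq_square)
    then show ?thesis unfolding f'
      by (simp add: poly_integral_power2_sum poly_integral_smult rL) (simp add: L_def poly_integral_legendre_square)
  qed
  moreover have "(\<Sum>z\<in>gl_points p. gl_weight p z * (poly f z)\<^sup>2) = poly_integral (-1) 1 (r\<^sup>2) + a\<^sup>2 * (2 / real p)"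
  proof -
    have "(\<Sum>z\<in>gl_points p. gl_weight p z * (poly f z)\<^sup>2)
      = (\<Sum>z\<in>gl_points p. gl_weight p z * poly (r\<^sup>2) z) + 2 * a * (\<Sum>z\<in>gl_points p. gl_weight p z * poly (r * L) z)
        + a\<^sup>2 * (\<Sum>z\<in>gl_points p. gl_weight p z * (poly L z)\<^sup>2)"
      unfolding f' by (simp add: sum_distrib_left algebra_simps power2_eq_square flip: sum.distrib)
    moreover have "(\<Sum>z\<in>gl_points p. gl_weight p z * poly (r\<^sup>2) z) = poly_integral (-1) 1 (r\<^sup>2)"
      using dr by (intro gl_quadrature[symmetric] p) (auto intro: order.trans[OF degree_power_le])
    moreover have "(\<Sum>z\<in>gl_points p. gl_weight p z * poly (r * L) z) = 0"
      unfolding rL[symmetric] using dr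
      by (intro gl_quadrature[symmetric] p order.trans[OF degree_mult_le]) (auto simp: L_def)
    moreover have "(\<Sum>z\<in>gl_points p. gl_weight p z * (poly L z)\<^sup>2) = (\<Sum>z\<in>gl_points p. 2 / lam p)"
      by (rule sum.cong) (use legendre_gl_nonzero[OF p] in \<open>auto simp: gl_weight_def L_def\<close>)
    moreover have "(\<Sum>z\<in>gl_points p. 2 / lam p) = 2 / real p"
      using p gl_eq(2)[OF p] by (simp add: lam_def divide_simps)
    ultimately show ?thesis by (simp only: poly_mult poly_power mult_zero_right add_0_right)
  qed
  moreover have "0 \<le> poly_integral (-1) 1 (r\<^sup>2)" by (rule poly_integral_square_nonneg)
  moreover have "a\<^sup>2 * (2 / (2 * real p + 1)) \<le> a\<^sup>2 * (2 / real p)"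
    using p by (intro mult_left_mono) (auto simp: field_simps)
  moreover have "a\<^sup>2 * (2 / real p) \<le> 3 * (a\<^sup>2 * (2 / (2 * real p + 1)))"
    using p mult_left_mono[of "2 / real p" "3 * (2 / (2 * real p + 1))" "a\<^sup>2"] by (simp add: field_simps)
  ultimately show "poly_integral (-1) 1 (f\<^sup>2) \<le> (\<Sum>z\<in>gl_points p. gl_weight p z * (poly f z)\<^sup>2)"
    and "(\<Sum>z\<in>gl_points p. gl_weight p z * (poly f z)\<^sup>2) \<le> 3 * poly_integral (-1) 1 (f\<^sup>2)"
    by linarith+
qed

section \<open>Sturm comparison for the nodes\<close>

lemma poly_pderiv2_lobatto: "poly (pderiv (pderiv (lobatto p))) x = - lam p * poly (pderiv (legendre p)) x"
  by (simp add: pderiv_lobatto pderiv_smult pderiv_minus)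

lemma lobatto_ode: "(1 - x\<^sup>2) * poly (pderiv (pderiv (lobatto p))) x = - lam p * poly (lobatto p) x"
  by (simp add: poly_pderiv2_lobatto poly_lobatto)

lemma poly_pderiv_lobatto: "poly (pderiv (lobatto p)) x = - lam p * poly (legendre p) x"
  by (simp add: pderiv_lobatto)

lemma lam_ge_2: "1 \<le> p \<Longrightarrow> 2 \<le> lam p"
  using mult_mono[of 1 "real p" 2 "real p + 1"] by (simp add: lam_def)

lemma one_minus_square_pos: "\<bar>x\<bar> < 1 \<Longrightarrow> 0 < 1 - (x::real)\<^sup>2"
  by (simp add: abs_square_less_1)

text \<open>Sonine's function \<open>S\<close> dominates L^2, increases on [0, 1] and equals 1 at
  the right end; parity covers the other half.\<close>

lemma legendre_abs_le_1:
  assumes p: "1 \<le> p" and x: "x \<in> {-1..1}"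
  shows "\<bar>poly (legendre p) x\<bar> \<le> 1"
proof -
  define L where "L = legendre p"
  have pp: "lam p > 0" by (rule lam_pos[OF p])
  define S where "S y = (poly L y)\<^sup>2 + (1 - y\<^sup>2) * (poly (pderiv L) y)\<^sup>2 / lam p" for y
  have der: "(S has_real_derivative 2 * y * (poly (pderiv L) y)\<^sup>2 / lam p) (at y)" for y
  proof -
    have "(S has_real_derivative 2 * poly L y * poly (pderiv L) y
        + (- 2 * y * (poly (pderiv L) y)\<^sup>2 + (1 - y\<^sup>2) * (2 * poly (pderiv L) y * poly (pderiv (pderiv L)) y)) / lam p) (at y)"
      unfolding S_def using pp by (auto intro!: derivative_eq_intros)
    moreover have "(1 - y\<^sup>2) * (2 * poly (pderiv L) y * poly (pderiv (pderiv L)) y)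
      = 2 * poly (pderiv L) y * (2 * y * poly (pderiv L) y - lam p * poly L y)"
      unfolding L_def legendre_ode_poly[symmetric] by (simp add: algebra_simps)
    ultimately show ?thesis using pp by (simp add: field_simps power2_eq_square)
  qed
  have pos: "(poly L y)\<^sup>2 \<le> 1" if "0 \<le> y" "y \<le> 1" for y
  proof -
    have "S y \<le> S 1"
      using that(2) by (rule DERIV_nonneg_imp_nondecreasing) (use that pp der in \<open>force intro!: exI divide_nonneg_pos\<close>)
    moreover have "S 1 = 1" by (simp add: S_def L_def)
    moreover have "(poly L y)\<^sup>2 \<le> S y"
      using pp that by (simp add: S_def abs_square_le_1)
    ultimately show ?thesis by simp
  qed
  have "(poly L x)\<^sup>2 \<le> 1"
  proof (cases "0 \<le> x")
    case False
    then have "(poly L (-x))\<^sup>2 \<le> 1" using x by (intro pos) auto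
    then show ?thesis by (simp add: L_def legendre_uminus power_mult_distrib flip: power_mult)
  qed (use pos x in auto)
  then show ?thesis by (simp add: L_def abs_square_le_1)
qed

text \<open>A second-order Taylor bound at 1 by bootstrapping: |L| <= 1 bounds
  \<open>lobatto p\<close> linearly, hence L' by \<open>lam p\<close>, hence L from below by a
  linear function, and one more integration gives the claim.\<close>

lemma lobatto_le_near_1:
  assumes p: "1 \<le> p" and x: "0 \<le> x" "x \<le> 1"
  shows "lam p * (1 - x) - (lam p)\<^sup>2 * (1 - x)\<^sup>2 / 2 \<le> poly (lobatto p) x"
proof -
  define l where "l = lam p"
  have l: "l > 0" using lam_pos[OF p] by (simp add: l_def)
  have v: "\<bar>poly (lobatto p) y\<bar> \<le> l * (1 - y)" if "0 \<le> y" "y \<le> 1" for y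
  proof -
    have "\<exists>z. y \<le> z \<and> z \<le> 1 \<and> poly (lobatto p) 1 - poly (lobatto p) y = (1 - y) * poly (pderiv (lobatto p)) z"
    proof (cases "y < 1")
      case True
      then show ?thesis using poly_MVT[OF True, of "lobatto p"] by (meson less_imp_le)
    qed (use that in auto)
    then obtain z where z: "y \<le> z" "z \<le> 1" "poly (lobatto p) y = (1 - y) * (l * poly (legendre p) z)"
      by (auto simp: poly_pderiv_lobatto l_def poly_lobatto)
    then have "\<bar>poly (lobatto p) y\<bar> = (1 - y) * l * \<bar>poly (legendre p) z\<bar>"
      using that l by (simp add: abs_mult)
    also have "\<dots> \<le> (1 - y) * l * 1"
      using that l z legendre_abs_le_1[OF p, of z] by (intro mult_left_mono) auto
    finally show ?thesis by (simp add: mult.commute)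
  qed
  have L': "poly (pderiv (legendre p)) y \<le> l" if "0 \<le> y" "y < 1" for y
  proof -
    have "(1 - y) * ((1 + y) * poly (pderiv (legendre p)) y) = poly (lobatto p) y"
      by (simp add: poly_lobatto power2_eq_square algebra_simps)
    also have "\<dots> \<le> (1 - y) * l" using v[of y] that by (simp add: mult.commute)
    finally have 1: "(1 + y) * poly (pderiv (legendre p)) y \<le> l" using that by simp
    show ?thesis
    proof (cases "poly (pderiv (legendre p)) y \<le> 0")
      case False
      then have "1 * poly (pderiv (legendre p)) y \<le> (1 + y) * poly (pderiv (legendre p)) y"
        using that by (intro mult_right_mono) auto
      then show ?thesis using 1 by simp
    qed (use l in auto)
  qed
  have L: "1 - l * (1 - y) \<le> poly (legendre p) y" if "0 \<le> y" "y \<le> 1" for y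
  proof (cases "y < 1")
    case True
    obtain z where z: "y < z" "z < 1" "poly (legendre p) 1 - poly (legendre p) y = (1 - y) * poly (pderiv (legendre p)) z"
      using poly_MVT[OF True] by blast
    have "(1 - y) * poly (pderiv (legendre p)) z \<le> (1 - y) * l"
      using z that by (intro mult_left_mono L') auto
    then show ?thesis using z(3) by (simp add: mult.commute)
  qed (use that in auto)
  define G where "G y = poly (lobatto p) y - l * (1 - y) + l\<^sup>2 * (1 - y)\<^sup>2 / 2" for y
  have der: "(G has_real_derivative - (l * (poly (legendre p) y - 1 + l * (1 - y)))) (at y)" for y
    unfolding G_def by (auto intro!: derivative_eq_intros simp: poly_pderiv_lobatto l_def field_simps power2_eq_square)
  have "G 1 \<le> G x"
    using x(2)
  proof (rule DERIV_nonpos_imp_nonincreasing)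
    fix y assume "x \<le> y" "y \<le> 1"
    then have "0 \<le> l * (poly (legendre p) y - 1 + l * (1 - y))"
      using L[of y] x l by simp
    then show "\<exists>d. (G has_real_derivative d) (at y) \<and> d \<le> 0"
      using der[of y] by (intro exI conjI) auto
  qed
  moreover have "G 1 = 0" by (simp add: G_def poly_lobatto)
  ultimately show ?thesis by (simp add: G_def l_def)
qed

text \<open>The parabola of \<open>lobatto_le_near_1\<close> is positive for 0 <
  \<open>lam p * (1 - z)\<close> < 2, so no node lies there.\<close>

lemma gl_dist_1:
  assumes p: "1 \<le> p" and z: "z \<in> gl_points p" "z \<noteq> 1"
  shows "2 \<le> lam p * (1 - z)"
proof (rule ccontr)
  assume "\<not> ?thesis"
  then have less: "lam p * (1 - z) < 2" by simp
  have z1: "z < 1" using gl_eq(3)[OF p] z by force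
  \<comment> \<open>Since \<open>lam p\<close> is at least 2, a node this close to 1 is nonnegative,
    as the Taylor bound requires.\<close>
  have "2 * (1 - z) \<le> lam p * (1 - z)"
    using lam_ge_2[OF p] z1 by (intro mult_right_mono) auto
  then have "0 \<le> z" using less by simp
  have "0 < lam p * (1 - z) * (2 - lam p * (1 - z)) / 2"
    using less z1 lam_pos[OF p] by simp
  also have "\<dots> = lam p * (1 - z) - (lam p)\<^sup>2 * (1 - z)\<^sup>2 / 2"
    by (simp add: power2_eq_square field_simps)
  also have "\<dots> \<le> poly (lobatto p) z" using \<open>0 \<le> z\<close> z1 by (intro lobatto_le_near_1 p) auto
  finally show False using z by (simp add: gl_points_def)
qed

lemma gl_interior:
  assumes p: "1 \<le> p" and z: "z \<in> gl_points p" "\<bar>z\<bar> < 1"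
  shows "2 / lam p \<le> 1 - z\<^sup>2"
proof -
  have "2 \<le> lam p * (1 - \<bar>z\<bar>)"
    using gl_dist_1[OF p, of "\<bar>z\<bar>"] gl_uminus z by (cases "0 \<le> z") auto
  also have "\<dots> \<le> lam p * (1 - z\<^sup>2)"
    using z lam_pos[OF p] power_decreasing[of 1 2 "\<bar>z\<bar>"] by (intro mult_left_mono) auto
  finally show ?thesis using lam_pos[OF p] by (simp add: field_simps)
qed

definition consec :: "nat \<Rightarrow> real \<Rightarrow> real \<Rightarrow> bool" where
  "consec p a b \<longleftrightarrow> a \<in> gl_points p \<and> b \<in> gl_points p \<and> a < b \<and> (\<forall>x\<in>{a<..<b}. x \<notin> gl_points p)"

lemma consec_bounds: "1 \<le> p \<Longrightarrow> consec p a b \<Longrightarrow> -1 \<le> a \<and> a < b \<and> b \<le> 1"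
  using gl_eq(3)[of p] by (force simp: consec_def)

lemma consec_uminus: "consec p a b \<Longrightarrow> consec p (-b) (-a)"
  unfolding consec_def using gl_uminus[of _ p] by force

lemma consec_sign:
  assumes "consec p a b"
  obtains e :: real where "e = 1 \<or> e = -1" "\<And>x. x \<in> {a<..<b} \<Longrightarrow> 0 < e * poly (lobatto p) x"
proof -
  define m where "m = (a + b) / 2"
  have m: "m \<in> {a<..<b}" using assms by (auto simp: m_def consec_def)
  have nz: "poly (lobatto p) x \<noteq> 0" if "x \<in> {a<..<b}" for x
    using assms that by (auto simp: consec_def gl_points_def)
  define e where "e = sgn (poly (lobatto p) m)"
  have e: "e = 1 \<or> e = -1" using nz[OF m] by (auto simp: e_def sgn_real_def)
  have "0 < e * poly (lobatto p) x" if x: "x \<in> {a<..<b}" for x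
  proof (rule ccontr)
    assume "\<not> ?thesis"
    then have "poly (smult e (lobatto p)) x \<le> 0" by simp
    moreover have "0 \<le> poly (smult e (lobatto p)) m" by (simp add: e_def sgn_real_def)
    ultimately have "\<exists>y\<in>closed_segment x m. poly (smult e (lobatto p)) y = 0"
      using IVT'[of "poly (smult e (lobatto p))" x 0 m] IVT2'[of "poly (smult e (lobatto p))" x 0 m]
      by (cases "x \<le> m") (force simp: closed_segment_eq_real_ivl intro!: continuous_intros)+
    then obtain y where y: "y \<in> closed_segment x m" "poly (lobatto p) y = 0" using e by auto
    have "y \<in> {a<..<b}" using y(1) x m by (auto simp: closed_segment_eq_real_ivl split: if_splits)
    with nz y show False by blast
  qed
  with e that show thesis by blast
qed

text \<open>The right-hand side contains the Wronskian of \<open>lobatto p\<close> and \<open>sin (k (x - a))\<close>.\<close>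

lemma sturm_wronskian:
  assumes p: "1 \<le> p" and ab: "consec p a b" and e: "\<And>x. x \<in> {a<..<b} \<Longrightarrow> 0 < e * poly (lobatto p) x"
    and c: "a < c" "c \<le> b" and k: "0 \<le> k" "k * (c - a) \<le> pi"
    and d: "\<And>x. x \<in> {a<..<c} \<Longrightarrow> 0 \<le> d * (k\<^sup>2 - lam p / (1 - x\<^sup>2))"
  shows "0 \<le> d * e * (poly (pderiv (lobatto p)) c * sin (k * (c - a)) - k * poly (lobatto p) c * cos (k * (c - a)))"
proof -
  \<comment> \<open>The derivative of the bracket is (k^2 - lam p / (1 - x^2)) v sin(k (x - a)), and
    the sine is nonnegative up to \<open>c\<close>. With \<open>d\<close> equal to -1 or 1 the
    argument serves for coefficients above or below k^2.\<close>
  define W where "W x = d * e * (poly (pderiv (lobatto p)) x * sin (k * (x - a)) - k * poly (lobatto p) x * cos (k * (x - a)))" for x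
  have "W a \<le> W c"
  proof (rule DERIV_nonneg_imp_increasing_open[where f = W])
    fix x assume x: "a < x" "x < c"
    have "x\<^sup>2 < 1" using x c consec_bounds[OF p ab] by (simp add: abs_square_less_1 abs_less_iff)
    then have v'': "poly (pderiv (pderiv (lobatto p))) x = - (lam p / (1 - x\<^sup>2)) * poly (lobatto p) x"
      using lobatto_ode[of x p] by (simp add: field_simps)
    have "k * (x - a) \<le> k * (c - a)" using x k by (intro mult_left_mono) auto
    then have "0 \<le> sin (k * (x - a))" using x k by (intro sin_ge_zero) auto
    moreover have "0 \<le> d * (k\<^sup>2 - lam p / (1 - x\<^sup>2))" "0 \<le> e * poly (lobatto p) x"
      using d[of x] e[of x] x c by auto
    ultimately have "0 \<le> d * (k\<^sup>2 - lam p / (1 - x\<^sup>2)) * (e * poly (lobatto p) x) * sin (k * (x - a))"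
      by simp
    moreover have "(W has_real_derivative d * (k\<^sup>2 - lam p / (1 - x\<^sup>2)) * (e * poly (lobatto p) x) * sin (k * (x - a))) (at x)"
      unfolding W_def by (auto intro!: derivative_eq_intros simp: v'' algebra_simps power2_eq_square)
    ultimately show "\<exists>y. (W has_real_derivative y) (at x) \<and> 0 \<le> y" by blast
  qed (use c in \<open>auto simp: W_def intro!: continuous_intros\<close>)
  moreover have "W a = 0" using ab by (simp add: W_def consec_def gl_points_def)
  ultimately have "0 \<le> W c" by simp
  then show ?thesis by (simp only: W_def)
qed

text \<open>k^2 is a lower bound for the coefficient on the gap. If the comparison sine completed
  its half period at some c inside the gap, the Wronskian there would force \<open>lobatto p\<close>
  to have the wrong sign at c.\<close>

lemma gap_upper:
  assumes p: "1 \<le> p" and ab: "consec p a b" and t: "0 \<le> t" "t < 1"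
    and tx: "\<And>x. x \<in> {a<..<b} \<Longrightarrow> t\<^sup>2 \<le> x\<^sup>2"
  shows "lam p * (b - a)\<^sup>2 \<le> pi\<^sup>2 * (1 - t\<^sup>2)"
proof (rule ccontr)
  assume neg: "\<not> ?thesis"
  have pp: "lam p > 0" by (rule lam_pos[OF p])
  have t2: "1 - t\<^sup>2 > 0" using t by (intro one_minus_square_pos) auto
  define k where "k = sqrt (lam p / (1 - t\<^sup>2))"
  have k: "k > 0" "k\<^sup>2 = lam p / (1 - t\<^sup>2)" using pp t2 by (auto simp: k_def)
  obtain e where e: "e = 1 \<or> e = -1" "\<And>x. x \<in> {a<..<b} \<Longrightarrow> 0 < e * poly (lobatto p) x"
    using consec_sign[OF ab] by blast
  have "pi\<^sup>2 < k\<^sup>2 * (b - a)\<^sup>2" using neg t2 by (simp add: k field_simps)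
  then have "pi < k * (b - a)"
    using k(1) consec_bounds[OF p ab] by (intro power2_less_imp_less[of pi]) (auto simp: power_mult_distrib)
  then have c: "a < a + pi / k" "a + pi / k < b" using k by (simp_all add: field_simps)
  have "0 \<le> -1 * e * (poly (pderiv (lobatto p)) (a + pi / k) * sin (k * (a + pi / k - a))
      - k * poly (lobatto p) (a + pi / k) * cos (k * (a + pi / k - a)))"
  proof (rule sturm_wronskian[OF p ab e(2)])
    fix x assume x: "x \<in> {a<..<a + pi / k}"
    then have "x\<^sup>2 < 1" using c consec_bounds[OF p ab] by (simp add: abs_square_less_1 abs_less_iff)
    then have "lam p / (1 - t\<^sup>2) \<le> lam p / (1 - x\<^sup>2)"
      using tx[of x] x c pp by (intro divide_left_mono) auto
    then show "0 \<le> -1 * (k\<^sup>2 - lam p / (1 - x\<^sup>2))" by (simp add: k)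
  qed (use c k in auto)
  then have "k * (e * poly (lobatto p) (a + pi / k)) \<le> 0" using k by (simp add: mult.left_commute)
  moreover have "0 < e * poly (lobatto p) (a + pi / k)" using c by (intro e(2)) auto
  ultimately show False using mult_pos_pos[OF k(1)] by fastforce
qed

text \<open>Here k^2 is an upper bound for the coefficient. If the sine were still positive at
  \<open>b\<close>, the Wronskian would force a nonnegative signed slope there, whereas
  \<open>lobatto p\<close> arrives at its simple zero \<open>b\<close> with a strictly negative
  one.\<close>

lemma gap_lower:
  assumes p: "1 \<le> p" and ab: "consec p a b" and t: "0 \<le> t" "t < 1"
    and tx: "\<And>x. x \<in> {a<..<b} \<Longrightarrow> x\<^sup>2 \<le> t\<^sup>2"
  shows "pi\<^sup>2 * (1 - t\<^sup>2) \<le> lam p * (b - a)\<^sup>2"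
proof (rule ccontr)
  assume neg: "\<not> ?thesis"
  have pp: "lam p > 0" by (rule lam_pos[OF p])
  have t2: "1 - t\<^sup>2 > 0" using t by (intro one_minus_square_pos) auto
  define k where "k = sqrt (lam p / (1 - t\<^sup>2))"
  have k: "k > 0" "k\<^sup>2 = lam p / (1 - t\<^sup>2)" using pp t2 by (auto simp: k_def)
  obtain e where e: "e = 1 \<or> e = -1" "\<And>x. x \<in> {a<..<b} \<Longrightarrow> 0 < e * poly (lobatto p) x"
    using consec_sign[OF ab] by blast
  have a_b: "a < b" using ab by (simp add: consec_def)
  have vb: "poly (lobatto p) b = 0" using ab by (simp add: consec_def gl_points_def)
  have "k\<^sup>2 * (b - a)\<^sup>2 < pi\<^sup>2" using neg t2 by (simp add: k field_simps)
  then have kpi: "k * (b - a) < pi"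
    using k(1) by (intro power2_less_imp_less[of _ pi]) (auto simp: power_mult_distrib)
  have "0 \<le> 1 * e * (poly (pderiv (lobatto p)) b * sin (k * (b - a)) - k * poly (lobatto p) b * cos (k * (b - a)))"
  proof (rule sturm_wronskian[OF p ab e(2)])
    fix x assume x: "x \<in> {a<..<b}"
    have "lam p / (1 - x\<^sup>2) \<le> lam p / (1 - t\<^sup>2)"
      using tx[OF x] t2 pp by (intro divide_left_mono) auto
    then show "0 \<le> 1 * (k\<^sup>2 - lam p / (1 - x\<^sup>2))" by (simp add: k)
  qed (use a_b k kpi in auto)
  then have nn: "0 \<le> e * poly (pderiv (lobatto p)) b * sin (k * (b - a))" by (simp add: vb)
  have "e * poly (pderiv (lobatto p)) b < 0"
  proof -
    have "poly (pderiv (lobatto p)) b \<noteq> 0"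
      using legendre_gl_nonzero[OF p, of b] pp ab by (auto simp: poly_pderiv_lobatto consec_def)
    moreover have "\<not> 0 < poly (pderiv (smult e (lobatto p))) b"
    proof
      assume "0 < poly (pderiv (smult e (lobatto p))) b"
      from DERIV_pos_inc_left[OF poly_DERIV this]
      obtain d where d: "d > 0" "\<And>h. 0 < h \<Longrightarrow> h < d \<Longrightarrow> poly (smult e (lobatto p)) (b - h) < poly (smult e (lobatto p)) b"
        by blast
      define h where "h = min (d / 2) ((b - a) / 2)"
      have "0 < h" "h < d" "b - h \<in> {a<..<b}" using d(1) a_b by (auto simp: h_def min_def field_simps)
      with d(2)[of h] e(2)[of "b - h"] vb show False by simp
    qed
    ultimately show ?thesis using e(1) by (auto simp: pderiv_smult pderiv_minus)
  qed
  moreover have "0 < sin (k * (b - a))" using a_b k kpi by (intro sin_gt_zero) auto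
  ultimately have "e * poly (pderiv (lobatto p)) b * sin (k * (b - a)) < 0" by (rule mult_neg_pos)
  with nn show False by simp
qed

section \<open>Envelopes and weights\<close>

context
  fixes p :: nat assumes p: "1 \<le> p"
begin

lemma sqrt_derivative:
  assumes "\<bar>x\<bar> < 1"
  shows "((\<lambda>x. sqrt (1 - x\<^sup>2)) has_real_derivative - x * (1 / sqrt (1 - x\<^sup>2))) (at x)"
    "((\<lambda>x. 1 / sqrt (1 - x\<^sup>2)) has_real_derivative x * (1 / sqrt (1 - x\<^sup>2)) ^ 3) (at x)"
proof -
  have pos: "0 < 1 - x\<^sup>2" by (rule one_minus_square_pos[OF assms])
  show 1: "((\<lambda>x. sqrt (1 - x\<^sup>2)) has_real_derivative - x * (1 / sqrt (1 - x\<^sup>2))) (at x)"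
    using pos by (auto intro!: derivative_eq_intros simp: field_simps)
  show "((\<lambda>x. 1 / sqrt (1 - x\<^sup>2)) has_real_derivative x * (1 / sqrt (1 - x\<^sup>2)) ^ 3) (at x)"
  proof -
    have "((\<lambda>x. inverse (sqrt (1 - x\<^sup>2))) has_real_derivative
        - (inverse (sqrt (1 - x\<^sup>2)) * (- x * (1 / sqrt (1 - x\<^sup>2))) * inverse (sqrt (1 - x\<^sup>2)))) (at x)"
      by (rule DERIV_inverse'[OF 1]) (use pos in auto)
    then show ?thesis by (simp add: inverse_eq_divide power3_eq_cube)
  qed
qed

text \<open>
  In the variable \<open>\<theta> = arccos x\<close> and with \<open>y = v / sqrt (sin \<theta>)\<close>, where \<open>v\<close> is \<open>lobatto p\<close>, the
  equation for \<open>v\<close> becomes \<open>y'' + Q y = 0\<close> with \<open>Q = lam p + 1/4 - 3 / (4 (sin \<theta>)\<^sup>2)\<close>. The function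
  below is the energy \<open>y'\<^sup>2 + Q y\<^sup>2\<close>, which is monotone because \<open>Q\<close> is.
\<close>

lemma envelope_antimono:
  assumes x: "0 \<le> x" "x \<le> z" "z < 1" "poly (lobatto p) x = 0" "poly (lobatto p) z = 0"
  shows "sqrt (1 - z\<^sup>2) * (poly (legendre p) z)\<^sup>2 \<le> sqrt (1 - x\<^sup>2) * (poly (legendre p) x)\<^sup>2"
proof -
  define l where "l = lam p"
  define v v' where "v = poly (lobatto p)" and "v' = poly (pderiv (lobatto p))"
  define S I :: "real \<Rightarrow> real" where "S y = sqrt (1 - y\<^sup>2)" and "I y = 1 / sqrt (1 - y\<^sup>2)" for y
  \<comment> \<open>\<open>S\<close> is sin \<theta> and \<open>I\<close> its reciprocal; this is
    the energy multiplied out in x. At a node v = 0, and only the first term is left, a multiple of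
    sqrt (1 - x^2) L^2.\<close>
  define E where "E y = S y * (v' y)\<^sup>2 + y * v y * v' y * I y
    + (v y)\<^sup>2 * (l * I y - I y ^ 3 / 2)" for y
  have der: "(E has_real_derivative - (3 / 2 * y * (v y)\<^sup>2 * I y ^ 5)) (at y)"
    if y: "\<bar>y\<bar> < 1" for y
  proof -
    define w where "w = poly (pderiv (pderiv (lobatto p))) y"
    have pos: "0 < 1 - y\<^sup>2" by (rule one_minus_square_pos[OF y])
    have Si: "S y * I y = 1" "y\<^sup>2 + (S y)\<^sup>2 = 1" using pos by (auto simp: S_def I_def)
    have D: "(S has_real_derivative - y * I y) (at y)" "(I has_real_derivative y * I y ^ 3) (at y)"
      "(v has_real_derivative v' y) (at y)" "(v' has_real_derivative w) (at y)"
      unfolding S_def I_def v_def v'_def w_def by (intro sqrt_derivative[OF y] poly_DERIV)+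
    have "(1 - y\<^sup>2) * w = - l * v y"
      using lobatto_ode[of y p] by (simp add: w_def l_def v_def)
    then have w: "w = - l * v y * (I y)\<^sup>2" using Si by algebra
    have d: "(E has_real_derivative
        (- y * I y) * (v' y)\<^sup>2 + S y * (2 * v' y * w)
        + (((1 * v y + y * v' y) * v' y + y * v y * w) * I y + y * v y * v' y * (y * I y ^ 3))
        + (2 * v y * v' y * (l * I y - I y ^ 3 / 2) + (v y)\<^sup>2 * (l * (y * I y ^ 3) - 3 * (I y)\<^sup>2 * (y * I y ^ 3) / 2))) (at y)"
      unfolding E_def using D by (auto intro!: derivative_eq_intros simp: field_simps power2_eq_square)
    show ?thesis
      by (rule DERIV_cong[OF d]) (use Si w in algebra)
  qed
  have "E z \<le> E x"
    using x(2)
  proof (rule DERIV_nonpos_imp_nonincreasing)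
    fix y assume y: "x \<le> y" "y \<le> z"
    then have "\<bar>y\<bar> < 1" using x by simp
    moreover have "0 \<le> 3 / 2 * y * (v y)\<^sup>2 * I y ^ 5"
      unfolding I_def using x y one_minus_square_pos[OF calculation] by simp
    ultimately show "\<exists>d. (E has_real_derivative d) (at y) \<and> d \<le> 0"
      using der by (metis neg_le_0_iff_le)
  qed
  then have "l\<^sup>2 * (sqrt (1 - z\<^sup>2) * (poly (legendre p) z)\<^sup>2) \<le> l\<^sup>2 * (sqrt (1 - x\<^sup>2) * (poly (legendre p) x)\<^sup>2)"
    using x by (simp add: E_def S_def I_def v_def v'_def poly_pderiv_lobatto l_def power_mult_distrib mult.left_commute)
  moreover have "l\<^sup>2 > 0" using lam_pos[OF p] by (simp add: l_def)
  ultimately show ?thesis by simp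
qed

text \<open>
  The same device for \<open>u = sqrt (sin \<theta>) L\<close>, where \<open>L\<close> is \<open>legendre p\<close>; now
  \<open>Q = lam p + 1/4 + 1 / (4 (sin \<theta>)\<^sup>2)\<close> decreases in \<open>\<theta>\<close>.
\<close>

lemma envelope_mono:
  assumes x: "0 \<le> x" "x \<le> z" "z < 1" "poly (pderiv (legendre p)) x = 0" "poly (pderiv (legendre p)) z = 0"
  shows "sqrt (1 - x\<^sup>2) * lam p * (poly (legendre p) x)\<^sup>2
     \<le> sqrt (1 - z\<^sup>2) * lam p * (poly (legendre p) z)\<^sup>2 + (poly (legendre p) z)\<^sup>2 / (2 * sqrt (1 - z\<^sup>2))"
proof -
  define l where "l = lam p"
  define v v' where "v = poly (legendre p)" and "v' = poly (pderiv (legendre p))"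
  define S I :: "real \<Rightarrow> real" where "S y = sqrt (1 - y\<^sup>2)" and "I y = 1 / sqrt (1 - y\<^sup>2)" for y
  \<comment> \<open>The energy multiplied out in x. At an interior node v' = 0 and the first two
    terms are left; the second is dropped at \<open>x\<close> and kept at \<open>z\<close>.\<close>
  define E where "E y = S y * l * (v y)\<^sup>2 + (v y)\<^sup>2 * I y / 2
    - y * S y * v y * v' y + S y ^ 3 * (v' y)\<^sup>2" for y
  have der: "(E has_real_derivative y * (v y)\<^sup>2 * I y ^ 3 / 2) (at y)"
    if y: "\<bar>y\<bar> < 1" for y
  proof -
    define w where "w = poly (pderiv (pderiv (legendre p))) y"
    have pos: "0 < 1 - y\<^sup>2" by (rule one_minus_square_pos[OF y])
    have Si: "S y * I y = 1" "y\<^sup>2 + (S y)\<^sup>2 = 1" using pos by (auto simp: S_def I_def)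
    have D: "(S has_real_derivative - y * I y) (at y)" "(I has_real_derivative y * I y ^ 3) (at y)"
      "(v has_real_derivative v' y) (at y)" "(v' has_real_derivative w) (at y)"
      unfolding S_def I_def v_def v'_def w_def by (intro sqrt_derivative[OF y] poly_DERIV)+
    have "(1 - y\<^sup>2) * w = 2 * y * v' y - l * v y"
      using legendre_ode_poly[of y p] by (simp add: w_def l_def v_def v'_def)
    then have w: "w = (2 * y * v' y - l * v y) * (I y)\<^sup>2" using Si by algebra
    have d: "(E has_real_derivative
        ((- y * I y) * l * (v y)\<^sup>2 + S y * l * (2 * v y * v' y))
        + (2 * v y * v' y * I y + (v y)\<^sup>2 * (y * I y ^ 3)) / 2
        - (((1 * S y + y * (- y * I y)) * v y + y * S y * v' y) * v' y + y * S y * v y * w)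
        + (3 * (S y)\<^sup>2 * (- y * I y) * (v' y)\<^sup>2 + S y ^ 3 * (2 * v' y * w))) (at y)"
      unfolding E_def using D by (auto intro!: derivative_eq_intros simp: field_simps power2_eq_square)
    show ?thesis
      by (rule DERIV_cong[OF d]) (use Si w in algebra)
  qed
  have "E x \<le> E z"
    using x(2)
  proof (rule DERIV_nonneg_imp_nondecreasing)
    fix y assume y: "x \<le> y" "y \<le> z"
    then have "\<bar>y\<bar> < 1" using x by simp
    moreover have "0 \<le> y * (v y)\<^sup>2 * I y ^ 3 / 2"
      unfolding I_def using x y one_minus_square_pos[OF calculation] by simp
    ultimately show "\<exists>d. (E has_real_derivative d) (at y) \<and> 0 \<le> d"
      using der by blast
  qed
  moreover have "0 \<le> (poly (legendre p) x)\<^sup>2 / (2 * sqrt (1 - x\<^sup>2))"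
    using one_minus_square_pos[of x] x by simp
  ultimately show ?thesis
    using x by (simp add: E_def S_def I_def v_def v'_def l_def mult.commute)
qed

text \<open>At the end point the gap is of order 1 / \<open>lam p\<close>. The upper bound comes
  from \<open>gap_upper\<close>: 1 - t^2 is at most 2 (1 - z), and one factor 1 - z cancels.\<close>

lemma last_gap:
  assumes z: "consec p z 1"
  shows "2 \<le> lam p * (1 - z)" "lam p * (1 - z) \<le> 2 * pi\<^sup>2"
proof -
  have z': "-1 \<le> z" "z < 1" using consec_bounds[OF p z] by auto
  show "2 \<le> lam p * (1 - z)"
    using z z' by (intro gl_dist_1 p) (auto simp: consec_def)
  \<comment> \<open>The least absolute value on the gap, which contains the origin if
    \<open>z\<close> is negative.\<close>
  define t where "t = max z 0"
  have t: "0 \<le> t" "t < 1" using z' by (auto simp: t_def)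
  have "lam p * (1 - z)\<^sup>2 \<le> pi\<^sup>2 * (1 - t\<^sup>2)"
  proof (rule gap_upper[OF p z t])
    fix x assume "x \<in> {z<..<1}"
    then show "t\<^sup>2 \<le> x\<^sup>2" by (auto simp: t_def max_def intro!: power_mono)
  qed
  also have "1 - t\<^sup>2 = (1 + t) * (1 - t)" by (simp add: power2_eq_square algebra_simps)
  also have "\<dots> \<le> 2 * (1 - z)" using t by (intro mult_mono) (auto simp: t_def)
  finally have "(1 - z) * (lam p * (1 - z)) \<le> (1 - z) * (2 * pi\<^sup>2)"
    by (simp add: power2_eq_square mult_ac mult_left_mono)
  then show "lam p * (1 - z) \<le> 2 * pi\<^sup>2" using z' by simp
qed

text \<open>On the last gap \<open>lobatto p\<close> is positive, hence concave by its equation. Its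
  slope at \<open>z\<close>, which is \<open>lam p\<close> times |L(z)|, is therefore at least the
  mean slope up to a point where the function is known to be at least 1/2.\<close>

lemma legendre_last_gl:
  assumes z: "consec p z 1" "-1 < z"
  shows "1 / (4 * pi\<^sup>2) \<le> \<bar>poly (legendre p) z\<bar>"
proof -
  have pp: "lam p \<ge> 2" "lam p > 0" using lam_ge_2[OF p] by auto
  note lg = last_gap[OF z(1)]
  have z1: "z < 1" using z by (simp add: consec_def)
  \<comment> \<open>The maximum point of the parabola in \<open>lobatto_le_near_1\<close>, with
    value 1/2; \<open>last_gap\<close> puts it to the right of \<open>z\<close>.\<close>
  define t where "t = 1 - 1 / lam p"
  have t: "z < t" "t < 1" "0 \<le> t" using lg pp by (auto simp: t_def field_simps)
  have "1 / 2 = lam p * (1 - t) - (lam p)\<^sup>2 * (1 - t)\<^sup>2 / 2"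
    using pp by (simp add: t_def power2_eq_square)
  also have "\<dots> \<le> poly (lobatto p) t" by (rule lobatto_le_near_1[OF p]) (use t in auto)
  finally have vt: "1 / 2 \<le> poly (lobatto p) t" .
  obtain e where e: "e = 1 \<or> e = -1" "\<And>x. x \<in> {z<..<1} \<Longrightarrow> 0 < e * poly (lobatto p) x"
    using consec_sign[OF z(1)] by blast
  have "e = 1" using e(2)[of t] e(1) t vt by auto
  obtain c where c: "z < c" "c < t" "poly (lobatto p) t - poly (lobatto p) z = (t - z) * poly (pderiv (lobatto p)) c"
    using poly_MVT[OF t(1)] by blast
  have vz: "poly (lobatto p) z = 0" using z by (simp add: consec_def gl_points_def)
  have "poly (pderiv (lobatto p)) c \<le> poly (pderiv (lobatto p)) z"
  proof (rule DERIV_nonpos_imp_nonincreasing[where f = "poly (pderiv (lobatto p))"])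
    fix x assume x: "z \<le> x" "x \<le> c"
    have "0 \<le> poly (lobatto p) x"
      using x vz e(2)[of x] c t \<open>e = 1\<close> by (cases "x = z") auto
    moreover have "\<bar>x\<bar> < 1" using x z(2) c t by auto
    ultimately have "0 \<le> poly (pderiv (legendre p)) x"
      using one_minus_square_pos[of x] by (simp add: poly_lobatto zero_le_mult_iff)
    then have "poly (pderiv (pderiv (lobatto p))) x \<le> 0"
      using pp by (simp add: poly_pderiv2_lobatto)
    then show "\<exists>y. (poly (pderiv (lobatto p)) has_real_derivative y) (at x) \<and> y \<le> 0"
      using poly_DERIV by blast
  qed (use c in auto)
  then have "(t - z) * poly (pderiv (lobatto p)) c \<le> (t - z) * poly (pderiv (lobatto p)) z"
    using t by (intro mult_left_mono) auto
  then have "1 / 2 \<le> (t - z) * poly (pderiv (lobatto p)) z" using c(3) vz vt by linarith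
  then have *: "1 / 2 \<le> (t - z) * (lam p * - poly (legendre p) z)"
    by (simp add: poly_pderiv_lobatto)
  also have "\<dots> \<le> (t - z) * (lam p * \<bar>poly (legendre p) z\<bar>)"
    using t pp by (intro mult_left_mono) auto
  also have "\<dots> \<le> (1 - z) * (lam p * \<bar>poly (legendre p) z\<bar>)"
    using t pp by (intro mult_right_mono) auto
  also have "\<dots> = (lam p * (1 - z)) * \<bar>poly (legendre p) z\<bar>" by simp
  also have "\<dots> \<le> (2 * pi\<^sup>2) * \<bar>poly (legendre p) z\<bar>"
    using lg by (intro mult_right_mono) auto
  finally show ?thesis by (simp add: field_simps)
qed

lemma last_gl_exists:
  obtains z where "consec p z 1" "\<And>x. x \<in> gl_points p \<Longrightarrow> x \<noteq> 1 \<Longrightarrow> x \<le> z"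
proof
  define z where "z = Max (gl_points p - {1})"
  have fin: "finite (gl_points p - {1})" "gl_points p - {1} \<noteq> {}" using gl_eq[OF p] by (auto intro!: exI[of _ "-1"])
  show le: "x \<le> z" if "x \<in> gl_points p" "x \<noteq> 1" for x using that fin by (simp add: z_def)
  have "z \<in> gl_points p - {1}" unfolding z_def by (rule Max_in[OF fin])
  then show "consec p z 1" using le gl_eq[OF p] by (force simp: consec_def)
qed

lemma wt_uminus: "gl_weight p (- x) = gl_weight p x"
  by (simp add: gl_weight_def legendre_uminus power_mult_distrib flip: power_mult)

text \<open>Both envelopes are compared with their values at the last node \<open>z\<close> before
  1, one in each direction. There everything is known: sqrt (1 - z^2) is of order 1 / sqrt (lam p)
  by \<open>last_gap\<close>, and |L(z)| lies between 1 / (4 pi^2) and 1. Together: weights are of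
  order sqrt (1 - x^2) / sqrt (lam p), as gaps are.\<close>

lemma wt_bounds_aux:
  assumes x: "x \<in> gl_points p" "0 \<le> x" "x < 1"
  shows "gl_weight p x * sqrt (lam p) \<le> 32 * pi ^ 4 * sqrt (1 - x\<^sup>2)"
    and "2 * sqrt (1 - x\<^sup>2) \<le> (2 * pi + 1) * (sqrt (lam p) * gl_weight p x)"
proof -
  define l where "l = lam p"
  have l: "l > 0" "l \<ge> 2" using lam_ge_2[OF p] by (auto simp: l_def)
  obtain z where z: "consec p z 1" "x \<le> z" using last_gl_exists x by (metis less_irrefl)
  have z1: "0 \<le> z" "z < 1" "z \<in> gl_points p" using x z by (auto simp: consec_def)
  have vz: "poly (lobatto p) z = 0" "poly (lobatto p) x = 0" using z1 x by (auto simp: gl_points_def)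
  then have L'z: "poly (pderiv (legendre p)) z = 0" "poly (pderiv (legendre p)) x = 0"
    using z1 x by (auto simp: poly_lobatto power2_eq_1_iff)
  note lg = last_gap[OF z(1)]
  define sz sx where "sz = sqrt (1 - z\<^sup>2)" and "sx = sqrt (1 - x\<^sup>2)"
  have sq: "0 < 1 - z\<^sup>2" "0 < 1 - x\<^sup>2" using one_minus_square_pos[of z] one_minus_square_pos[of x] z1 x by auto
  then have s_pos: "sz > 0" "sx > 0" by (auto simp: sz_def sx_def)
  have e: "1 - z\<^sup>2 = (1 + z) * (1 - z)" by (simp add: power2_eq_square algebra_simps)
  have "2 / l \<le> 1 * (1 - z)" using lg l by (simp add: l_def field_simps)
  also have "\<dots> \<le> (1 + z) * (1 - z)" using z1 by (intro mult_right_mono) auto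
  finally have lo: "sqrt (2 / l) \<le> sz" by (simp add: sz_def e)
  have "(1 + z) * (1 - z) \<le> 2 * (2 * pi\<^sup>2 / l)"
    using lg l z1 by (intro mult_mono) (auto simp: l_def field_simps)
  moreover have "2 * (2 * pi\<^sup>2 / l) = (2 * pi)\<^sup>2 / l" by (simp add: power2_eq_square)
  ultimately have "sz \<le> sqrt ((2 * pi)\<^sup>2 / l)" by (simp only: sz_def e real_sqrt_le_iff)
  moreover have "sqrt ((2 * pi)\<^sup>2 / l) = 2 * pi / sqrt l"
    by (simp only: real_sqrt_divide real_sqrt_abs) simp
  ultimately have up: "sz \<le> 2 * pi / sqrt l" by simp
  define Lz Lx where "Lz = poly (legendre p) z" and "Lx = poly (legendre p) x"
  have Lz1: "Lz\<^sup>2 \<le> 1" using legendre_abs_le_1[OF p, of z] z1 by (simp add: Lz_def abs_square_le_1)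
  have Lz2: "1 / (16 * pi ^ 4) \<le> Lz\<^sup>2"
  proof -
    have "(1 / (4 * pi\<^sup>2))\<^sup>2 \<le> \<bar>Lz\<bar>\<^sup>2"
      unfolding Lz_def using legendre_last_gl[OF z(1)] z1 by (intro power_mono) auto
    then show ?thesis by (simp add: power_divide power_mult_distrib flip: power_mult)
  qed
  have gl_weight: "gl_weight p x * (l * Lx\<^sup>2) = 2"
    using legendre_gl_nonzero[OF p x(1)] l by (simp add: gl_weight_def l_def Lx_def)
  have w: "gl_weight p x > 0" using wt_pos[OF p] x by simp
  have sl: "sqrt l > 0" "sqrt l * sqrt l = l" using l by auto
  have "1 / (16 * pi ^ 4) \<le> sqrt l * (sx * Lx\<^sup>2)"
  proof -
    have "1 \<le> sqrt l * sz"
    proof -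
      have "1 \<le> sqrt l * sqrt (2 / l)" using l by (simp flip: real_sqrt_mult)
      also have "\<dots> \<le> sqrt l * sz" using lo sl by (intro mult_left_mono) auto
      finally show ?thesis .
    qed
    then have "1 * (1 / (16 * pi ^ 4)) \<le> sqrt l * sz * Lz\<^sup>2"
      using Lz2 by (intro mult_mono) auto
    also have "\<dots> = sqrt l * (sz * Lz\<^sup>2)" by simp
    also have "\<dots> \<le> sqrt l * (sx * Lx\<^sup>2)"
      using envelope_antimono[OF x(2) z(2) z1(2) vz(2,1)] sl
      by (intro mult_left_mono) (auto simp: sz_def sx_def Lz_def Lx_def)
    finally show ?thesis by simp
  qed
  then have "gl_weight p x * sqrt l * (1 / (16 * pi ^ 4)) \<le> gl_weight p x * sqrt l * (sqrt l * (sx * Lx\<^sup>2))"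
    using w sl by (intro mult_left_mono) auto
  also have "\<dots> = gl_weight p x * (l * Lx\<^sup>2) * sx"
    using sl by (metis mult.assoc mult.commute)
  finally show "gl_weight p x * sqrt (lam p) \<le> 32 * pi ^ 4 * sqrt (1 - x\<^sup>2)"
    unfolding gl_weight by (simp add: l_def sx_def field_simps)
  have "sx * l * Lx\<^sup>2 \<le> sz * l * Lz\<^sup>2 + Lz\<^sup>2 / (2 * sz)"
    using envelope_mono[OF x(2) z(2) z1(2) L'z(2,1)] by (simp add: sz_def sx_def Lz_def Lx_def l_def)
  also have "\<dots> \<le> sz * l * 1 + 1 / (2 * sz)"
    using Lz1 s_pos l by (intro add_mono mult_left_mono divide_right_mono) auto
  also have "\<dots> \<le> 2 * pi * sqrt l + sqrt l"
  proof (rule add_mono)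
    have "sz * l \<le> 2 * pi / sqrt l * l" using up l by (intro mult_right_mono) auto
    also have "\<dots> = 2 * pi * (l / sqrt l)" by simp
    finally show "sz * l * 1 \<le> 2 * pi * sqrt l" using l by (simp only: real_div_sqrt)
    have "1 / (2 * sz) \<le> 1 / (2 * sqrt (2 / l))"
      using lo s_pos l by (intro divide_left_mono) auto
    also have "\<dots> = sqrt l / (2 * sqrt 2)" by (simp add: real_sqrt_divide)
    also have "\<dots> \<le> sqrt l / 1"
      using sl real_sqrt_ge_one[of 2] by (intro divide_left_mono) linarith+
    finally show "1 / (2 * sz) \<le> sqrt l" by simp
  qed
  finally have "gl_weight p x * (sx * l * Lx\<^sup>2) \<le> gl_weight p x * (2 * pi * sqrt l + sqrt l)"
    using w by (intro mult_left_mono) auto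
  moreover have "gl_weight p x * (sx * l * Lx\<^sup>2) = (gl_weight p x * (l * Lx\<^sup>2)) * sx" by (simp only: mult_ac)
  then have "gl_weight p x * (sx * l * Lx\<^sup>2) = 2 * sx" by (simp only: gl_weight)
  moreover have "gl_weight p x * (2 * pi * sqrt l + sqrt l) = (2 * pi + 1) * (sqrt l * gl_weight p x)"
    by (simp add: algebra_simps)
  ultimately show "2 * sqrt (1 - x\<^sup>2) \<le> (2 * pi + 1) * (sqrt (lam p) * gl_weight p x)"
    by (simp only: sx_def l_def)
qed

lemma wt_bounds:
  assumes x: "x \<in> gl_points p" "\<bar>x\<bar> < 1"
  shows "gl_weight p x * sqrt (lam p) \<le> 32 * pi ^ 4 * sqrt (1 - x\<^sup>2)"
    and "2 * sqrt (1 - x\<^sup>2) \<le> (2 * pi + 1) * (sqrt (lam p) * gl_weight p x)"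
  using wt_bounds_aux[of x] wt_bounds_aux[of "-x"] x gl_uminus[OF x(1)]
  by (cases "0 \<le> x"; simp add: wt_uminus)+

end

text \<open>One constant for all comparisons of weights with gaps. The largest demand is 128 pi^4,
  the factor 32 pi^4 of \<open>wt_bounds\<close> times the 4 of
  \<open>outer_gap_lower\<close>.\<close>

definition Cgap :: real where "Cgap = 200 * pi ^ 4"

lemma Cgap_ge: "1 \<le> Cgap" "128 * pi ^ 4 \<le> Cgap" "pi\<^sup>2 \<le> Cgap" "40 * pi\<^sup>2 \<le> Cgap"
proof -
  have pi3: "3 \<le> pi" using pi_approx by simp
  have p2: "9 \<le> pi\<^sup>2" using power_mono[OF pi3, of 2] by simp
  then have "9 * pi\<^sup>2 \<le> pi\<^sup>2 * pi\<^sup>2" by (intro mult_right_mono) auto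
  then have p4: "9 * pi\<^sup>2 \<le> pi ^ 4" by (simp flip: power_add)
  show "1 \<le> Cgap" "128 * pi ^ 4 \<le> Cgap" "pi\<^sup>2 \<le> Cgap" "40 * pi\<^sup>2 \<le> Cgap"
    using p2 p4 by (simp_all add: Cgap_def)
qed

section \<open>Comparison of quadrature weights and gaps\<close>

context
  fixes p :: nat assumes p: "1 \<le> p"
begin

lemma outer_gap_upper:
  assumes ab: "consec p a b" and a: "0 \<le> a"
  shows "lam p * (b - a)\<^sup>2 \<le> pi\<^sup>2 * (1 - a\<^sup>2)"
  using consec_bounds[OF p ab] a
  by (intro gap_upper[OF p ab]) (auto intro!: power_mono)

text \<open>If the gap is short compared with 1 - a^2, then 1 - x^2 keeps at least half of its size
  across it and \<open>gap_lower\<close> applies. Otherwise b - a exceeds (1 - a^2) / 4, which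
  suffices because 1 - a^2 is at least 2 / \<open>lam p\<close> at a node.\<close>

lemma outer_gap_lower:
  assumes ab: "consec p a b" and a: "0 \<le> a"
  shows "sqrt (1 - a\<^sup>2) \<le> 4 * (sqrt (lam p) * (b - a))"
proof -
  define l where "l = lam p"
  have l: "l \<ge> 2" "sqrt l > 0" using lam_ge_2[OF p] by (auto simp: l_def)
  note cb = consec_bounds[OF p ab]
  have a1: "\<bar>a\<bar> < 1" using cb a by auto
  have sa: "0 < 1 - a\<^sup>2" by (rule one_minus_square_pos[OF a1])
  define s where "s = sqrt (1 - a\<^sup>2)"
  have s: "s > 0" "s\<^sup>2 = 1 - a\<^sup>2" using sa by (auto simp: s_def)
  have lo: "2 / l \<le> s\<^sup>2" using gl_interior[OF p _ a1] ab by (simp add: consec_def s l_def)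
  show ?thesis
  proof (cases "4 * (b - a) \<le> 1 - a\<^sup>2")
    case True
    \<comment> \<open>Chosen so that 1 - t^2 is half of 1 - a^2.\<close>
    define t where "t = sqrt ((1 + a\<^sup>2) / 2)"
    have t2: "t\<^sup>2 = (1 + a\<^sup>2) / 2" by (simp add: t_def)
    have t: "0 \<le> t" "t < 1" using sa by (auto simp: t_def)
    have "pi\<^sup>2 * (1 - t\<^sup>2) \<le> lam p * (b - a)\<^sup>2"
    proof (rule gap_lower[OF p ab t])
      fix x assume x: "x \<in> {a<..<b}"
      then have "x\<^sup>2 = a\<^sup>2 + (x - a) * (x + a)" by (simp add: power2_eq_square algebra_simps)
      also have "(x - a) * (x + a) \<le> (b - a) * 2" using x a cb by (intro mult_mono) auto
      finally show "x\<^sup>2 \<le> t\<^sup>2" using True unfolding t2 by (simp add: field_simps)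
    qed
    moreover have "1 - t\<^sup>2 = s\<^sup>2 / 2" unfolding t2 s by (simp add: field_simps)
    ultimately have "pi\<^sup>2 * s\<^sup>2 / 2 \<le> l * (b - a)\<^sup>2" by (simp add: l_def)
    moreover have "2 * s\<^sup>2 \<le> pi\<^sup>2 * s\<^sup>2"
      using pi_ge_two power_mono[of 2 pi 2] by (intro mult_right_mono) auto
    ultimately have "s\<^sup>2 \<le> (sqrt l * (b - a))\<^sup>2" using l by (simp add: power_mult_distrib)
    then have "s \<le> sqrt l * (b - a)" using l cb by (rule_tac power2_le_imp_le) auto
    also have "\<dots> \<le> 4 * (sqrt l * (b - a))" using l cb by simp
    finally show ?thesis by (simp add: s_def l_def)
  next
    case False
    have "1 \<le> (sqrt l * s)\<^sup>2" using lo l by (simp add: power_mult_distrib field_simps)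
    then have "1\<^sup>2 \<le> (sqrt l * s)\<^sup>2" by simp
    then have "1 \<le> sqrt l * s" using l s by (rule_tac power2_le_imp_le) auto
    then have "s * 1 \<le> s * (sqrt l * s)" using s by (intro mult_left_mono) auto
    also have "\<dots> = sqrt l * s\<^sup>2" by (simp add: power2_eq_square)
    also have "\<dots> \<le> sqrt l * (4 * (b - a))" using False l s by (intro mult_left_mono) auto
    also have "\<dots> = 4 * (sqrt l * (b - a))" by simp
    finally show ?thesis unfolding s_def l_def by simp
  qed
qed

lemma wt_le_outer_gap:
  assumes ab: "consec p a b" and a: "0 \<le> a"
  shows "gl_weight p a \<le> Cgap * (b - a)"
proof -
  have l: "sqrt (lam p) > 0" using lam_pos[OF p] by simp
  have "gl_weight p a * sqrt (lam p) \<le> 32 * pi ^ 4 * sqrt (1 - a\<^sup>2)"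
    using wt_bounds(1)[OF p, of a] ab a consec_bounds[OF p ab] by (auto simp: consec_def)
  also have "\<dots> \<le> 32 * pi ^ 4 * (4 * (sqrt (lam p) * (b - a)))"
    using outer_gap_lower[OF assms] by (intro mult_left_mono) auto
  finally have "sqrt (lam p) * gl_weight p a \<le> sqrt (lam p) * (128 * pi ^ 4 * (b - a))"
    by (simp add: mult_ac)
  then have "gl_weight p a \<le> 128 * pi ^ 4 * (b - a)" using l by simp
  also have "\<dots> \<le> Cgap * (b - a)"
    using Cgap_ge consec_bounds[OF p ab] by (intro mult_right_mono) auto
  finally show ?thesis .
qed

lemma wt_1: "gl_weight p 1 = 2 / lam p"
  by (simp add: gl_weight_def)

lemma wt_1_le_gap: "consec p a 1 \<Longrightarrow> gl_weight p 1 \<le> Cgap * (1 - a)"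
proof -
  assume a: "consec p a 1"
  then have "gl_weight p 1 \<le> 1 * (1 - a)"
    using last_gap(1)[OF p a] lam_pos[OF p] by (simp add: wt_1 field_simps)
  also have "\<dots> \<le> Cgap * (1 - a)"
    using consec_bounds[OF p a] Cgap_ge(1) by (intro mult_right_mono) auto
  finally show ?thesis .
qed

text \<open>The interval from \<open>a\<close> to \<open>b\<close> may contain the origin only if it is symmetric, hence the hypothesis on \<open>a\<close>.\<close>

lemma gap_le_wt_aux:
  assumes ab: "consec p a b" and a: "0 \<le> a \<or> a = - b"
  shows "b - a \<le> Cgap * gl_weight p b" "b - a \<le> Cgap * gl_weight p a"
proof -
  define l where "l = lam p"
  have l: "l \<ge> 2" "sqrt l > 0" "l > 0" using lam_ge_2[OF p] by (auto simp: l_def)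
  note cb = consec_bounds[OF p ab]
  define t where "t = max a 0"
  have t: "0 \<le> t" "t < 1" "a \<le> t" "t < b" using cb a by (auto simp: t_def)
  have s0: "0 < 1 - t\<^sup>2" using t by (intro one_minus_square_pos) auto
  define s where "s = sqrt (1 - t\<^sup>2)"
  have s: "s > 0" "s\<^sup>2 = 1 - t\<^sup>2" using s0 by (auto simp: s_def)
  have "l * (b - a)\<^sup>2 \<le> pi\<^sup>2 * (1 - t\<^sup>2)"
    unfolding l_def
    by (rule gap_upper[OF p ab t(1,2)]) (auto simp: t_def max_def intro!: power_mono)
  then have "(sqrt l * (b - a))\<^sup>2 \<le> (pi * s)\<^sup>2"
    using l by (simp add: power_mult_distrib s)
  then have up: "sqrt l * (b - a) \<le> pi * s"
    using s by (rule_tac power2_le_imp_le) auto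
  have C: "pi * (1 + 5 * pi) * (2 * pi + 1) / 2 \<le> Cgap"
  proof -
    have "pi * (1 + 5 * pi) * (2 * pi + 1) \<le> pi * (pi + 5 * pi) * (2 * pi + pi)"
      using pi_ge_two by (intro mult_mono) auto
    also have "\<dots> = 18 * pi ^ 3" by (simp add: power3_eq_cube)
    also have "\<dots> \<le> 18 * pi ^ 4" using pi_ge_two by (intro mult_left_mono power_increasing) auto
    also have "\<dots> \<le> 2 * Cgap" by (simp add: Cgap_def)
    finally show ?thesis by simp
  qed
  have C1: "pi * (2 * pi + 1) / 2 \<le> Cgap"
  proof -
    have "pi * 1 * (2 * pi + 1) \<le> pi * (1 + 5 * pi) * (2 * pi + 1)"
      using pi_ge_two by (intro mult_mono) auto
    then show ?thesis using C by linarith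
  qed
  show b: "b - a \<le> Cgap * gl_weight p b"
  proof (cases "b = 1")
    case True
    then have "l * (1 - a) \<le> 2 * pi\<^sup>2" using last_gap(2)[OF p, of a] ab by (simp add: l_def)
    then have "b - a \<le> pi\<^sup>2 * gl_weight p b" using l True by (simp add: wt_1 l_def field_simps)
    also have "\<dots> \<le> Cgap * gl_weight p b"
      using Cgap_ge(3) wt_pos[OF p, of b] ab by (intro mult_right_mono) (auto simp: consec_def)
    finally show ?thesis .
  next
    case False
    then have b1: "\<bar>b\<bar> < 1" using cb t by auto
    have bgl: "b \<in> gl_points p" using ab by (simp add: consec_def)
    define y where "y = sqrt (1 - b\<^sup>2)"
    have y: "y > 0" "y\<^sup>2 = 1 - b\<^sup>2" using one_minus_square_pos[OF b1] by (auto simp: y_def)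
    have "2 \<le> l * y\<^sup>2" using gl_interior[OF p bgl b1] l by (simp add: y l_def field_simps)
    then have "1\<^sup>2 \<le> (sqrt l * y)\<^sup>2" using l by (simp add: power_mult_distrib)
    then have ly: "1 \<le> sqrt l * y" using l y by (rule_tac power2_le_imp_le) auto
    have "s\<^sup>2 = y\<^sup>2 + (b - t) * (b + t)" unfolding s y by (simp add: power2_eq_square algebra_simps)
    also have "(b - t) * (b + t) \<le> (b - a) * 2" using t cb by (intro mult_mono) auto
    also have "(b - a) * 2 \<le> (sqrt l * y) * ((b - a) * 2)" using mult_right_mono[OF ly, of "(b - a) * 2"] cb by simp
    also have "\<dots> = 2 * y * (sqrt l * (b - a))" by simp
    also have "\<dots> \<le> 2 * y * (pi * s)" using up y by (intro mult_left_mono) auto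
    finally have sy: "s\<^sup>2 \<le> y\<^sup>2 + 2 * pi * (s * y)" by (simp add: mult_ac)
    \<comment> \<open>\<open>sy\<close> is a quadratic inequality for the ratio s / y, and 1 + 5 pi
      generously bounds its larger root. Thus sqrt (1 - x^2) is comparable at the two ends of the
      gap, although it decreases towards \<open>b\<close>.\<close>
    have "s \<le> (1 + 5 * pi) * y"
    proof (rule ccontr)
      assume neg: "\<not> ?thesis"
      have "0 < pi * y" using y by simp
      then have sy': "y < s" using neg by (simp add: algebra_simps)
      have "(1 + 5 * pi) * y * s < s * s" using neg s by (intro mult_strict_right_mono) auto
      moreover have "y * y \<le> y * s" using y sy' by (intro mult_left_mono) auto
      moreover have "0 < pi * (s * y)" using s y by simp
      ultimately show False using sy by (simp add: power2_eq_square algebra_simps)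
    qed
    then have "sqrt l * (b - a) \<le> pi * ((1 + 5 * pi) * y)"
      using up by (meson mult_left_mono order_trans pi_ge_zero)
    also have "\<dots> = pi * (1 + 5 * pi) / 2 * (2 * y)" by simp
    also have "\<dots> \<le> pi * (1 + 5 * pi) / 2 * ((2 * pi + 1) * (sqrt l * gl_weight p b))"
      using wt_bounds(2)[OF p bgl b1] by (intro mult_left_mono) (auto simp: y_def l_def)
    finally have "sqrt l * (b - a) \<le> sqrt l * (pi * (1 + 5 * pi) * (2 * pi + 1) / 2 * gl_weight p b)"
      by (simp add: mult_ac)
    then have "b - a \<le> pi * (1 + 5 * pi) * (2 * pi + 1) / 2 * gl_weight p b" using l by simp
    also have "\<dots> \<le> Cgap * gl_weight p b" using C wt_pos[OF p bgl] by (intro mult_right_mono) auto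
    finally show ?thesis .
  qed
  show "b - a \<le> Cgap * gl_weight p a"
  proof (cases "a = - b")
    case True
    then show ?thesis using b wt_uminus[OF p, of b] by simp
  next
    case False
    then have a0: "0 \<le> a" "t = a" using a by (auto simp: t_def)
    then have a1: "\<bar>a\<bar> < 1" "a \<in> gl_points p" using cb ab by (auto simp: consec_def)
    have "sqrt l * (b - a) \<le> pi / 2 * (2 * s)" using up by simp
    also have "\<dots> \<le> pi / 2 * ((2 * pi + 1) * (sqrt l * gl_weight p a))"
      using wt_bounds(2)[OF p a1(2,1)] a0 by (intro mult_left_mono) (auto simp: s_def l_def)
    finally have "sqrt l * (b - a) \<le> sqrt l * (pi * (2 * pi + 1) / 2 * gl_weight p a)"
      by (simp add: mult_ac)
    then have "b - a \<le> pi * (2 * pi + 1) / 2 * gl_weight p a" using l by simp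
    also have "\<dots> \<le> Cgap * gl_weight p a" using C1 wt_pos[OF p a1(2)] by (intro mult_right_mono) auto
    finally show ?thesis .
  qed
qed

text \<open>The reflections -a and -b are nodes too, and one of them would lie inside an unsymmetric
  gap around the origin.\<close>

lemma consec_cases:
  assumes "consec p a b"
  shows "0 \<le> a \<or> b \<le> 0 \<or> a = - b"
proof (rule ccontr)
  assume neg: "\<not> ?thesis"
  then have ab: "a < 0" "0 < b" "a \<noteq> - b" by auto
  have "- a \<in> gl_points p" "- b \<in> gl_points p" using assms gl_uminus by (auto simp: consec_def)
  moreover have "- a \<in> {a<..<b} \<or> - b \<in> {a<..<b}" using ab by auto
  ultimately show False using assms by (auto simp: consec_def)
qed

lemma gap_le_wt:
  assumes ab: "consec p a b"
  shows "b - a \<le> Cgap * gl_weight p b" "b - a \<le> Cgap * gl_weight p a"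
proof -
  have "(b - a \<le> Cgap * gl_weight p b) \<and> (b - a \<le> Cgap * gl_weight p a)"
  proof (cases "0 \<le> a \<or> a = - b")
    case True
    then show ?thesis using gap_le_wt_aux[OF ab] by blast
  next
    case False
    then have "b \<le> 0" using consec_cases[OF ab] by auto
    then show ?thesis
      using gap_le_wt_aux[OF consec_uminus[OF ab]] wt_uminus[OF p] by simp
  qed
  then show "b - a \<le> Cgap * gl_weight p b" "b - a \<le> Cgap * gl_weight p a" by auto
qed

lemma inner_mirror:
  assumes ab: "consec p a b" and b: "b \<le> 0"
  shows "gl_weight p b \<le> Cgap * (b - a)" "lam p * (b - a)\<^sup>2 \<le> pi\<^sup>2 * (1 - b\<^sup>2)"
  using wt_le_outer_gap[OF consec_uminus[OF ab]] outer_gap_upper[OF consec_uminus[OF ab]] b wt_uminus[OF p]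
  by (simp_all add: power2_commute)

lemma wt_minus_1_le_gap: "consec p (-1) b \<Longrightarrow> gl_weight p (-1) \<le> Cgap * (b - (-1))"
  using wt_1_le_gap[OF consec_uminus[of p "-1" b, simplified]] wt_uminus[OF p, of 1] by (simp add: add.commute)

end

section \<open>Mass and stiffness on the interval\<close>

definition gl_point :: "nat \<Rightarrow> nat \<Rightarrow> real" where
  "gl_point p i = sorted_list_of_set (gl_points p) ! i"

definition gl_gap :: "nat \<Rightarrow> nat \<Rightarrow> real" where
  "gl_gap p a = gl_point p (Suc a) - gl_point p a"

context
  fixes p :: nat assumes p: "1 \<le> p"
begin

lemma xi_less: "i < j \<Longrightarrow> j \<le> p \<Longrightarrow> gl_point p i < gl_point p j"
  using strict_sorted_list_of_set[of "gl_points p"] gl_eq(1,2)[OF p]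
  by (simp add: gl_point_def sorted_wrt_iff_nth_less)

lemma xi_le: "i \<le> j \<Longrightarrow> j \<le> p \<Longrightarrow> gl_point p i \<le> gl_point p j"
  using xi_less[of i j] by (cases "i = j") auto

lemma xi_bij: "bij_betw (gl_point p) {..p} (gl_points p)"
proof -
  have "bij_betw (nth (sorted_list_of_set (gl_points p))) {..<p + 1} (set (sorted_list_of_set (gl_points p)))"
    using gl_eq(1,2)[OF p] by (intro bij_betw_nth) auto
  then show ?thesis
    using gl_eq(1)[OF p] unfolding gl_point_def[abs_def] by (simp add: lessThan_Suc_atMost)
qed

lemma xi_in: "i \<le> p \<Longrightarrow> gl_point p i \<in> gl_points p"
  using bij_betw_apply[OF xi_bij] by simp

lemma xi_ends: "gl_point p 0 = -1" "gl_point p p = 1"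
proof -
  have im: "gl_point p ` {..p} = gl_points p" using xi_bij by (rule bij_betw_imp_surj_on)
  obtain i where i: "i \<le> p" "gl_point p i = -1" using im gl_eq(5)[OF p] by (metis atMost_iff imageE)
  obtain j where j: "j \<le> p" "gl_point p j = 1" using im gl_eq(4)[OF p] by (metis atMost_iff imageE)
  have "gl_point p 0 \<in> {-1..1}" "gl_point p p \<in> {-1..1}" using xi_in gl_eq(3)[OF p] by blast+
  moreover have "gl_point p 0 \<le> gl_point p i" "gl_point p j \<le> gl_point p p" using i j xi_le[of 0 i] xi_le[of j p] by auto
  ultimately show "gl_point p 0 = -1" "gl_point p p = 1" using i j by auto
qed

lemma xi_consec: "i < p \<Longrightarrow> consec p (gl_point p i) (gl_point p (Suc i))"
  unfolding consec_def
proof (intro conjI ballI notI)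
  fix x assume i: "i < p" and x: "x \<in> {gl_point p i<..<gl_point p (Suc i)}" "x \<in> gl_points p"
  then obtain j where j: "j \<le> p" "x = gl_point p j"
    using xi_bij by (metis atMost_iff bij_betw_iff_bijections)
  show False
  proof (cases "j \<le> i")
    case True
    then show ?thesis using xi_le[of j i] i x j by auto
  next
    case False
    then show ?thesis using xi_le[of "Suc i" j] x j by auto
  qed
qed (auto intro: xi_in xi_less)

lemma sum_gl: "(\<Sum>z\<in>gl_points p. f z) = (\<Sum>i\<le>p. f (gl_point p i))"
  by (rule sum.reindex_bij_betw[OF xi_bij, symmetric])

lemma gap_pos: "a < p \<Longrightarrow> 0 < gl_gap p a"
  using xi_less[of a "Suc a"] by (simp add: gl_gap_def)

lemma sum_poly_integral_cells: "n \<le> p \<Longrightarrow> (\<Sum>a<n. poly_integral (gl_point p a) (gl_point p (Suc a)) f) = poly_integral (-1) (gl_point p n) f"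
proof (induction n)
  case 0
  then show ?case using xi_ends by (simp add: poly_integral_def)
next
  case (Suc n)
  then show ?case
    using poly_integral_combine[of "-1" "gl_point p n" "gl_point p (Suc n)" f] xi_ends xi_le[of 0 n] xi_le[of n "Suc n"] by simp
qed

text \<open>A weight is controlled by the gap on the side away from the origin, and at an end point
  by the only adjacent gap. Adding both neighbours, with 0 beyond the ends, makes the bound uniform
  in \<open>i\<close>.\<close>

lemma wt_le_gaps:
  assumes i: "i \<le> p"
  shows "gl_weight p (gl_point p i) \<le> Cgap * ((if i < p then gl_gap p i else 0) + (if 0 < i then gl_gap p (i - 1) else 0))"
    (is "_ \<le> Cgap * (?A + ?B)")
proof -
  have "i - 1 < p" using i p by linarith
  then have nonneg: "0 \<le> ?A" "0 \<le> ?B" using gap_pos[of i] gap_pos[of "i - 1"] i p by (auto intro: less_imp_le)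
  have C: "Cgap \<ge> 0" using Cgap_ge by simp
  have A: ?thesis if "gl_weight p (gl_point p i) \<le> Cgap * ?A"
    using that mult_left_mono[of ?A "?A + ?B" Cgap] nonneg C by linarith
  have B: ?thesis if "gl_weight p (gl_point p i) \<le> Cgap * ?B"
    using that mult_left_mono[of ?B "?A + ?B" Cgap] nonneg C by linarith
  show ?thesis
  proof (cases "0 \<le> gl_point p i")
    case True
    show ?thesis
    proof (cases "i < p")
      case ip: True
      then show ?thesis using wt_le_outer_gap[OF p xi_consec[OF ip] True] A by (simp add: gl_gap_def)
    next
      case False
      then have "i = p" using i by simp
      then show ?thesis using wt_1_le_gap[OF p] xi_consec[of "p - 1"] xi_ends p B by (simp add: gl_gap_def)
    qed
  next
    case False
    show ?thesis
    proof (cases "i = 0")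
      case True
      then show ?thesis using wt_minus_1_le_gap[OF p] xi_consec[of 0] xi_ends p A by (simp add: gl_gap_def)
    next
      case i0: False
      then have "consec p (gl_point p (i - 1)) (gl_point p i)" using xi_consec[of "i - 1"] i by simp
      from inner_mirror(1)[OF p this] show ?thesis using False i0 B by (simp add: gl_gap_def)
    qed
  qed
qed

text \<open>Regroups a sum over nodes into a sum over gaps. It is used with squared nodal values for
  the masses and with t = 1 for the local energies in
  \<open>gl_interpolation_stable\<close>.\<close>

lemma sum_shift_gap: "(\<Sum>i\<le>p. ((if i < p then g i else 0) + (if 0 < i then g (i - 1) else 0)) * t i)
   = (\<Sum>a<p. g a * (t a + t (Suc a)))" for g t :: "nat \<Rightarrow> real"
proof -
  have "(\<Sum>i\<le>p. (if i < p then g i else 0) * t i) = (\<Sum>a<p. g a * t a)"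
    by (simp add: lessThan_Suc_atMost[symmetric])
  moreover have "(\<Sum>i\<le>p. (if 0 < i then g (i - 1) else 0) * t i) = (\<Sum>a<p. g a * t (Suc a))"
    by (subst sum.atMost_shift) simp
  ultimately show ?thesis by (simp add: distrib_left distrib_right sum.distrib)
qed

text \<open>The trapezoidal sum stands in for the piecewise linear mass. The factor 6 is the 3 of
  \<open>gl_discrete_norm\<close> times 2, since a node borders at most two gaps.\<close>

theorem gl_mass_equivalence:
  assumes q: "degree q \<le> p"
  shows "poly_integral (-1) 1 (q\<^sup>2) \<le> Cgap * (\<Sum>a<p. gl_gap p a * ((poly q (gl_point p a))\<^sup>2 + (poly q (gl_point p (Suc a)))\<^sup>2))"
    and "(\<Sum>a<p. gl_gap p a * ((poly q (gl_point p a))\<^sup>2 + (poly q (gl_point p (Suc a)))\<^sup>2)) \<le> 6 * Cgap * poly_integral (-1) 1 (q\<^sup>2)"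
proof -
  define t where "t i = (poly q (gl_point p i))\<^sup>2" for i
  have t: "0 \<le> t i" for i by (simp add: t_def)
  have "poly_integral (-1) 1 (q\<^sup>2) \<le> (\<Sum>i\<le>p. gl_weight p (gl_point p i) * t i)"
    using gl_discrete_norm(1)[OF p q] by (simp add: sum_gl t_def)
  also have "\<dots> \<le> (\<Sum>i\<le>p. Cgap * ((if i < p then gl_gap p i else 0) + (if 0 < i then gl_gap p (i - 1) else 0)) * t i)"
    by (intro sum_mono mult_right_mono t wt_le_gaps) simp
  also have "\<dots> = Cgap * (\<Sum>a<p. gl_gap p a * (t a + t (Suc a)))"
    unfolding sum_shift_gap[symmetric] by (simp add: sum_distrib_left mult.assoc)
  finally show "poly_integral (-1) 1 (q\<^sup>2) \<le> Cgap * (\<Sum>a<p. gl_gap p a * ((poly q (gl_point p a))\<^sup>2 + (poly q (gl_point p (Suc a)))\<^sup>2))"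
    by (simp add: t_def)
  have w: "0 \<le> gl_weight p (gl_point p i) * t i" if "i \<le> p" for i
    using wt_pos[OF p xi_in[OF that]] t by simp
  have "(\<Sum>a<p. gl_gap p a * (t a + t (Suc a)))
    \<le> (\<Sum>a<p. Cgap * (gl_weight p (gl_point p a) * t a) + Cgap * (gl_weight p (gl_point p (Suc a)) * t (Suc a)))"
  proof (rule sum_mono)
    fix a assume "a \<in> {..<p}"
    then have a: "a < p" by simp
    have "gl_gap p a * t a \<le> Cgap * gl_weight p (gl_point p a) * t a"
      "gl_gap p a * t (Suc a) \<le> Cgap * gl_weight p (gl_point p (Suc a)) * t (Suc a)"
      unfolding gl_gap_def by (intro mult_right_mono t gap_le_wt[OF p xi_consec[OF a]])+
    then show "gl_gap p a * (t a + t (Suc a)) \<le> Cgap * (gl_weight p (gl_point p a) * t a) + Cgap * (gl_weight p (gl_point p (Suc a)) * t (Suc a))"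
      by (simp add: algebra_simps)
  qed
  also have "\<dots> = Cgap * ((\<Sum>a<p. gl_weight p (gl_point p a) * t a) + (\<Sum>a<p. gl_weight p (gl_point p (Suc a)) * t (Suc a)))"
    by (simp add: sum.distrib sum_distrib_left distrib_left)
  also have "\<dots> \<le> Cgap * ((\<Sum>i\<le>p. gl_weight p (gl_point p i) * t i) + (\<Sum>i\<le>p. gl_weight p (gl_point p i) * t i))"
  proof (intro mult_left_mono add_mono)
    show "(\<Sum>a<p. gl_weight p (gl_point p a) * t a) \<le> (\<Sum>i\<le>p. gl_weight p (gl_point p i) * t i)"
      using w by (intro sum_mono2) auto
    show "(\<Sum>a<p. gl_weight p (gl_point p (Suc a)) * t (Suc a)) \<le> (\<Sum>i\<le>p. gl_weight p (gl_point p i) * t i)"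
      using w[of 0] by (simp add: sum.atMost_shift)
  qed (use Cgap_ge in simp)
  also have "\<dots> \<le> Cgap * (6 * poly_integral (-1) 1 (q\<^sup>2))"
    using gl_discrete_norm(2)[OF p q] Cgap_ge by (intro mult_left_mono) (auto simp: sum_gl t_def)
  finally show "(\<Sum>a<p. gl_gap p a * ((poly q (gl_point p a))\<^sup>2 + (poly q (gl_point p (Suc a)))\<^sup>2)) \<le> 6 * Cgap * poly_integral (-1) 1 (q\<^sup>2)"
    by (simp add: t_def mult_ac)
qed

theorem gl_stiffness_lower:
  "(\<Sum>a<p. (poly q (gl_point p (Suc a)) - poly q (gl_point p a))\<^sup>2 / gl_gap p a) \<le> poly_integral (-1) 1 ((pderiv q)\<^sup>2)"
proof -
  have "(\<Sum>a<p. (poly q (gl_point p (Suc a)) - poly q (gl_point p a))\<^sup>2 / gl_gap p a)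
    \<le> (\<Sum>a<p. poly_integral (gl_point p a) (gl_point p (Suc a)) ((pderiv q)\<^sup>2))"
  proof (rule sum_mono)
    fix a assume "a \<in> {..<p}"
    then have a: "0 < gl_gap p a" by (simp add: gap_pos)
    then have le: "gl_point p a \<le> gl_point p (Suc a)" by (simp add: gl_gap_def)
    show "(poly q (gl_point p (Suc a)) - poly q (gl_point p a))\<^sup>2 / gl_gap p a \<le> poly_integral (gl_point p a) (gl_point p (Suc a)) ((pderiv q)\<^sup>2)"
      using poly_integral_square_le[OF le, of "pderiv q"] a by (simp add: poly_integral_pderiv[OF le] field_simps flip: gl_gap_def)
  qed
  then show ?thesis using sum_poly_integral_cells[of p] xi_ends by simp
qed

end

section \<open>Stability of Gauss-Lobatto interpolation in the H^1 seminorm\<close>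

lemma legendre_expansion: "degree f \<le> N \<Longrightarrow> \<exists>a. f = (\<Sum>n\<le>N. smult (a n) (legendre n))"
proof (induction N arbitrary: f)
  case 0
  then obtain c where "f = [:c:]" by (auto elim: degree_eq_zeroE)
  moreover have "legendre 0 = 1" by (simp add: legendre_def one_pCons)
  ultimately show ?case by (intro exI[of _ "\<lambda>_. c"]) (simp add: one_pCons)
next
  case (Suc N)
  define c where "c = coeff f (Suc N) / coeff (legendre (Suc N)) (Suc N)"
  have lc: "coeff (legendre (Suc N)) (Suc N) \<noteq> 0"
    using leading_coeff_0_iff[of "legendre (Suc N)"] by simp
  define g where "g = f - smult c (legendre (Suc N))"
  have "degree g \<le> Suc N"
    unfolding g_def by (intro degree_diff_le Suc.prems order.trans[OF degree_smult_le]) simp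
  moreover have "coeff g (Suc N) = 0" using lc by (simp add: g_def c_def)
  ultimately have "degree g \<le> N"
    by (metis Suc_n_not_le_n degree_0 leading_coeff_0_iff le_SucE zero_le)
  then obtain a where a: "g = (\<Sum>n\<le>N. smult (a n) (legendre n))" using Suc.IH by blast
  have "f = (\<Sum>n\<le>Suc N. smult ((a(Suc N := c)) n) (legendre n))"
    using a by (simp add: g_def algebra_simps)
  then show ?case by blast
qed

lemma poly_integral_legendre_sum:
  assumes "finite A"
  shows "poly_integral (-1) 1 ((\<Sum>n\<in>A. smult (a n) (legendre n)) * (\<Sum>n\<in>A. smult (b n) (legendre n)))
    = (\<Sum>n\<in>A. a n * b n * (2 / (2 * real n + 1)))"
proof -
  have "poly_integral (-1) 1 ((\<Sum>n\<in>A. smult (a n) (legendre n)) * (\<Sum>n\<in>A. smult (b n) (legendre n)))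
    = (\<Sum>n\<in>A. \<Sum>m\<in>A. a n * (b m * poly_integral (-1) 1 (legendre n * legendre m)))"
    by (simp add: sum_product poly_integral_sum poly_integral_smult mult_ac)
  also have "\<dots> = (\<Sum>n\<in>A. \<Sum>m\<in>A. if m = n then a n * b n * (2 / (2 * real n + 1)) else 0)"
    by (intro sum.cong refl) (auto simp: legendre_orthogonal')
  also have "\<dots> = (\<Sum>n\<in>A. a n * b n * (2 / (2 * real n + 1)))"
    using assms by (simp add: sum.delta')
  finally show ?thesis .
qed

text \<open>
  The functions \<open>lobatto n\<close> diagonalize both the weighted \<open>L\<^sup>2\<close> form with weight \<open>1 / (1 - x\<^sup>2)\<close> and the
  \<open>H\<^sup>1\<close> form, with quotient \<open>lam n\<close>. The weighted form of \<open>(1 - x\<^sup>2) R'\<close> is written without division.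
\<close>

lemma weighted_series:
  assumes A: "finite A" "0 \<notin> A"
    and f: "f = (\<Sum>n\<in>A. smult (a n) (legendre n))"
    and R: "R = (\<Sum>n\<in>A. smult (- a n / lam n) (legendre n))"
    and e: "e = [:1, 0, -1:] * pderiv R"
  shows "pderiv e = f" "poly_integral (-1) 1 (f\<^sup>2) = (\<Sum>n\<in>A. (a n)\<^sup>2 * (2 / (2 * real n + 1)))"
    "poly_integral (-1) 1 (e * pderiv R) = (\<Sum>n\<in>A. (a n)\<^sup>2 * (2 / (2 * real n + 1)) / lam n)"
proof -
  have lam: "lam n > 0" if "n \<in> A" for n using A that by (intro lam_pos) (metis One_nat_def Suc_leI neq0_conv)
  have pd: "pderiv (\<Sum>n\<in>A. g n) = (\<Sum>n\<in>A. pderiv (g n))" for g :: "nat \<Rightarrow> real poly"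
    using higher_pderiv_sum[of 1 g A] by simp
  have ev: "e = (\<Sum>n\<in>A. smult (- a n / lam n) (lobatto n))"
    unfolding e R pd sum_distrib_left
    by (rule sum.cong) (simp_all add: pderiv_smult pderiv_minus lobatto_def del: mult_pCons_left)
  show "pderiv e = f"
    unfolding ev f pd
  proof (rule sum.cong)
    fix n assume "n \<in> A"
    then have "lam n \<noteq> 0" using lam[of n] by simp
    then show "pderiv (smult (- a n / lam n) (lobatto n)) = smult (a n) (legendre n)"
      by (simp add: pderiv_smult pderiv_minus pderiv_lobatto)
  qed simp
  show "poly_integral (-1) 1 (f\<^sup>2) = (\<Sum>n\<in>A. (a n)\<^sup>2 * (2 / (2 * real n + 1)))"
    using poly_integral_legendre_sum[OF A(1), of a a] by (simp add: f power2_eq_square)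
  have "poly_integral (-1) 1 (e * pderiv R) = (\<Sum>n\<in>A. - a n / lam n * poly_integral (-1) 1 (lobatto n * pderiv R))"
    unfolding ev by (simp add: sum_distrib_right poly_integral_sum poly_integral_smult poly_integral_minus)
  also have "\<dots> = (\<Sum>n\<in>A. - a n * poly_integral (-1) 1 (legendre n * R))"
  proof (rule sum.cong)
    fix n assume "n \<in> A"
    then have "lam n \<noteq> 0" using lam[of n] by simp
    then show "- a n / lam n * poly_integral (-1) 1 (lobatto n * pderiv R) = - a n * poly_integral (-1) 1 (legendre n * R)"
      by (simp add: poly_integral_lobatto_mult)
  qed simp
  also have "\<dots> = - poly_integral (-1) 1 (f * R)"
    unfolding f by (simp add: sum_distrib_right poly_integral_sum poly_integral_smult poly_integral_minus sum_negf)
  also have "poly_integral (-1) 1 (f * R) = (\<Sum>n\<in>A. a n * (- a n / lam n) * (2 / (2 * real n + 1)))"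
    unfolding f R by (rule poly_integral_legendre_sum[OF A(1)])
  finally show "poly_integral (-1) 1 (e * pderiv R) = (\<Sum>n\<in>A. (a n)\<^sup>2 * (2 / (2 * real n + 1)) / lam n)"
    by (simp add: sum_negf power2_eq_square mult.commute)
qed

text \<open>Integrates e(y)^2 <= 2 e(x)^2 + 2 (e(y) - e(x))^2 over x, with Cauchy-Schwarz for the
  difference.\<close>

lemma local_trace:
  assumes ab: "a < b" and y: "y = a \<or> y = b"
  shows "(b - a) * (poly e y)\<^sup>2 \<le> 2 * poly_integral a b (e\<^sup>2) + 2 * (b - a)\<^sup>2 * poly_integral a b ((pderiv e)\<^sup>2)"
proof -
  have sub: "poly_integral c d (f\<^sup>2) \<le> poly_integral a b (f\<^sup>2)" if "a \<le> c" "c \<le> d" "d \<le> b" for c d and f :: "real poly"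
    using poly_integral_combine[of a c b "f\<^sup>2"] poly_integral_combine[of c d b "f\<^sup>2"] that
      poly_integral_square_nonneg[of a c f] poly_integral_square_nonneg[of d b f] by simp
  define G where "G = poly_integral a b ((pderiv e)\<^sup>2)"
  have G: "G \<ge> 0" by (simp add: G_def poly_integral_square_nonneg)
  have "poly_integral a b [:(poly e y)\<^sup>2:] \<le> poly_integral a b (smult 2 (e\<^sup>2) + [:2 * (b - a) * G:])"
  proof (rule poly_integral_mono)
    fix x assume x: "x \<in> {a..b}"
    define c d where "c = min x y" and "d = max x y"
    have cd: "a \<le> c" "c \<le> d" "d \<le> b" using x y ab by (auto simp: c_def d_def)
    have "(poly e y - poly e x)\<^sup>2 = (poly e d - poly e c)\<^sup>2"
      by (auto simp: c_def d_def min_def max_def power2_commute)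
    also have "\<dots> \<le> (d - c) * poly_integral c d ((pderiv e)\<^sup>2)"
      using poly_integral_square_le[OF cd(2), of "pderiv e"] by (simp add: poly_integral_pderiv[OF cd(2)])
    also have "\<dots> \<le> (b - a) * G"
      unfolding G_def using cd by (intro mult_mono sub poly_integral_square_nonneg) auto
    finally have 1: "(poly e y - poly e x)\<^sup>2 \<le> (b - a) * G" .
    have "(poly e y)\<^sup>2 \<le> 2 * (poly e x)\<^sup>2 + 2 * (poly e y - poly e x)\<^sup>2"
      using zero_le_power2[of "poly e y - 2 * poly e x"] by (simp add: power2_eq_square algebra_simps)
    then have "(poly e y)\<^sup>2 \<le> 2 * (poly e x)\<^sup>2 + 2 * ((b - a) * G)"
      using 1 by linarith
    moreover have "poly (smult 2 (e\<^sup>2) + [:2 * (b - a) * G:]) x = 2 * (poly e x)\<^sup>2 + 2 * ((b - a) * G)"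
      by (simp add: algebra_simps)
    moreover have "poly [:(poly e y)\<^sup>2:] x = (poly e y)\<^sup>2" by simp
    ultimately show "poly [:(poly e y)\<^sup>2:] x \<le> poly (smult 2 (e\<^sup>2) + [:2 * (b - a) * G:]) x"
      by (simp only:)
  qed
  then show ?thesis
    using ab by (simp add: poly_integral_const poly_integral_add poly_integral_smult G_def power2_eq_square mult_ac)
qed

context
  fixes p :: nat assumes p: "1 \<le> p"
begin

text \<open>\<open>r\<close> plays the role of e / (1 - x^2), so \<open>e * r\<close> is the
  weighted square. As \<open>y\<close> is the end of the gap nearest to the origin, 1 - x^2 is at
  most 1 - y^2 on the gap; this turns the plain norm of \<open>local_trace\<close> into the weighted
  one, while lam p (b - a)^2 <= pi^2 (1 - y^2) absorbs the derivative term.\<close>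

lemma weighted_trace:
  assumes ab: "consec p a b" and y: "y = a \<and> 0 \<le> a \<or> y = b \<and> b \<le> 0"
    and e: "e = [:1, 0, -1:] * r"
  shows "lam p * (gl_weight p y / (1 - y\<^sup>2)) * (poly e y)\<^sup>2
    \<le> Cgap\<^sup>2 * (lam p * poly_integral a b (e * r) + poly_integral a b ((pderiv e)\<^sup>2))"
proof -
  note cb = consec_bounds[OF p ab]
  have y1: "\<bar>y\<bar> < 1" using y cb by auto
  have sy: "0 < 1 - y\<^sup>2" by (rule one_minus_square_pos[OF y1])
  have lp: "0 < lam p" by (rule lam_pos[OF p])
  define H where "H = b - a"
  have H: "H > 0" using cb by (simp add: H_def)
  have w: "gl_weight p y \<le> Cgap * H" "lam p * H\<^sup>2 \<le> pi\<^sup>2 * (1 - y\<^sup>2)"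
    using y wt_le_outer_gap[OF p ab] outer_gap_upper[OF p ab] inner_mirror[OF p ab] by (auto simp: H_def)
  have pe: "poly e x = (1 - x\<^sup>2) * poly r x" for x
    by (simp add: e power2_eq_square algebra_simps)
  have E: "poly_integral a b (e\<^sup>2) \<le> (1 - y\<^sup>2) * poly_integral a b (e * r)"
    unfolding poly_integral_smult[symmetric]
  proof (rule poly_integral_mono)
    fix x assume x: "x \<in> {a..b}"
    have "y\<^sup>2 \<le> x\<^sup>2" using x y by (auto simp: power2_le_iff_abs_le intro: power_mono) (auto simp: abs_le_square_iff[symmetric])
    moreover have "0 \<le> (1 - x\<^sup>2) * (poly r x)\<^sup>2" using x cb by (auto simp: abs_square_le_1 abs_le_iff)
    ultimately have "(1 - x\<^sup>2) * ((1 - x\<^sup>2) * (poly r x)\<^sup>2) \<le> (1 - y\<^sup>2) * ((1 - x\<^sup>2) * (poly r x)\<^sup>2)"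
      by (intro mult_right_mono) auto
    then show "poly (e\<^sup>2) x \<le> poly (smult (1 - y\<^sup>2) (e * r)) x"
      by (simp add: pe power2_eq_square mult_ac)
  qed
  have er: "0 \<le> poly_integral a b (e * r)"
  proof (rule poly_integral_nonneg)
    fix x assume "x \<in> {a..b}"
    then have "0 \<le> (1 - x\<^sup>2) * (poly r x)\<^sup>2" using cb by (auto simp: abs_square_le_1 abs_le_iff)
    then show "0 \<le> poly (e * r) x" by (simp add: pe power2_eq_square mult.assoc)
  qed
  define G where "G = poly_integral a b ((pderiv e)\<^sup>2)"
  have G: "0 \<le> G" unfolding G_def by (rule poly_integral_square_nonneg)
  have "lam p * (gl_weight p y / (1 - y\<^sup>2)) * (poly e y)\<^sup>2 \<le> lam p * (Cgap * H / (1 - y\<^sup>2)) * (poly e y)\<^sup>2"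
    using w(1) sy lp by (intro mult_right_mono mult_left_mono divide_right_mono) auto
  also have "\<dots> = lam p * Cgap / (1 - y\<^sup>2) * (H * (poly e y)\<^sup>2)" by simp
  also have "\<dots> \<le> lam p * Cgap / (1 - y\<^sup>2) * (2 * ((1 - y\<^sup>2) * poly_integral a b (e * r)) + 2 * H\<^sup>2 * G)"
    using local_trace[of a b y e] cb y E sy lp Cgap_ge
    by (intro mult_left_mono) (auto simp: H_def G_def)
  also have "\<dots> = Cgap * (2 * (lam p * poly_integral a b (e * r)) + 2 * (lam p * H\<^sup>2 / (1 - y\<^sup>2)) * G)"
    using sy by (simp add: divide_simps) (simp add: algebra_simps)
  also have "\<dots> \<le> Cgap * (2 * pi\<^sup>2 * (lam p * poly_integral a b (e * r)) + 2 * pi\<^sup>2 * G)"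
  proof (intro mult_left_mono add_mono mult_right_mono)
    show "2 \<le> 2 * pi\<^sup>2" using pi_ge_two power_mono[of 2 pi 2] by simp
    show "lam p * H\<^sup>2 / (1 - y\<^sup>2) \<le> pi\<^sup>2" using w(2) sy by (simp add: field_simps)
  qed (use er lp G Cgap_ge in auto)
  also have "\<dots> = Cgap * (2 * pi\<^sup>2) * (lam p * poly_integral a b (e * r) + G)" by (simp add: algebra_simps)
  also have "\<dots> \<le> Cgap * Cgap * (lam p * poly_integral a b (e * r) + G)"
    using Cgap_ge er lp G by (intro mult_right_mono mult_left_mono) auto
  finally show ?thesis by (simp add: power2_eq_square G_def)
qed

text \<open>The low part \<open>f0\<close> of W' is reproduced exactly, so what is to be bounded is
  \<open>d\<close>, the interpolant of the tail \<open>e\<close>. The inverse inequality brings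
  \<open>d\<close> to the weighted norm, quadrature to its nodal values, which are those of
  \<open>e\<close>; \<open>weighted_trace\<close> and the approximation inequality lead back to
  W'.\<close>

theorem gl_interpolation_stable:
  assumes q: "degree q \<le> p" and W: "\<And>z. z \<in> gl_points p \<Longrightarrow> poly W z = poly q z"
  shows "poly_integral (-1) 1 ((pderiv q)\<^sup>2) \<le> (8 * Cgap\<^sup>2 + 2) * poly_integral (-1) 1 ((pderiv W)\<^sup>2)"
proof -
  define l where "l = lam p"
  have l: "l > 0" using lam_pos[OF p] by (simp add: l_def)
  have lam_mono: "lam m \<le> lam n" if "m \<le> n" for m n
    using that by (auto simp: lam_def intro!: mult_mono)
  \<comment> \<open>The maximum keeps \<open>{..<p}\<close> inside \<open>{..N}\<close> when W has
    low degree.\<close>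
  define N where "N = max p (degree (pderiv W))"
  obtain a where a: "pderiv W = (\<Sum>n\<le>N. smult (a n) (legendre n))"
    using legendre_expansion[of "pderiv W" N] by (auto simp: N_def)
  define f R where "f = (\<Sum>n\<in>{p..N}. smult (a n) (legendre n))"
    and "R = (\<Sum>n\<in>{p..N}. smult (- a n / lam n) (legendre n))"
  define e where "e = [:1, 0, -1:] * pderiv R"
  have A: "finite {p..N}" "0 \<notin> {p..N}" using p by auto
  note ws = weighted_series[OF A f_def R_def e_def]
  define f0 where "f0 = (\<Sum>n\<in>{..<p}. smult (a n) (legendre n))"
  have split: "{..N} = {..<p} \<union> {p..N}" by (auto simp: N_def)
  have W': "pderiv W = f0 + f"
    unfolding a f0_def f_def split by (rule sum.union_disjoint) auto
  have nW: "poly_integral (-1) 1 ((pderiv W)\<^sup>2) = (\<Sum>n\<le>N. (a n)\<^sup>2 * (2 / (2 * real n + 1)))"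
    unfolding a using poly_integral_legendre_sum[of "{..N}" a a] by (simp add: power2_eq_square)
  have f_le: "poly_integral (-1) 1 (f\<^sup>2) \<le> poly_integral (-1) 1 ((pderiv W)\<^sup>2)"
    unfolding nW ws(2) by (intro sum_mono2) (auto simp: N_def)
  have f0_le: "poly_integral (-1) 1 (f0\<^sup>2) \<le> poly_integral (-1) 1 ((pderiv W)\<^sup>2)"
  proof -
    have "poly_integral (-1) 1 (f0\<^sup>2) = (\<Sum>n<p. (a n)\<^sup>2 * (2 / (2 * real n + 1)))"
      using poly_integral_legendre_sum[of "{..<p}" a a] by (simp add: f0_def power2_eq_square)
    also have "\<dots> \<le> poly_integral (-1) 1 ((pderiv W)\<^sup>2)"
      unfolding nW by (intro sum_mono2) (auto simp: N_def)
    finally show ?thesis .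
  qed
  \<comment> \<open>The approximation inequality: the tail contains only modes with
    \<open>lam n\<close> at least \<open>lam p\<close>.\<close>
  have er_le: "l * poly_integral (-1) 1 (e * pderiv R) \<le> poly_integral (-1) 1 (f\<^sup>2)"
    unfolding ws(2,3) sum_distrib_left
  proof (rule sum_mono)
    fix n assume n: "n \<in> {p..N}"
    then have "l \<le> lam n" "lam n > 0" using lam_mono lam_pos[of n] p by (auto simp: l_def)
    then show "l * ((a n)\<^sup>2 * (2 / (2 * real n + 1)) / lam n) \<le> (a n)\<^sup>2 * (2 / (2 * real n + 1))"
      using mult_right_mono[of "l / lam n" 1 "(a n)\<^sup>2 * (2 / (2 * real n + 1))"] by (simp add: mult_ac)
  qed
  \<comment> \<open>W - e has derivative \<open>f0\<close>, so \<open>d\<close> is a polynomial of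
    degree at most p; at the nodes q = W, and there \<open>d\<close> equals
    \<open>e\<close>.\<close>
  define d where "d = q - (W - e)"
  have d': "pderiv d = pderiv q - f0" by (simp add: d_def pderiv_diff W' ws(1))
  have "degree (pderiv d) \<le> p - 1"
    unfolding d' f0_def using q p
    by (intro degree_diff_le degree_sum_le order.trans[OF degree_smult_le]) (auto simp: degree_pderiv)
  then obtain b where b: "pderiv d = (\<Sum>n\<le>p - 1. smult (b n) (legendre n))"
    using legendre_expansion by blast
  have e_ends: "poly e 1 = 0" "poly e (-1) = 0" by (simp_all add: e_def)
  have d_ends: "poly d 1 = 0" "poly d (-1) = 0"
    using W gl_eq(4,5)[OF p] by (simp_all add: d_def e_ends)
  \<comment> \<open>\<open>d\<close> vanishes at both ends, so its derivative has mean 0. The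
    constant mode must be absent because \<open>weighted_series\<close> divides by
    \<open>lam n\<close>.\<close>
  have "b 0 = 0"
  proof -
    have "0 = poly_integral (-1) 1 (pderiv d)" by (simp add: poly_integral_pderiv d_ends)
    also have "\<dots> = (\<Sum>n\<le>p - 1. b n * poly_integral (-1) 1 (legendre n * legendre 0))"
      unfolding b by (simp add: poly_integral_sum poly_integral_smult legendre_def[of 0])
    also have "\<dots> = b 0 * 2" by (simp add: legendre_orthogonal' sum.delta if_distrib cong: if_cong)
    finally show ?thesis by simp
  qed
  define B where "B = {1..p - 1}"
  have B: "finite B" "0 \<notin> B" by (auto simp: B_def)
  have b': "pderiv d = (\<Sum>n\<in>B. smult (b n) (legendre n))"
    unfolding b by (rule sum.mono_neutral_right) (auto simp: B_def \<open>b 0 = 0\<close> not_le less_Suc_eq_le)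
  define S where "S = (\<Sum>n\<in>B. smult (- b n / lam n) (legendre n))"
  define e2 where "e2 = [:1, 0, -1:] * pderiv S"
  note ws2 = weighted_series[OF B b' S_def e2_def]
  have "d = e2"
  proof -
    have "pderiv (d - e2) = 0" by (simp add: pderiv_diff ws2(1))
    then obtain c where c: "d - e2 = [:c:]" using pderiv_iszero by blast
    then have "poly (d - e2) 1 = c" by simp
    then have "c = 0" using d_ends by (simp add: e2_def)
    then show ?thesis using c by simp
  qed
  have d_S: "poly d x = (1 - x\<^sup>2) * poly (pderiv S) x" for x
    unfolding \<open>d = e2\<close> by (simp add: e2_def power2_eq_square algebra_simps)
  \<comment> \<open>The inverse inequality: only modes with \<open>lam n\<close> at most
    \<open>lam p\<close> occur.\<close>
  have dd: "poly_integral (-1) 1 ((pderiv d)\<^sup>2) \<le> l * poly_integral (-1) 1 (d * pderiv S)"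
  proof -
    have "poly_integral (-1) 1 ((pderiv d)\<^sup>2) \<le> l * poly_integral (-1) 1 (e2 * pderiv S)"
      unfolding ws2(2,3) sum_distrib_left
    proof (rule sum_mono)
      fix n assume n: "n \<in> B"
      then have "lam n \<le> l" "lam n > 0" using lam_mono[of n p] lam_pos[of n] by (auto simp: l_def B_def)
      then show "(b n)\<^sup>2 * (2 / (2 * real n + 1)) \<le> l * ((b n)\<^sup>2 * (2 / (2 * real n + 1)) / lam n)"
        using mult_right_mono[of 1 "l / lam n" "(b n)\<^sup>2 * (2 / (2 * real n + 1))"] by (simp add: mult_ac)
    qed
    then show ?thesis by (simp add: \<open>d = e2\<close>)
  qed
  \<comment> \<open>The weighted square of \<open>d\<close>, written as the polynomial d S', stays
    within the exactness of the quadrature.\<close>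
  have degd: "degree (d * pderiv S) \<le> 2 * p - 1"
  proof -
    have "degree S \<le> p - 1"
      unfolding S_def by (intro degree_sum_le B order.trans[OF degree_smult_le]) (auto simp: B_def)
    moreover have "degree d \<le> p"
      using \<open>degree (pderiv d) \<le> p - 1\<close> p by (simp add: degree_pderiv)
    ultimately show ?thesis
      using degree_mult_le[of d "pderiv S"] by (simp add: degree_pderiv)
  qed
  define g where "g = smult l (e * pderiv R) + f\<^sup>2"
  define T where "T i = poly_integral (gl_point p i) (gl_point p (Suc i)) g" for i
  have T: "T i = l * poly_integral (gl_point p i) (gl_point p (Suc i)) (e * pderiv R) + poly_integral (gl_point p i) (gl_point p (Suc i)) ((pderiv e)\<^sup>2)" for i
    by (simp add: T_def g_def poly_integral_add poly_integral_smult ws(1))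
  have T0: "0 \<le> T i" if "i < p" for i
    unfolding T_def
  proof (rule poly_integral_nonneg)
    fix x assume x: "x \<in> {gl_point p i..gl_point p (Suc i)}"
    have "-1 \<le> x" "x \<le> 1" using x xi_le[OF p, of 0 i] xi_le[OF p, of "Suc i" p] xi_ends[OF p] that by auto
    then have "0 \<le> (1 - x\<^sup>2) * (poly (pderiv R) x)\<^sup>2" by (auto simp: abs_square_le_1 abs_le_iff)
    then have "0 \<le> l * ((1 - x\<^sup>2) * (poly (pderiv R) x)\<^sup>2) + (poly f x)\<^sup>2" using l by simp
    also have "\<dots> = poly g x" by (simp add: g_def e_def power2_eq_square algebra_simps)
    finally show "0 \<le> poly g x" .
  qed
  \<comment> \<open>The end points contribute nothing, since \<open>d\<close> vanishes there. An
    interior node uses the adjacent gap away from the origin; the bound lists both neighbours so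
    that \<open>sum_shift_gap\<close> applies.\<close>
  have node: "l * (gl_weight p (gl_point p i) * poly (d * pderiv S) (gl_point p i))
      \<le> Cgap\<^sup>2 * ((if i < p then T i else 0) + (if 0 < i then T (i - 1) else 0))" if i: "i \<le> p" for i
  proof -
    define z where "z = gl_point p i"
    have z: "z \<in> gl_points p" using xi_in[OF p i] by (simp add: z_def)
    have rhs: "0 \<le> (if i < p then T i else 0)" "0 \<le> (if 0 < i then T (i - 1) else 0)"
      using T0[of i] T0[of "i - 1"] i by auto
    show ?thesis
    proof (cases "i = 0 \<or> i = p")
      case True
      then have "poly d z = 0" using xi_ends[OF p] d_ends by (auto simp: z_def)
      then have "l * (gl_weight p (gl_point p i) * poly (d * pderiv S) (gl_point p i)) = 0" by (simp add: z_def)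
      then show ?thesis
        using mult_nonneg_nonneg[OF zero_le_power2[of Cgap] add_nonneg_nonneg[OF rhs]] by (simp only:)
    next
      case False
      then have ip: "0 < i" "i < p" using i by auto
      have z1: "\<bar>z\<bar> < 1" using xi_less[OF p, of 0 i] xi_less[OF p, of i p] xi_ends[OF p] ip by (auto simp: z_def)
      have sz: "0 < 1 - z\<^sup>2" by (rule one_minus_square_pos[OF z1])
      have "poly d z = poly e z" using W[OF z] by (simp add: d_def)
      then have eq: "poly (d * pderiv S) z = (poly e z)\<^sup>2 / (1 - z\<^sup>2)"
      proof -
        have "poly (pderiv S) z = poly e z / (1 - z\<^sup>2)"
          using d_S[of z] sz \<open>poly d z = poly e z\<close> by (simp add: eq_divide_eq mult.commute)
        then show ?thesis using \<open>poly d z = poly e z\<close> by (simp add: power2_eq_square)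
      qed
      have "l * (gl_weight p z / (1 - z\<^sup>2)) * (poly e z)\<^sup>2 \<le> Cgap\<^sup>2 * (T i + T (i - 1))"
      proof (cases "0 \<le> z")
        case True
        have "l * (gl_weight p z / (1 - z\<^sup>2)) * (poly e z)\<^sup>2 \<le> Cgap\<^sup>2 * T i"
          unfolding T l_def using True
          by (intro weighted_trace xi_consec[OF p] e_def ip) (simp add: z_def)
        also have "\<dots> \<le> Cgap\<^sup>2 * (T i + T (i - 1))" using rhs ip by (intro mult_left_mono) auto
        finally show ?thesis .
      next
        case False
        have c: "consec p (gl_point p (i - 1)) (gl_point p (Suc (i - 1)))" using ip by (intro xi_consec[OF p]) auto
        have "l * (gl_weight p z / (1 - z\<^sup>2)) * (poly e z)\<^sup>2 \<le> Cgap\<^sup>2 * T (i - 1)"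
          unfolding T l_def using False ip
          by (intro weighted_trace c e_def) (simp add: z_def)
        also have "\<dots> \<le> Cgap\<^sup>2 * (T i + T (i - 1))" using rhs ip by (intro mult_left_mono) auto
        finally show ?thesis .
      qed
      then show ?thesis using ip unfolding eq[unfolded z_def] z_def by (simp add: mult_ac)
    qed
  qed
  have "poly_integral (-1) 1 ((pderiv d)\<^sup>2) \<le> l * (\<Sum>i\<le>p. gl_weight p (gl_point p i) * poly (d * pderiv S) (gl_point p i))"
    using dd by (simp add: gl_quadrature[OF p degd] sum_gl[OF p])
  also have "\<dots> \<le> (\<Sum>i\<le>p. Cgap\<^sup>2 * ((if i < p then T i else 0) + (if 0 < i then T (i - 1) else 0)))"
    unfolding sum_distrib_left by (intro sum_mono node) simp
  \<comment> \<open>Every gap is charged at most twice, once from each of its ends.\<close>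
  also have "\<dots> = Cgap\<^sup>2 * (\<Sum>a<p. T a * (1 + 1))"
    using sum_shift_gap[OF p, of T "\<lambda>_. 1"] by (simp add: sum_distrib_left[symmetric])
  also have "\<dots> = 2 * Cgap\<^sup>2 * poly_integral (-1) 1 g"
    using sum_poly_integral_cells[OF p, of p g] xi_ends[OF p] by (simp add: T_def flip: sum_distrib_right)
  also have "\<dots> \<le> 2 * Cgap\<^sup>2 * (2 * poly_integral (-1) 1 ((pderiv W)\<^sup>2))"
    using er_le f_le by (intro mult_left_mono) (auto simp: g_def poly_integral_add poly_integral_smult)
  finally have d_le: "poly_integral (-1) 1 ((pderiv d)\<^sup>2) \<le> 4 * Cgap\<^sup>2 * poly_integral (-1) 1 ((pderiv W)\<^sup>2)"
    by simp
  have "pderiv q = pderiv d + f0" by (simp add: d')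
  then have "poly_integral (-1) 1 ((pderiv q)\<^sup>2) \<le> 2 * poly_integral (-1) 1 ((pderiv d)\<^sup>2) + 2 * poly_integral (-1) 1 (f0\<^sup>2)"
    using poly_integral_power2_sum_le by metis
  then show ?thesis using d_le f0_le by (simp add: algebra_simps)
qed

end

section \<open>Bernstein polynomials and their H^1 energy\<close>

definition bernp :: "nat \<Rightarrow> nat \<Rightarrow> real poly" where
  "bernp n k = smult (real (n choose k)) ([:0, 1:] ^ k * [:1, -1:] ^ (n - k))"

lemma poly_bernp: "poly (bernp n k) x = Bernstein n k x"
  by (simp add: bernp_def Bernstein_def)

lemma pderiv_bernp_0: "pderiv (bernp (Suc m) 0) = smult (- real (Suc m)) (bernp m 0)"
proof (rule poly_ext)
  fix x :: real
  have "pderiv ([:1, -1:] ^ Suc m :: real poly) = smult (real (Suc m)) ([:1, -1:] ^ m) * [:-1:]"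
    unfolding pderiv_power_Suc by (simp add: pderiv_pCons)
  from arg_cong[OF this, of "\<lambda>f. poly f x"]
  show "poly (pderiv (bernp (Suc m) 0)) x = poly (smult (- real (Suc m)) (bernp m 0)) x"
    by (simp add: bernp_def)
qed

lemma pderiv_bernp_Suc:
  assumes "j \<le> m"
  shows "pderiv (bernp (Suc m) (Suc j)) = smult (real (Suc m)) (bernp m j - bernp m (Suc j))"
proof (rule poly_ext)
  fix x :: real
  have 1: "pderiv ([:0, 1:] ^ Suc j :: real poly) = smult (real (Suc j)) ([:0, 1:] ^ j)"
    unfolding pderiv_power_Suc by (simp add: pderiv_pCons one_pCons)
  have 2: "poly (pderiv ([:1, -1:] ^ (m - j))) x = - real (m - j) * (1 - x) ^ (m - Suc j)"
  proof (cases "m - j")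
    case (Suc i)
    have "pderiv ([:1, -1:] ^ Suc i :: real poly) = smult (real (Suc i)) ([:1, -1:] ^ i) * [:-1:]"
      unfolding pderiv_power_Suc by (simp add: pderiv_pCons)
    from arg_cong[OF this, of "\<lambda>f. poly f x"] show ?thesis
      using Suc by (simp add: Suc_diff_Suc[symmetric] diff_Suc split: nat.split)
  qed simp
  have b1: "real (Suc m choose Suc j) * real (Suc j) = real (Suc m) * real (m choose j)"
    using Suc_times_binomial_eq[of m j] by (metis of_nat_mult)
  have b2: "real (Suc m choose Suc j) * real (m - j) = real (Suc m) * real (m choose Suc j)"
  proof -
    have "(m - j) * (Suc m choose Suc j) = Suc m * (m choose Suc j)"
      using binomial_absorb_comp[of "Suc m" "Suc j"] by simp
    then show ?thesis by (metis of_nat_mult mult.commute)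
  qed
  have "poly (pderiv (bernp (Suc m) (Suc j))) x
    = real (Suc m choose Suc j) * real (Suc j) * (x ^ j * (1 - x) ^ (m - j))
      - real (Suc m choose Suc j) * real (m - j) * (x ^ Suc j * (1 - x) ^ (m - Suc j))"
    unfolding bernp_def pderiv_smult pderiv_mult diff_Suc_Suc
    by (simp only: poly_smult poly_add poly_mult 1 2) (simp add: algebra_simps)
  then show "poly (pderiv (bernp (Suc m) (Suc j))) x = poly (smult (real (Suc m)) (bernp m j - bernp m (Suc j))) x"
    unfolding b1 b2 by (simp add: bernp_def algebra_simps del: of_nat_Suc)
qed

text \<open>Neighbouring basis polynomials have equal integrals, because their difference is a
  multiple of the derivative of a Bernstein polynomial that vanishes at both ends.\<close>

lemma poly_integral_bernp: "j \<le> m \<Longrightarrow> poly_integral 0 1 (bernp m j) = 1 / real (Suc m)"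
proof (induction j)
  case 0
  have "real (Suc m) * poly_integral 0 1 (bernp m 0) = - poly_integral 0 1 (pderiv (bernp (Suc m) 0))"
    unfolding pderiv_bernp_0 poly_integral_smult by (simp add: algebra_simps)
  also have "\<dots> = 1" by (simp add: poly_integral_pderiv poly_bernp Bernstein_def)
  finally show ?case by (simp add: field_simps)
next
  case (Suc j)
  have "real (Suc m) * (poly_integral 0 1 (bernp m j) - poly_integral 0 1 (bernp m (Suc j))) = poly_integral 0 1 (pderiv (bernp (Suc m) (Suc j)))"
    using Suc.prems by (simp add: pderiv_bernp_Suc poly_integral_smult poly_integral_diff)
  also have "\<dots> = 0" using Suc.prems by (simp add: poly_integral_pderiv poly_bernp Bernstein_def)
  finally show ?case using Suc by simp
qed

definition bernpoly :: "nat \<Rightarrow> (nat \<Rightarrow> real) \<Rightarrow> real poly" where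
  "bernpoly n u = (\<Sum>k\<le>n. smult (u k) (bernp n k))"

lemma pderiv_sum: "pderiv (\<Sum>i\<in>A. f i) = (\<Sum>i\<in>A. pderiv (f i :: real poly))"
  using higher_pderiv_sum[of 1 f A] by simp

lemma pderiv_bernpoly:
  "pderiv (bernpoly (Suc m) u) = smult (real (Suc m)) (\<Sum>j\<le>m. smult (u (Suc j) - u j) (bernp m j))"
proof -
  have "pderiv (bernpoly (Suc m) u) = smult (real (Suc m)) (- smult (u 0) (bernp m 0)
      + (\<Sum>j\<le>m. smult (u (Suc j)) (bernp m j)) - (\<Sum>j\<le>m. smult (u (Suc j)) (bernp m (Suc j))))"
    unfolding bernpoly_def sum.atMost_Suc_shift pderiv_add pderiv_sum
    by (intro poly_ext)
      (simp add: pderiv_smult pderiv_bernp_0 pderiv_bernp_Suc poly_sum sum_distrib_left sum_subtractf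
        right_diff_distrib mult_ac del: of_nat_Suc)
  moreover have "smult (u 0) (bernp m 0) + (\<Sum>j\<le>m. smult (u (Suc j)) (bernp m (Suc j))) = (\<Sum>j\<le>m. smult (u j) (bernp m j))"
  proof -
    \<comment> \<open>The added term is 0, as m choose (m + 1) vanishes.\<close>
    have "(\<Sum>j\<le>Suc m. smult (u j) (bernp m j)) = (\<Sum>j\<le>m. smult (u j) (bernp m j))"
      by (simp add: bernp_def)
    then show ?thesis by (simp add: sum.atMost_Suc_shift del: sum.atMost_Suc)
  qed
  ultimately show ?thesis
    by (simp add: smult_diff_left sum_subtractf algebra_simps flip: smult_add_right smult_diff_right)
qed

lemma weighted_Cauchy_Schwarz:
  fixes s l :: "'a \<Rightarrow> real"
  assumes "\<And>a. a \<in> A \<Longrightarrow> 0 \<le> l a"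
  shows "(\<Sum>a\<in>A. s a * l a)\<^sup>2 \<le> (\<Sum>a\<in>A. l a) * (\<Sum>a\<in>A. (s a)\<^sup>2 * l a)"
proof -
  have "(\<Sum>a\<in>A. sqrt (l a) * (s a * sqrt (l a)))\<^sup>2 \<le> (\<Sum>a\<in>A. (sqrt (l a))\<^sup>2) * (\<Sum>a\<in>A. (s a * sqrt (l a))\<^sup>2)"
    by (rule Cauchy_Schwarz_ineq_sum)
  moreover have "(\<Sum>a\<in>A. sqrt (l a) * (s a * sqrt (l a))) = (\<Sum>a\<in>A. s a * l a)"
    by (rule sum.cong) (use assms in auto)
  moreover have "(\<Sum>a\<in>A. (sqrt (l a))\<^sup>2) = (\<Sum>a\<in>A. l a)"
    by (rule sum.cong) (use assms in auto)
  moreover have "(\<Sum>a\<in>A. (s a * sqrt (l a))\<^sup>2) = (\<Sum>a\<in>A. (s a)\<^sup>2 * l a)"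
    by (rule sum.cong) (use assms in \<open>auto simp: power_mult_distrib\<close>)
  ultimately show ?thesis by simp
qed

text \<open>
  This lets the interpolation estimate, which is proved for polynomial data, be applied to
  piecewise linear data.
\<close>

lemma bernpoly_energy:
  "poly_integral 0 1 ((pderiv (bernpoly (Suc m) u))\<^sup>2) \<le> real (Suc m) * (\<Sum>j\<le>m. (u (Suc j) - u j)\<^sup>2)"
proof -
  define d where "d j = u (Suc j) - u j" for j
  have "poly_integral 0 1 ((pderiv (bernpoly (Suc m) u))\<^sup>2)
      \<le> poly_integral 0 1 (smult ((real (Suc m))\<^sup>2) (\<Sum>j\<le>m. smult ((d j)\<^sup>2) (bernp m j)))"
  proof (rule poly_integral_mono)
    fix x :: real assume x: "x \<in> {0..1}"
    \<comment> \<open>Jensen's inequality: the Bernstein polynomials are nonnegative on [0, 1] and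
      sum to 1.\<close>
    have "(\<Sum>j\<le>m. d j * Bernstein m j x)\<^sup>2 \<le> (\<Sum>j\<le>m. Bernstein m j x) * (\<Sum>j\<le>m. (d j)\<^sup>2 * Bernstein m j x)"
      using x by (intro weighted_Cauchy_Schwarz Bernstein_nonneg) auto
    then have "(\<Sum>j\<le>m. d j * Bernstein m j x)\<^sup>2 \<le> (\<Sum>j\<le>m. (d j)\<^sup>2 * Bernstein m j x)"
      by simp
    then show "poly ((pderiv (bernpoly (Suc m) u))\<^sup>2) x
      \<le> poly (smult ((real (Suc m))\<^sup>2) (\<Sum>j\<le>m. smult ((d j)\<^sup>2) (bernp m j))) x"
      unfolding pderiv_bernpoly
      by (simp add: poly_sum poly_bernp power_mult_distrib mult_left_mono flip: d_def del: of_nat_Suc)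
  qed
  also have "\<dots> = (real (Suc m))\<^sup>2 * (\<Sum>j\<le>m. (d j)\<^sup>2 * (1 / real (Suc m)))"
    by (simp add: poly_integral_smult poly_integral_sum poly_integral_bernp del: of_nat_Suc)
  also have "\<dots> = real (Suc m) * (\<Sum>j\<le>m. (d j)\<^sup>2)"
    by (simp add: power2_eq_square flip: sum_divide_distrib del: of_nat_Suc)
  finally show ?thesis by (simp add: d_def)
qed

section \<open>Transfer to the unit interval and to arbitrary nodal data\<close>

lemma gl_node_eq: "gl_node p i = (1 + gl_point p i) / 2"
proof -
  have "{\<xi>. poly ([:-1, 0, 1:] * pderiv (legendre p)) \<xi> = 0} = gl_points p"
    by (auto simp: gl_points_def poly_lobatto power2_eq_square)
  then show ?thesis by (simp add: gl_node_def gl_point_def)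
qed

lemma poly_integral_affine: "poly_integral 0 1 f = poly_integral (-1) 1 (pcompose f [:1/2, 1/2:]) / 2"
proof -
  obtain F where F: "pderiv F = f" using poly_antiderivative by blast
  have "pderiv (pcompose F [:1/2, 1/2:]) = smult (1/2) (pcompose f [:1/2, 1/2:])"
    by (simp add: pderiv_pcompose F pderiv_pCons)
  then have "poly_integral (-1) 1 (smult (1/2) (pcompose f [:1/2, 1/2:]))
      = poly (pcompose F [:1/2, 1/2:]) 1 - poly (pcompose F [:1/2, 1/2:]) (-1)"
    using poly_integral_pderiv[of "-1" 1 "pcompose F [:1/2, 1/2:]"] by simp
  then show ?thesis using poly_integral_pderiv[of 0 1 F] by (simp add: F poly_integral_smult poly_pcompose)
qed

definition lagp :: "nat \<Rightarrow> nat \<Rightarrow> real poly" where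
  "lagp p i = (\<Prod>j\<in>{0..p} - {i}. smult (1 / (gl_node p i - gl_node p j)) [:- gl_node p j, 1:])"

lemma poly_lagp: "poly (lagp p i) x = lagrange p i x"
  by (simp add: lagp_def lagrange_def poly_prod field_simps diff_divide_distrib)

definition gl_interp :: "nat \<Rightarrow> (nat \<Rightarrow> real) \<Rightarrow> real poly" where
  "gl_interp p c = (\<Sum>i\<le>p. smult (c i) (lagp p i))"

definition cell_width :: "nat \<Rightarrow> nat \<Rightarrow> real" where
  "cell_width p a = gl_node p (Suc a) - gl_node p a"

context
  fixes p :: nat assumes p: "1 \<le> p"
begin

lemma gl_node_less: "i < j \<Longrightarrow> j \<le> p \<Longrightarrow> gl_node p i < gl_node p j"
  using xi_less[OF p, of i j] by (simp add: gl_node_eq)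

lemma gl_node_le: "i \<le> j \<Longrightarrow> j \<le> p \<Longrightarrow> gl_node p i \<le> gl_node p j"
  using xi_le[OF p, of i j] by (simp add: gl_node_eq)

lemma gl_node_ends: "gl_node p 0 = 0" "gl_node p p = 1"
  using xi_ends[OF p] by (simp_all add: gl_node_eq)

lemma gl_node_bounds: "i \<le> p \<Longrightarrow> 0 \<le> gl_node p i \<and> gl_node p i \<le> 1"
  using gl_node_le[of 0 i] gl_node_le[of i p] gl_node_ends by simp

lemma cell_eq: "cell_width p a = gl_gap p a / 2"
  by (simp add: cell_width_def gl_gap_def gl_node_eq field_simps)

lemma cell_pos: "a < p \<Longrightarrow> 0 < cell_width p a"
  using gl_node_less[of a "Suc a"] by (simp add: cell_width_def)

lemma lagrange_node: "i \<le> p \<Longrightarrow> k \<le> p \<Longrightarrow> lagrange p i (gl_node p k) = (if k = i then 1 else 0)"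
proof (cases "k = i")
  case True
  assume i: "i \<le> p"
  have "gl_node p i \<noteq> gl_node p j" if "j \<le> p" "j \<noteq> i" for j
    using gl_node_less[of i j] gl_node_less[of j i] i that by (cases i j rule: linorder_cases) auto
  then show ?thesis using True by (simp add: lagrange_def)
next
  case False
  assume "i \<le> p" "k \<le> p"
  then show ?thesis using False by (auto simp: lagrange_def intro!: prod_zero)
qed

lemma degree_lagp: "i \<le> p \<Longrightarrow> degree (lagp p i) \<le> p"
proof -
  assume i: "i \<le> p"
  have "degree (lagp p i) \<le> (\<Sum>j\<in>{0..p} - {i}. degree (smult (1 / (gl_node p i - gl_node p j)) [:- gl_node p j, 1:]))"
    unfolding lagp_def by (rule degree_prod_sum_le[unfolded o_def]) simp
  also have "\<dots> \<le> (\<Sum>j\<in>{0..p} - {i}. 1)"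
    by (rule sum_mono) (auto intro: order.trans[OF degree_smult_le])
  also have "\<dots> = p" using i by (simp add: card_Diff_singleton)
  finally show ?thesis .
qed

lemma degree_gl_interp: "degree (gl_interp p c) \<le> p"
  unfolding gl_interp_def
  by (intro degree_sum_le order.trans[OF degree_smult_le] degree_lagp) auto

lemma gl_interp_node: "k \<le> p \<Longrightarrow> poly (gl_interp p c) (gl_node p k) = c k"
proof -
  assume k: "k \<le> p"
  have "poly (gl_interp p c) (gl_node p k) = (\<Sum>i\<le>p. if k = i then c i else 0)"
    unfolding gl_interp_def poly_sum
    by (rule sum.cong) (auto simp: poly_lagp lagrange_node k)
  then show ?thesis using k by simp
qed

lemma poly_pcompose_xi: "poly (pcompose f [:1/2, 1/2:]) (gl_point p i) = poly f (gl_node p i)"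
  by (simp add: poly_pcompose gl_node_eq add_divide_distrib)

lemma poly_integral_pderiv_affine:
  "poly_integral (-1) 1 ((pderiv (pcompose f [:1/2, 1/2:]))\<^sup>2) = poly_integral 0 1 ((pderiv f)\<^sup>2) / 2"
proof -
  have "(pderiv (pcompose f [:1/2, 1/2:]))\<^sup>2 = smult (1/4) (pcompose ((pderiv f)\<^sup>2) [:1/2, 1/2:])"
    by (rule poly_ext) (simp add: pderiv_pcompose pderiv_pCons poly_pcompose power2_eq_square)
  then show ?thesis unfolding poly_integral_affine[of "(pderiv f)\<^sup>2"] by (simp add: poly_integral_smult)
qed

theorem interp_mass_equivalence:
  "poly_integral 0 1 ((gl_interp p c)\<^sup>2) \<le> Cgap * (\<Sum>a<p. cell_width p a * ((c a)\<^sup>2 + (c (Suc a))\<^sup>2))"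
  "(\<Sum>a<p. cell_width p a * ((c a)\<^sup>2 + (c (Suc a))\<^sup>2)) \<le> 6 * Cgap * poly_integral 0 1 ((gl_interp p c)\<^sup>2)"
proof -
  define q where "q = pcompose (gl_interp p c) [:1/2, 1/2:]"
  have dq: "degree q \<le> p" using degree_gl_interp by (simp add: q_def degree_pcompose)
  have v: "poly q (gl_point p a) = c a" if "a \<le> p" for a
    using gl_interp_node[OF that] by (simp add: q_def poly_pcompose_xi)
  have "pcompose ((gl_interp p c)\<^sup>2) [:1/2, 1/2:] = q\<^sup>2"
    by (rule poly_ext) (simp add: q_def poly_pcompose)
  then have I: "poly_integral (-1) 1 (q\<^sup>2) = 2 * poly_integral 0 1 ((gl_interp p c)\<^sup>2)"
    by (simp add: poly_integral_affine)
  have S: "(\<Sum>a<p. gl_gap p a * ((poly q (gl_point p a))\<^sup>2 + (poly q (gl_point p (Suc a)))\<^sup>2))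
    = 2 * (\<Sum>a<p. cell_width p a * ((c a)\<^sup>2 + (c (Suc a))\<^sup>2))"
    unfolding sum_distrib_left by (rule sum.cong) (auto simp: v cell_eq)
  show "poly_integral 0 1 ((gl_interp p c)\<^sup>2) \<le> Cgap * (\<Sum>a<p. cell_width p a * ((c a)\<^sup>2 + (c (Suc a))\<^sup>2))"
    "(\<Sum>a<p. cell_width p a * ((c a)\<^sup>2 + (c (Suc a))\<^sup>2)) \<le> 6 * Cgap * poly_integral 0 1 ((gl_interp p c)\<^sup>2)"
    using gl_mass_equivalence[OF p dq] unfolding I S by simp_all
qed

theorem interp_stiffness_lower:
  "(\<Sum>a<p. (c (Suc a) - c a)\<^sup>2 / cell_width p a) \<le> poly_integral 0 1 ((pderiv (gl_interp p c))\<^sup>2)"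
proof -
  define q where "q = pcompose (gl_interp p c) [:1/2, 1/2:]"
  have v: "poly q (gl_point p a) = c a" if "a \<le> p" for a
    using gl_interp_node[OF that] by (simp add: q_def poly_pcompose_xi)
  have "(\<Sum>a<p. (poly q (gl_point p (Suc a)) - poly q (gl_point p a))\<^sup>2 / gl_gap p a) = (\<Sum>a<p. (c (Suc a) - c a)\<^sup>2 / cell_width p a) / 2"
    unfolding sum_divide_distrib by (rule sum.cong) (auto simp: v cell_eq)
  then show ?thesis
    using gl_stiffness_lower[OF p, of q] by (simp add: q_def poly_integral_pderiv_affine)
qed

lemma interp_stable_poly:
  "poly_integral 0 1 ((pderiv (gl_interp p (\<lambda>i. poly W (gl_node p i))))\<^sup>2) \<le> (8 * Cgap\<^sup>2 + 2) * poly_integral 0 1 ((pderiv W)\<^sup>2)"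
proof -
  define c where "c i = poly W (gl_node p i)" for i
  define q where "q = pcompose (gl_interp p c) [:1/2, 1/2:]"
  have dq: "degree q \<le> p" using degree_gl_interp by (simp add: q_def degree_pcompose)
  have "poly (pcompose W [:1/2, 1/2:]) z = poly q z" if z: "z \<in> gl_points p" for z
  proof -
    obtain i where "i \<le> p" "z = gl_point p i"
      using z bij_betw_imp_surj_on[OF xi_bij[OF p]] by (metis atMost_iff imageE)
    then show ?thesis using gl_interp_node[of i c] by (simp add: q_def poly_pcompose_xi c_def)
  qed
  from gl_interpolation_stable[OF p dq this] show ?thesis
    by (simp add: q_def poly_integral_pderiv_affine c_def[abs_def])
qed

text \<open>The piecewise linear interpolant \<open>u\<close> of the data is approximated by its
  Bernstein polynomials, whose energy does not exceed that of \<open>u\<close>. Their nodal values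
  converge to \<open>c\<close>, and the left side is a quadratic form in finitely many nodal values,
  so the polynomial estimate passes to the limit.\<close>

theorem interp_stiffness_upper:
  "poly_integral 0 1 ((pderiv (gl_interp p c))\<^sup>2) \<le> (8 * Cgap\<^sup>2 + 2) * (\<Sum>a<p. (c (Suc a) - c a)\<^sup>2 / cell_width p a)"
proof -
  define K where "K = 8 * Cgap\<^sup>2 + 2"
  define s where "s a = (c (Suc a) - c a) / cell_width p a" for a
  \<comment> \<open>The length of the part of cell \<open>a\<close> to the left of \<open>x\<close>.
    With it \<open>u\<close> and its accumulated energy \<open>E\<close> need no case distinction
    between cells.\<close>
  define len where "len a x = min x (gl_node p (Suc a)) - min x (gl_node p a)" for a x
  define u where "u x = c 0 + (\<Sum>a<p. s a * len a x)" for x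
  define E where "E x = (\<Sum>a<p. (s a)\<^sup>2 * len a x)" for x
  define S where "S = (\<Sum>a<p. (c (Suc a) - c a)\<^sup>2 / cell_width p a)"
  have len_mono: "len a x \<le> len a y" if "a < p" "x \<le> y" for a x y
    using that gl_node_le[of a "Suc a"] by (auto simp: len_def min_def)
  have len_sum: "(\<Sum>a<p. len a x) = x" if "0 \<le> x" "x \<le> 1" for x
    unfolding len_def sum_lessThan_telescope[of "\<lambda>a. min x (gl_node p a)"]
    using that gl_node_ends by simp
  have u_node: "u (gl_node p i) = c i" if i: "i \<le> p" for i
  proof -
    have "(\<Sum>a<p. s a * len a (gl_node p i)) = (\<Sum>a<i. c (Suc a) - c a)"
    proof (rule sum.mono_neutral_cong_right)
      show "\<forall>a\<in>{..<p} - {..<i}. s a * len a (gl_node p i) = 0"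
        using gl_node_le i by (auto simp: len_def min_absorb1)
      fix a assume "a \<in> {..<i}"
      then show "s a * len a (gl_node p i) = c (Suc a) - c a"
        using gl_node_le[of a i] gl_node_le[of "Suc a" i] i cell_pos[of a]
        by (simp add: len_def min_absorb2 s_def flip: cell_width_def)
    qed (use i in auto)
    also have "\<dots> = c i - c 0" by (rule sum_lessThan_telescope)
    finally show ?thesis by (simp add: u_def)
  qed
  have cont: "continuous_on {0..1} u"
    unfolding u_def len_def by (intro continuous_intros)
  \<comment> \<open>Cauchy-Schwarz on an arbitrary subinterval; the sampling points of the Bernstein
    polynomials are unrelated to the nodes, and these bounds telescope over them.\<close>
  have diff: "(u y - u x)\<^sup>2 \<le> (y - x) * (E y - E x)" if xy: "0 \<le> x" "x \<le> y" "y \<le> 1" for x y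
  proof -
    have "(\<Sum>a<p. s a * (len a y - len a x))\<^sup>2
      \<le> (\<Sum>a<p. len a y - len a x) * (\<Sum>a<p. (s a)\<^sup>2 * (len a y - len a x))"
      by (rule weighted_Cauchy_Schwarz) (use len_mono xy in auto)
    moreover have "u y - u x = (\<Sum>a<p. s a * (len a y - len a x))"
      by (simp add: u_def sum_subtractf right_diff_distrib)
    moreover have "(\<Sum>a<p. len a y - len a x) = y - x"
      using xy by (simp add: sum_subtractf len_sum)
    moreover have "E y - E x = (\<Sum>a<p. (s a)\<^sup>2 * (len a y - len a x))"
      by (simp add: E_def sum_subtractf right_diff_distrib)
    ultimately show ?thesis by simp
  qed
  have E1: "E 1 - E 0 = S"
  proof -
    have "E 1 - E 0 = (\<Sum>a<p. (s a)\<^sup>2 * (len a 1 - len a 0))"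
      by (simp add: E_def sum_subtractf right_diff_distrib)
    also have "\<dots> = S" unfolding S_def
    proof (rule sum.cong)
      fix a assume "a \<in> {..<p}"
      then have a: "a < p" by simp
      then have "len a 1 - len a 0 = cell_width p a"
        using gl_node_bounds[of a] gl_node_bounds[of "Suc a"] by (simp add: len_def cell_width_def)
      then show "(s a)\<^sup>2 * (len a 1 - len a 0) = (c (Suc a) - c a)\<^sup>2 / cell_width p a"
        using cell_pos[OF a] by (simp add: s_def power2_eq_square)
    qed simp
    finally show ?thesis .
  qed
  \<comment> \<open>The shifted index keeps the degree positive, as \<open>bernpoly_energy\<close>
    requires.\<close>
  define W where "W n = bernpoly (Suc n) (\<lambda>k. u (real k / real (Suc n)))" for n
  have W_energy: "poly_integral 0 1 ((pderiv (W n))\<^sup>2) \<le> S" for n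
  proof -
    define N where "N = real (Suc n)"
    have N: "N > 0" by (simp add: N_def)
    have "poly_integral 0 1 ((pderiv (W n))\<^sup>2) \<le> N * (\<Sum>j\<le>n. (u (real (Suc j) / N) - u (real j / N))\<^sup>2)"
      unfolding W_def N_def by (rule bernpoly_energy)
    also have "\<dots> = (\<Sum>j\<le>n. N * (u (real (Suc j) / N) - u (real j / N))\<^sup>2)"
      by (rule sum_distrib_left)
    also have "\<dots> \<le> (\<Sum>j\<le>n. E (real (Suc j) / N) - E (real j / N))"
    proof (rule sum_mono)
      fix j assume "j \<in> {..n}"
      then have j: "real (Suc j) \<le> N" by (simp add: N_def)
      have "N * (u (real (Suc j) / N) - u (real j / N))\<^sup>2
        \<le> N * ((real (Suc j) / N - real j / N) * (E (real (Suc j) / N) - E (real j / N)))"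
        using N j by (intro mult_left_mono diff) (auto simp: divide_right_mono)
      also have "\<dots> = E (real (Suc j) / N) - E (real j / N)"
        using N by (simp add: field_simps)
      finally show "N * (u (real (Suc j) / N) - u (real j / N))\<^sup>2 \<le> E (real (Suc j) / N) - E (real j / N)" .
    qed
    also have "\<dots> = E (real (Suc n) / N) - E (real 0 / N)"
      using sum_lessThan_telescope[of "\<lambda>j. E (real j / N)" "Suc n"] by (simp only: lessThan_Suc_atMost)
    also have "\<dots> = S" using N E1 by (simp add: N_def del: of_nat_Suc)
    finally show ?thesis .
  qed
  have W_lim: "(\<lambda>n. poly (W n) x) \<longlonglongrightarrow> u x" if x: "x \<in> {0..1}" for x
  proof (rule LIMSEQ_I)
    fix r :: real assume "0 < r"
    then obtain N where N: "\<And>n x. N \<le> n \<Longrightarrow> x \<in> {0..1} \<Longrightarrow> \<bar>u x - (\<Sum>k\<le>n. u (real k / real n) * Bernstein n k x)\<bar> < r"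
      using Bernstein_Weierstrass[OF cont] by blast
    have "poly (W n) x = (\<Sum>k\<le>Suc n. u (real k / real (Suc n)) * Bernstein (Suc n) k x)" for n
      by (simp add: W_def bernpoly_def poly_sum poly_bernp del: sum.atMost_Suc of_nat_Suc)
    then show "\<exists>no. \<forall>n\<ge>no. norm (poly (W n) x - u x) < r"
      using N[OF _ x] by (metis abs_minus_commute le_SucI real_norm_def)
  qed
  have form: "poly_integral 0 1 ((pderiv (gl_interp p b))\<^sup>2)
    = (\<Sum>i\<le>p. \<Sum>k\<le>p. b i * b k * poly_integral 0 1 (pderiv (lagp p i) * pderiv (lagp p k)))" for b
    by (simp add: gl_interp_def pderiv_sum pderiv_smult power2_eq_square sum_product poly_integral_sum poly_integral_smult mult_ac)
  have "(\<lambda>n. poly_integral 0 1 ((pderiv (gl_interp p (\<lambda>i. poly (W n) (gl_node p i))))\<^sup>2)) \<longlonglongrightarrow> poly_integral 0 1 ((pderiv (gl_interp p c))\<^sup>2)"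
    unfolding form
  proof (intro tendsto_intros)
    fix i k assume "i \<in> {..p}" "k \<in> {..p}"
    then show "(\<lambda>n. poly (W n) (gl_node p i)) \<longlonglongrightarrow> c i" "(\<lambda>n. poly (W n) (gl_node p k)) \<longlonglongrightarrow> c k"
      using W_lim gl_node_bounds u_node by (metis atLeastAtMost_iff atMost_iff)+
  qed
  then show ?thesis
  proof (rule LIMSEQ_le_const2)
    show "\<exists>N. \<forall>n\<ge>N. poly_integral 0 1 ((pderiv (gl_interp p (\<lambda>i. poly (W n) (gl_node p i))))\<^sup>2)
        \<le> (8 * Cgap\<^sup>2 + 2) * (\<Sum>a<p. (c (Suc a) - c a)\<^sup>2 / cell_width p a)"
    proof (intro exI allI impI)
      fix n
      have "poly_integral 0 1 ((pderiv (gl_interp p (\<lambda>i. poly (W n) (gl_node p i))))\<^sup>2) \<le> K * poly_integral 0 1 ((pderiv (W n))\<^sup>2)"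
        unfolding K_def by (rule interp_stable_poly)
      also have "\<dots> \<le> K * S"
        using W_energy by (intro mult_left_mono) (auto simp: K_def)
      finally show "poly_integral 0 1 ((pderiv (gl_interp p (\<lambda>i. poly (W n) (gl_node p i))))\<^sup>2)
        \<le> (8 * Cgap\<^sup>2 + 2) * (\<Sum>a<p. (c (Suc a) - c a)\<^sup>2 / cell_width p a)"
        by (simp add: K_def S_def)
    qed
  qed
qed

end

section \<open>Tensor products\<close>

text \<open>The piece of \<open>hat p i\<close> on cell \<open>a\<close>, continued as a polynomial,
  so that both discretizations lead to Gram matrices of polynomials.\<close>

definition hatp :: "nat \<Rightarrow> nat \<Rightarrow> nat \<Rightarrow> real poly" where
  "hatp p a i = (if i = a then smult (1 / cell_width p a) [:gl_node p (Suc a), -1:]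
     else if i = Suc a then smult (1 / cell_width p a) [:- gl_node p a, 1:] else 0)"

lemma hat_eq_hatp:
  assumes p: "1 \<le> p" and a: "a < p" and i: "i \<le> p" and x: "gl_node p a < x" "x < gl_node p (Suc a)"
  shows "hat p i x = poly (hatp p a i) x"
proof -
  have le: "gl_node p j \<le> gl_node p k" if "j \<le> k" "k \<le> p" for j k
    using gl_node_le[OF p that] .
  consider "i = a" | "i = Suc a" | "i < a" | "Suc a < i" by linarith
  then show ?thesis
  proof cases
    case 1
    then show ?thesis using x a by (simp add: hat_def hatp_def cell_width_def diff_divide_distrib)
  next
    case 2
    then show ?thesis using x by (simp add: hat_def hatp_def cell_width_def diff_divide_distrib)
  next
    case 3
    then have "gl_node p (Suc i) \<le> gl_node p a" "gl_node p i \<le> gl_node p a" using le a by auto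
    then show ?thesis using 3 x by (simp add: hat_def hatp_def)
  next
    case 4
    then have "gl_node p (Suc a) \<le> gl_node p (i - 1)" "gl_node p (Suc a) \<le> gl_node p i" using le i by auto
    then show ?thesis using 4 x by (simp add: hat_def hatp_def)
  qed
qed

definition quad :: "nat \<Rightarrow> (nat \<Rightarrow> nat \<Rightarrow> real) \<Rightarrow> (nat \<Rightarrow> real) \<Rightarrow> real" where
  "quad p A c = (\<Sum>i\<le>p. \<Sum>k\<le>p. c i * c k * A i k)"

text \<open>The spectral matrices have one cell, the piecewise linear ones p cells. This form
  supplies the semidefiniteness needed for Kronecker products.\<close>

definition gram :: "nat \<Rightarrow> (nat \<Rightarrow> real) \<Rightarrow> (nat \<Rightarrow> real) \<Rightarrow> (nat \<Rightarrow> nat \<Rightarrow> real poly) \<Rightarrow> nat \<Rightarrow> nat \<Rightarrow> real" where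
  "gram B \<alpha> \<beta> f i k = (\<Sum>a<B. poly_integral (\<alpha> a) (\<beta> a) (f a i * f a k))"

lemma qf_gram: "quad p (gram B \<alpha> \<beta> f) c = (\<Sum>a<B. poly_integral (\<alpha> a) (\<beta> a) ((\<Sum>i\<le>p. smult (c i) (f a i))\<^sup>2))"
proof -
  have "poly_integral (\<alpha> a) (\<beta> a) ((\<Sum>i\<le>p. smult (c i) (f a i))\<^sup>2)
    = (\<Sum>i\<le>p. \<Sum>k\<le>p. c i * c k * poly_integral (\<alpha> a) (\<beta> a) (f a i * f a k))" for a
    by (simp add: power2_eq_square sum_product poly_integral_sum poly_integral_smult mult_ac)
  then have "(\<Sum>a<B. poly_integral (\<alpha> a) (\<beta> a) ((\<Sum>i\<le>p. smult (c i) (f a i))\<^sup>2))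
    = (\<Sum>a<B. \<Sum>i\<le>p. \<Sum>k\<le>p. c i * c k * poly_integral (\<alpha> a) (\<beta> a) (f a i * f a k))"
    by simp
  also have "\<dots> = (\<Sum>i\<le>p. \<Sum>k\<le>p. \<Sum>a<B. c i * c k * poly_integral (\<alpha> a) (\<beta> a) (f a i * f a k))"
    by (subst sum.swap) (intro sum.cong refl sum.swap)
  finally show ?thesis by (simp add: quad_def gram_def sum_distrib_left)
qed

definition tensor :: "nat \<Rightarrow> (nat \<Rightarrow> nat \<Rightarrow> real) \<Rightarrow> (nat \<Rightarrow> nat \<Rightarrow> real) \<Rightarrow> (nat \<Rightarrow> nat \<Rightarrow> real) \<Rightarrow> real" where
  "tensor p A B v = (\<Sum>i\<le>p. \<Sum>j\<le>p. \<Sum>k\<le>p. \<Sum>l\<le>p. v i j * v k l * (A i k * B j l))"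

lemma tensor_swap: "tensor p A B v = tensor p B A (\<lambda>i j. v j i)"
proof -
  have "tensor p A B v = (\<Sum>j\<le>p. \<Sum>i\<le>p. \<Sum>k\<le>p. \<Sum>l\<le>p. v i j * v k l * (A i k * B j l))"
    unfolding tensor_def by (rule sum.swap)
  also have "\<dots> = (\<Sum>j\<le>p. \<Sum>i\<le>p. \<Sum>l\<le>p. \<Sum>k\<le>p. v i j * v k l * (A i k * B j l))"
    by (intro sum.cong refl sum.swap)
  finally show ?thesis by (simp add: tensor_def mult_ac)
qed

lemma tensor_gram:
  "tensor p (gram N \<alpha> \<beta> f) B v = (\<Sum>a<N. poly_integral (\<alpha> a) (\<beta> a)
     (\<Sum>j\<le>p. \<Sum>l\<le>p. smult (B j l) ((\<Sum>i\<le>p. smult (v i j) (f a i)) * (\<Sum>k\<le>p. smult (v k l) (f a k)))))"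
proof -
  have "poly_integral (\<alpha> a) (\<beta> a)
     (\<Sum>j\<le>p. \<Sum>l\<le>p. smult (B j l) ((\<Sum>i\<le>p. smult (v i j) (f a i)) * (\<Sum>k\<le>p. smult (v k l) (f a k))))
    = (\<Sum>j\<le>p. \<Sum>l\<le>p. \<Sum>i\<le>p. \<Sum>k\<le>p. v i j * v k l * (poly_integral (\<alpha> a) (\<beta> a) (f a i * f a k) * B j l))" for a
    by (simp add: poly_integral_sum poly_integral_smult sum_product sum_distrib_left mult_ac)
      (rule sum.cong[OF refl], rule sum.cong[OF refl], subst sum.swap, simp add: mult_ac)
  then have "(\<Sum>a<N. poly_integral (\<alpha> a) (\<beta> a)
     (\<Sum>j\<le>p. \<Sum>l\<le>p. smult (B j l) ((\<Sum>i\<le>p. smult (v i j) (f a i)) * (\<Sum>k\<le>p. smult (v k l) (f a k)))))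
    = (\<Sum>a<N. \<Sum>j\<le>p. \<Sum>l\<le>p. \<Sum>i\<le>p. \<Sum>k\<le>p. v i j * v k l * (poly_integral (\<alpha> a) (\<beta> a) (f a i * f a k) * B j l))"
    by simp
  also have "\<dots> = (\<Sum>j\<le>p. \<Sum>l\<le>p. \<Sum>i\<le>p. \<Sum>k\<le>p. \<Sum>a<N. v i j * v k l * (poly_integral (\<alpha> a) (\<beta> a) (f a i * f a k) * B j l))"
  proof -
    have s: "(\<Sum>a<N. \<Sum>k\<le>p. g a k) = (\<Sum>k\<le>p. \<Sum>a<N. g a k)" for g :: "nat \<Rightarrow> nat \<Rightarrow> real"
      by (rule sum.swap)
    show ?thesis unfolding s ..
  qed
  also have "\<dots> = (\<Sum>j\<le>p. \<Sum>l\<le>p. \<Sum>i\<le>p. \<Sum>k\<le>p. v i j * v k l * (gram N \<alpha> \<beta> f i k * B j l))"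
    by (simp add: gram_def sum_distrib_left sum_distrib_right)
  also have "\<dots> = (\<Sum>j\<le>p. \<Sum>i\<le>p. \<Sum>l\<le>p. \<Sum>k\<le>p. v i j * v k l * (gram N \<alpha> \<beta> f i k * B j l))"
    by (intro sum.cong refl sum.swap)
  also have "\<dots> = (\<Sum>j\<le>p. \<Sum>i\<le>p. \<Sum>k\<le>p. \<Sum>l\<le>p. v i j * v k l * (gram N \<alpha> \<beta> f i k * B j l))"
    by (intro sum.cong refl sum.swap)
  also have "\<dots> = tensor p (gram N \<alpha> \<beta> f) B v"
    unfolding tensor_def by (rule sum.swap)
  finally show ?thesis by simp
qed

lemma tensor_mono_right:
  assumes "\<And>c. quad p B c \<le> b * quad p B' c"
  shows "tensor p (gram N \<alpha> \<beta> f) B v \<le> b * tensor p (gram N \<alpha> \<beta> f) B' v"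
proof -
  define P where "P C a = (\<Sum>j\<le>p. \<Sum>l\<le>p. smult (C j l)
    ((\<Sum>i\<le>p. smult (v i j) (f a i)) * (\<Sum>k\<le>p. smult (v k l) (f a k))))" for C a
  have "tensor p (gram N \<alpha> \<beta> f) C v = (\<Sum>a<N. poly_integral (\<alpha> a) (\<beta> a) (P C a))" for C
    unfolding P_def by (rule tensor_gram)
  moreover have "poly_integral (\<alpha> a) (\<beta> a) (P B a) \<le> b * poly_integral (\<alpha> a) (\<beta> a) (P B' a)" for a
    unfolding poly_integral_smult[symmetric]
  proof (rule poly_integral_mono)
    fix x
    define g where "g j = poly (\<Sum>i\<le>p. smult (v i j) (f a i)) x" for j
    have "poly (P C a) x = quad p C g" for C
      by (simp only: P_def poly_sum poly_smult poly_mult quad_def g_def mult_ac)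
    then show "poly (P B a) x \<le> poly (smult b (P B' a)) x"
      using assms[of g] by simp
  qed
  ultimately show ?thesis by (simp add: sum_distrib_left sum_mono)
qed

text \<open>One factor is exchanged at a time, and the factor that stays is a Gram matrix in both
  steps.\<close>

lemma tensor_mono:
  assumes "\<And>c. quad p (gram N \<alpha> \<beta> f) c \<le> a * quad p A' c"
    and "\<And>c. quad p B c \<le> b * quad p (gram N' \<alpha>' \<beta>' f') c" and b: "0 \<le> b"
  shows "tensor p (gram N \<alpha> \<beta> f) B v \<le> a * b * tensor p A' (gram N' \<alpha>' \<beta>' f') v"
proof -
  have "tensor p (gram N \<alpha> \<beta> f) B v \<le> b * tensor p (gram N \<alpha> \<beta> f) (gram N' \<alpha>' \<beta>' f') v"
    by (rule tensor_mono_right) (rule assms(2))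
  also have "\<dots> = b * tensor p (gram N' \<alpha>' \<beta>' f') (gram N \<alpha> \<beta> f) (\<lambda>i j. v j i)"
    by (subst tensor_swap) simp
  also have "\<dots> \<le> b * (a * tensor p (gram N' \<alpha>' \<beta>' f') A' (\<lambda>i j. v j i))"
    by (intro mult_left_mono tensor_mono_right assms(1) b)
  also have "\<dots> = a * b * tensor p A' (gram N' \<alpha>' \<beta>' f') v"
    by (subst tensor_swap) simp
  finally show ?thesis .
qed

text \<open>The constant of \<open>interp_stable_poly\<close>; it also exceeds the 6
  \<open>Cgap\<close> of the mass comparison, so all four comparisons can share it.\<close>

definition Cref :: real where
  "Cref = 8 * Cgap\<^sup>2 + 2"

definition stiff_gl :: "nat \<Rightarrow> nat \<Rightarrow> nat \<Rightarrow> real" where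
  "stiff_gl p = gram 1 (\<lambda>_. 0) (\<lambda>_. 1) (\<lambda>_ i. pderiv (lagp p i))"
definition mass_gl :: "nat \<Rightarrow> nat \<Rightarrow> nat \<Rightarrow> real" where
  "mass_gl p = gram 1 (\<lambda>_. 0) (\<lambda>_. 1) (\<lambda>_ i. lagp p i)"
definition stiff_pl :: "nat \<Rightarrow> nat \<Rightarrow> nat \<Rightarrow> real" where
  "stiff_pl p = gram p (gl_node p) (\<lambda>a. gl_node p (Suc a)) (\<lambda>a i. pderiv (hatp p a i))"
definition mass_pl :: "nat \<Rightarrow> nat \<Rightarrow> nat \<Rightarrow> real" where
  "mass_pl p = gram p (gl_node p) (\<lambda>a. gl_node p (Suc a)) (hatp p)"

context
  fixes p :: nat assumes p: "1 \<le> p"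
begin

lemma qf_stiff_gl: "quad p (stiff_gl p) c = poly_integral 0 1 ((pderiv (gl_interp p c))\<^sup>2)"
  by (simp add: stiff_gl_def qf_gram gl_interp_def pderiv_sum pderiv_smult)

lemma qf_mass_gl: "quad p (mass_gl p) c = poly_integral 0 1 ((gl_interp p c)\<^sup>2)"
  by (simp add: mass_gl_def qf_gram gl_interp_def)

lemma hatp_sum:
  assumes a: "a < p"
  shows "(\<Sum>i\<le>p. smult (c i) (hatp p a i)) = [:c a:] + smult ((c (Suc a) - c a) / cell_width p a) [:- gl_node p a, 1:]"
proof -
  have "(\<Sum>i\<le>p. smult (c i) (hatp p a i)) = (\<Sum>i\<in>{a, Suc a}. smult (c i) (hatp p a i))"
    using a by (intro sum.mono_neutral_right) (auto simp: hatp_def)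
  also have "\<dots> = [:c a:] + smult ((c (Suc a) - c a) / cell_width p a) [:- gl_node p a, 1:]"
  proof (rule poly_ext)
    fix x
    have h: "cell_width p a \<noteq> 0" "gl_node p (Suc a) = gl_node p a + cell_width p a"
      using cell_pos[OF p a] by (auto simp: cell_width_def)
    show "poly (\<Sum>i\<in>{a, Suc a}. smult (c i) (hatp p a i)) x
      = poly ([:c a:] + smult ((c (Suc a) - c a) / cell_width p a) [:- gl_node p a, 1:]) x"
      using h(1) by (simp add: hatp_def h(2) field_simps)
  qed
  finally show ?thesis .
qed

lemma qf_stiff_pl: "quad p (stiff_pl p) c = (\<Sum>a<p. (c (Suc a) - c a)\<^sup>2 / cell_width p a)"
  unfolding stiff_pl_def qf_gram
proof (rule sum.cong)
  fix a assume "a \<in> {..<p}"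
  then have a: "a < p" by simp
  define s where "s = (c (Suc a) - c a) / cell_width p a"
  have "(\<Sum>i\<le>p. smult (c i) (pderiv (hatp p a i))) = pderiv (\<Sum>i\<le>p. smult (c i) (hatp p a i))"
    by (simp add: pderiv_sum pderiv_smult)
  also have "\<dots> = [:s:]"
    unfolding hatp_sum[OF a] s_def by (simp add: pderiv_add pderiv_smult pderiv_pCons)
  finally have "(\<Sum>i\<le>p. smult (c i) (pderiv (hatp p a i)))\<^sup>2 = [:s\<^sup>2:]"
    by (simp add: power2_eq_square)
  moreover have "gl_node p a \<le> gl_node p (Suc a)" using cell_pos[OF p a] by (simp add: cell_width_def)
  ultimately have "poly_integral (gl_node p a) (gl_node p (Suc a)) ((\<Sum>i\<le>p. smult (c i) (pderiv (hatp p a i)))\<^sup>2)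
    = s\<^sup>2 * cell_width p a" by (simp add: poly_integral_const cell_width_def)
  then show "poly_integral (gl_node p a) (gl_node p (Suc a)) ((\<Sum>i\<le>p. smult (c i) (pderiv (hatp p a i)))\<^sup>2)
    = (c (Suc a) - c a)\<^sup>2 / cell_width p a"
    using cell_pos[OF p a] by (simp add: s_def power2_eq_square)
qed simp

lemma qf_mass_pl: "quad p (mass_pl p) c = (\<Sum>a<p. cell_width p a * ((c a)\<^sup>2 + c a * c (Suc a) + (c (Suc a))\<^sup>2) / 3)"
  unfolding mass_pl_def qf_gram
proof (rule sum.cong)
  fix a assume "a \<in> {..<p}"
  then have a: "a < p" by simp
  define h where "h = cell_width p a"
  have h: "h > 0" "gl_node p (Suc a) = gl_node p a + h" using cell_pos[OF p a] by (auto simp: h_def cell_width_def)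
  define s where "s = (c (Suc a) - c a) / h"
  have cs: "c (Suc a) = c a + s * h" using h by (simp add: s_def)
  define X where "X = [:- gl_node p a, 1:]"
  define F where "F = smult ((c a)\<^sup>2) X + smult (c a * s) (X ^ 2) + smult (s\<^sup>2 / 3) (X ^ 3)"
  have X': "pderiv X = 1" by (simp add: X_def pderiv_pCons one_pCons)
  have "pderiv F = ([:c a:] + smult s X)\<^sup>2"
  proof (rule poly_ext)
    fix x
    show "poly (pderiv F) x = poly (([:c a:] + smult s X)\<^sup>2) x"
      unfolding F_def pderiv_add pderiv_smult pderiv_power X'
      by (simp add: power2_eq_square algebra_simps)
  qed
  then have "poly_integral (gl_node p a) (gl_node p (Suc a)) ((\<Sum>i\<le>p. smult (c i) (hatp p a i))\<^sup>2)
    = poly F (gl_node p (Suc a)) - poly F (gl_node p a)"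
    unfolding hatp_sum[OF a] using h by (subst poly_integral_pderiv[symmetric]) (simp_all add: X_def s_def h_def)
  also have "\<dots> = (c a)\<^sup>2 * h + c a * s * h\<^sup>2 + s\<^sup>2 / 3 * h ^ 3"
    by (simp add: F_def X_def h(2) algebra_simps)
  also have "\<dots> = h * ((c a)\<^sup>2 + c a * c (Suc a) + (c (Suc a))\<^sup>2) / 3"
    unfolding cs by (simp add: power2_eq_square power3_eq_cube field_simps)
  finally show "poly_integral (gl_node p a) (gl_node p (Suc a)) ((\<Sum>i\<le>p. smult (c i) (hatp p a i))\<^sup>2)
    = cell_width p a * ((c a)\<^sup>2 + c a * c (Suc a) + (c (Suc a))\<^sup>2) / 3" by (simp add: h_def)
qed simp

lemma Cref_ge: "1 \<le> Cref" "6 * Cgap \<le> Cref"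
proof -
  have "Cgap * 1 \<le> Cgap * Cgap" using Cgap_ge by (intro mult_left_mono) auto
  then show "1 \<le> Cref" "6 * Cgap \<le> Cref"
    unfolding Cref_def power2_eq_square using Cgap_ge(1) by linarith+
qed

lemma stiff_pl_le_stiff_gl: "quad p (stiff_pl p) c \<le> Cref * quad p (stiff_gl p) c"
proof -
  have "quad p (stiff_pl p) c \<le> 1 * quad p (stiff_gl p) c"
    using interp_stiffness_lower[OF p] by (simp add: qf_stiff_pl qf_stiff_gl)
  also have "\<dots> \<le> Cref * quad p (stiff_gl p) c"
    using Cref_ge by (intro mult_right_mono) (auto simp: qf_stiff_gl poly_integral_square_nonneg)
  finally show ?thesis .
qed

lemma stiff_gl_le_stiff_pl: "quad p (stiff_gl p) c \<le> Cref * quad p (stiff_pl p) c"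
  using interp_stiffness_upper[OF p] by (simp add: qf_stiff_pl qf_stiff_gl Cref_def)

text \<open>The exact piecewise linear mass against the trapezoidal sum, by |x y| <= (x^2 + y^2) / 2
  on each cell.\<close>

lemma mass_bounds:
  "(\<Sum>a<p. cell_width p a * ((c a)\<^sup>2 + (c (Suc a))\<^sup>2)) \<le> 6 * quad p (mass_pl p) c"
  "quad p (mass_pl p) c \<le> (\<Sum>a<p. cell_width p a * ((c a)\<^sup>2 + (c (Suc a))\<^sup>2))"
proof -
  have b: "\<bar>x * y\<bar> \<le> (x\<^sup>2 + y\<^sup>2) / 2" for x y :: real
    using sum_squares_bound[of "\<bar>x\<bar>" "\<bar>y\<bar>"] by (simp add: abs_mult)
  show "(\<Sum>a<p. cell_width p a * ((c a)\<^sup>2 + (c (Suc a))\<^sup>2)) \<le> 6 * quad p (mass_pl p) c"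
    unfolding qf_mass_pl sum_distrib_left
  proof (rule sum_mono)
    fix a assume "a \<in> {..<p}"
    then have "0 < cell_width p a" using cell_pos[OF p] by simp
    then have "cell_width p a * ((c a)\<^sup>2 + (c (Suc a))\<^sup>2) \<le> cell_width p a * (2 * ((c a)\<^sup>2 + c a * c (Suc a) + (c (Suc a))\<^sup>2))"
      using b[of "c a" "c (Suc a)"] by (intro mult_left_mono) (auto simp: abs_le_iff)
    then show "cell_width p a * ((c a)\<^sup>2 + (c (Suc a))\<^sup>2) \<le> 6 * (cell_width p a * ((c a)\<^sup>2 + c a * c (Suc a) + (c (Suc a))\<^sup>2) / 3)"
      by (simp add: algebra_simps)
  qed
  show "quad p (mass_pl p) c \<le> (\<Sum>a<p. cell_width p a * ((c a)\<^sup>2 + (c (Suc a))\<^sup>2))"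
    unfolding qf_mass_pl
  proof (rule sum_mono)
    fix a assume "a \<in> {..<p}"
    then have "0 < cell_width p a" using cell_pos[OF p] by simp
    then have "cell_width p a * ((c a)\<^sup>2 + c a * c (Suc a) + (c (Suc a))\<^sup>2) \<le> cell_width p a * (3 * ((c a)\<^sup>2 + (c (Suc a))\<^sup>2))"
      using b[of "c a" "c (Suc a)"] zero_le_power2[of "c a"] zero_le_power2[of "c (Suc a)"]
      by (intro mult_left_mono) (auto simp: abs_le_iff)
    then show "cell_width p a * ((c a)\<^sup>2 + c a * c (Suc a) + (c (Suc a))\<^sup>2) / 3 \<le> cell_width p a * ((c a)\<^sup>2 + (c (Suc a))\<^sup>2)"
      by (simp add: algebra_simps)
  qed
qed

lemma mass_pl_nonneg: "0 \<le> quad p (mass_pl p) c"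
  unfolding mass_pl_def qf_gram by (intro sum_nonneg poly_integral_square_nonneg)

lemma mass_gl_le_mass_pl: "quad p (mass_gl p) c \<le> Cref * quad p (mass_pl p) c"
proof -
  have "quad p (mass_gl p) c \<le> Cgap * (\<Sum>a<p. cell_width p a * ((c a)\<^sup>2 + (c (Suc a))\<^sup>2))"
    using interp_mass_equivalence(1)[OF p] by (simp add: qf_mass_gl)
  also have "\<dots> \<le> Cgap * (6 * quad p (mass_pl p) c)"
    using mass_bounds(1) Cgap_ge by (intro mult_left_mono) auto
  also have "\<dots> = (6 * Cgap) * quad p (mass_pl p) c" by simp
  also have "\<dots> \<le> Cref * quad p (mass_pl p) c"
    using Cref_ge mass_pl_nonneg by (intro mult_right_mono) auto
  finally show ?thesis .
qed

lemma mass_pl_le_mass_gl: "quad p (mass_pl p) c \<le> Cref * quad p (mass_gl p) c"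
proof -
  have "quad p (mass_pl p) c \<le> 6 * Cgap * quad p (mass_gl p) c"
    using mass_bounds(2) interp_mass_equivalence(2)[OF p] by (simp add: qf_mass_gl) (meson order_trans)
  also have "\<dots> \<le> Cref * quad p (mass_gl p) c"
    using Cref_ge by (intro mult_right_mono) (auto simp: qf_mass_gl poly_integral_square_nonneg)
  finally show ?thesis .
qed

theorem reference_equivalence:
  "tensor p (stiff_gl p) (mass_gl p) v + tensor p (mass_gl p) (stiff_gl p) v
     \<le> Cref\<^sup>2 * (tensor p (stiff_pl p) (mass_pl p) v + tensor p (mass_pl p) (stiff_pl p) v)"
  "tensor p (stiff_pl p) (mass_pl p) v + tensor p (mass_pl p) (stiff_pl p) v
     \<le> Cref\<^sup>2 * (tensor p (stiff_gl p) (mass_gl p) v + tensor p (mass_gl p) (stiff_gl p) v)"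
proof -
  have C: "0 \<le> Cref" using Cref_ge by simp
  have "tensor p (stiff_gl p) (mass_gl p) v \<le> Cref * Cref * tensor p (stiff_pl p) (mass_pl p) v"
    "tensor p (mass_gl p) (stiff_gl p) v \<le> Cref * Cref * tensor p (mass_pl p) (stiff_pl p) v"
    "tensor p (stiff_pl p) (mass_pl p) v \<le> Cref * Cref * tensor p (stiff_gl p) (mass_gl p) v"
    "tensor p (mass_pl p) (stiff_pl p) v \<le> Cref * Cref * tensor p (mass_gl p) (stiff_gl p) v"
    using stiff_gl_le_stiff_pl stiff_pl_le_stiff_gl mass_gl_le_mass_pl mass_pl_le_mass_gl C
    unfolding stiff_gl_def stiff_pl_def mass_gl_def mass_pl_def by (intro tensor_mono; simp)+
  then show "tensor p (stiff_gl p) (mass_gl p) v + tensor p (mass_gl p) (stiff_gl p) v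
     \<le> Cref\<^sup>2 * (tensor p (stiff_pl p) (mass_pl p) v + tensor p (mass_pl p) (stiff_pl p) v)"
    "tensor p (stiff_pl p) (mass_pl p) v + tensor p (mass_pl p) (stiff_pl p) v
     \<le> Cref\<^sup>2 * (tensor p (stiff_gl p) (mass_gl p) v + tensor p (mass_gl p) (stiff_gl p) v)"
    by (simp_all add: power2_eq_square distrib_left)
qed

end

section \<open>Mapped elements\<close>

lemma Basis_2: "(Basis :: (real ^ 2) set) = {axis 1 1, axis 2 1}"
  by (auto simp: Basis_vec_def) (metis exhaust_2)

text \<open>\<open>lborel_eq\<close> presents the measure on the plane as the image of a product
  over \<open>Basis\<close>, where integrals of products factor.\<close>

lemma lborel_integral_prod2:
  fixes f g :: "real \<Rightarrow> real"
  assumes f: "integrable lborel f" and g: "integrable lborel g"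
  shows "(LINT x|lborel. f ((x :: real ^ 2) $ 1) * g (x $ 2)) = (LINT x|lborel. f x) * (LINT x|lborel. g x)"
    and "integrable lborel (\<lambda>x :: real ^ 2. f (x $ 1) * g (x $ 2))"
proof -
  interpret product_sigma_finite "\<lambda>_ :: real ^ 2. lborel :: real measure"
    by (simp add: product_sigma_finite_def sigma_finite_lborel)
  have [measurable]: "f \<in> borel_measurable borel" "g \<in> borel_measurable borel"
    using borel_measurable_integrable[OF f] borel_measurable_integrable[OF g] by simp_all
  have ne: "axis 1 1 \<noteq> (axis 2 1 :: real ^ 2)" by (simp add: axis_eq_axis)
  define h where "h b = (if b = axis 1 (1 :: real) then f else g)" for b :: "real ^ 2"
  define F where "F x = f ((x :: real ^ 2) $ 1) * g (x $ 2)" for x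
  define e where "e w = (\<Sum>b\<in>Basis. w b *\<^sub>R b)" for w :: "real ^ 2 \<Rightarrow> real"
  have [measurable]: "F \<in> borel_measurable borel" unfolding F_def by measurable
  have me: "e \<in> measurable (\<Pi>\<^sub>M b\<in>Basis. lborel) borel" unfolding e_def by measurable
  have eq: "F (e w) = (\<Prod>b\<in>Basis. h b (w b))" for w
    using ne by (simp add: F_def e_def h_def Basis_2 axis_def)
  have lb: "(lborel :: (real ^ 2) measure) = distr (\<Pi>\<^sub>M b\<in>Basis. lborel) borel e"
    unfolding e_def by (rule lborel_eq)
  have hi: "integrable lborel (h b)" for b using f g by (simp add: h_def)
  have "(LINT x|lborel. F x) = (LINT w|(\<Pi>\<^sub>M b\<in>Basis. lborel). F (e w))"
    unfolding lb by (rule integral_distr[OF me]) measurable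
  also have "\<dots> = (\<Prod>b\<in>Basis. LINT x|lborel. h b x)"
    unfolding eq by (rule product_integral_prod) (simp_all add: hi)
  also have "\<dots> = (LINT x|lborel. f x) * (LINT x|lborel. g x)"
    using ne by (simp add: h_def Basis_2)
  finally show "(LINT x|lborel. f ((x :: real ^ 2) $ 1) * g (x $ 2)) = (LINT x|lborel. f x) * (LINT x|lborel. g x)"
    by (simp add: F_def)
  have "integrable (\<Pi>\<^sub>M b\<in>Basis. lborel) (\<lambda>w. F (e w))"
    unfolding eq by (rule product_integrable_prod) (simp_all add: hi)
  then have "integrable (distr (\<Pi>\<^sub>M b\<in>Basis. lborel) borel e) F"
    by (subst integrable_distr_eq[OF me]) measurable
  then show "integrable lborel (\<lambda>x :: real ^ 2. f (x $ 1) * g (x $ 2))"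
    unfolding lb[symmetric] F_def[abs_def] .
qed

definition obox :: "real \<Rightarrow> real \<Rightarrow> real \<Rightarrow> real \<Rightarrow> point set" where
  "obox a b c d = {y. a < y $ 1 \<and> y $ 1 < b \<and> c < y $ 2 \<and> y $ 2 < d}"

lemma open_obox: "open (obox a b c d)"
  unfolding obox_def by (intro open_Collect_conj open_Collect_less continuous_intros)

lemma poly_interval_integral:
  "integrable lborel (\<lambda>x. indicator {a<..<b} x * poly f x)"
  "(LINT x|lborel. indicator {a<..<b} x * poly f x) = poly_integral a b f"
proof -
  have "set_integrable lborel {a..b} (poly f)"
    unfolding set_integrable_def by (rule borel_integrable_compact) (auto intro!: continuous_intros)
  then have i: "set_integrable lborel {a<..<b} (poly f)"
    by (rule set_integrable_subset) auto
  then show "integrable lborel (\<lambda>x. indicator {a<..<b} x * poly f x)"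
    by (simp add: set_integrable_def)
  have "(LINT x:{a<..<b}|lborel. poly f x) = poly_integral a b f"
    using set_borel_integral_eq_integral(2)[OF i] by (simp add: poly_integral_def integral_open_interval_real)
  then show "(LINT x|lborel. indicator {a<..<b} x * poly f x) = poly_integral a b f"
    by (simp add: set_lebesgue_integral_def)
qed

lemma obox_integral:
  "set_integrable lebesgue (obox a b c d) (\<lambda>y. poly f (y $ 1) * poly g (y $ 2))"
  "(LINT y:obox a b c d|lebesgue. poly f (y $ 1) * poly g (y $ 2)) = poly_integral a b f * poly_integral c d g"
proof -
  have eq: "(\<lambda>y. indicator (obox a b c d) y *\<^sub>R (poly f (y $ 1) * poly g (y $ 2)))
    = (\<lambda>y. (indicator {a<..<b} (y $ 1) * poly f (y $ 1)) * (indicator {c<..<d} (y $ 2) * poly g (y $ 2)))"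
    by (auto simp: fun_eq_iff obox_def indicator_def)
  note i = lborel_integral_prod2[OF poly_interval_integral(1)[of a b f] poly_interval_integral(1)[of c d g]]
  show "set_integrable lebesgue (obox a b c d) (\<lambda>y. poly f (y $ 1) * poly g (y $ 2))"
    unfolding set_integrable_def eq by (rule integrable_completion[THEN iffD2]) (use i(2) in auto)
  show "(LINT y:obox a b c d|lebesgue. poly f (y $ 1) * poly g (y $ 2)) = poly_integral a b f * poly_integral c d g"
    unfolding set_lebesgue_integral_def eq
    using i borel_measurable_integrable[OF i(2)]
    by (subst integral_completion) (simp_all add: poly_interval_integral)
qed

text \<open>
  The gradients of functions transported by a map with Jacobian matrix \<open>M\<close> are \<open>1 / det M\<close> times the
  cofactor matrix applied to the reference gradients; \<open>cofin\<close> is the inner product without the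
  determinants.
\<close>

definition cofin :: "real ^ 2 ^ 2 \<Rightarrow> real \<Rightarrow> real \<Rightarrow> real \<Rightarrow> real \<Rightarrow> real" where
  "cofin M u1 u2 w1 w2 = (M $ 2 $ 2 * u1 - M $ 2 $ 1 * u2) * (M $ 2 $ 2 * w1 - M $ 2 $ 1 * w2)
     + (M $ 1 $ 1 * u2 - M $ 1 $ 2 * u1) * (M $ 1 $ 1 * w2 - M $ 1 $ 2 * w1)"

lemma norm_vec2_square: "(norm (v :: real ^ 2))\<^sup>2 = (v $ 1)\<^sup>2 + (v $ 2)\<^sup>2"
  unfolding power2_norm_eq_inner inner_vec_def sum_2 by (simp add: power2_eq_square)

lemma matrix_vector_2: "((M :: real ^ 2 ^ 2) *v v) $ i = M $ i $ 1 * v $ 1 + M $ i $ 2 * v $ 2"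
  by (simp add: matrix_vector_mult_def sum_2)

text \<open>In two dimensions the cofactor matrix is M up to rotations by a right angle, so bounds
  for M pass to \<open>cofin\<close> with the same constants. The determinant is bounded through the
  entries p, q, r of the Gram matrix of the columns.\<close>

lemma cofin_bounds:
  fixes M :: "real ^ 2 ^ 2"
  assumes hs: "0 < h" "0 < s"
    and up: "\<And>v. norm (M *v v) \<le> s * h * norm v" and lo: "\<And>v. h * norm v \<le> s * norm (M *v v)"
  shows "(h / s)\<^sup>2 \<le> \<bar>det M\<bar>" "\<bar>det M\<bar> \<le> (s * h)\<^sup>2"
    "(h / s)\<^sup>2 * (w1\<^sup>2 + w2\<^sup>2) \<le> cofin M w1 w2 w1 w2"
    "cofin M w1 w2 w1 w2 \<le> (s * h)\<^sup>2 * (w1\<^sup>2 + w2\<^sup>2)"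
proof -
  define a b c d where "a = M $ 1 $ 1" and "b = M $ 1 $ 2" and "c = M $ 2 $ 1" and "d = M $ 2 $ 2"
  have coord: "(h / s)\<^sup>2 * (x\<^sup>2 + y\<^sup>2) \<le> (a * x + b * y)\<^sup>2 + (c * x + d * y)\<^sup>2 \<and>
    (a * x + b * y)\<^sup>2 + (c * x + d * y)\<^sup>2 \<le> (s * h)\<^sup>2 * (x\<^sup>2 + y\<^sup>2)" for x y
  proof -
    define v where "v = (vector [x, y] :: real ^ 2)"
    have nv: "(norm v)\<^sup>2 = x\<^sup>2 + y\<^sup>2" by (simp add: norm_vec2_square v_def)
    have nM: "(norm (M *v v))\<^sup>2 = (a * x + b * y)\<^sup>2 + (c * x + d * y)\<^sup>2"
      by (simp add: norm_vec2_square matrix_vector_2 v_def a_def b_def c_def d_def)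
    have "(norm (M *v v))\<^sup>2 \<le> (s * h * norm v)\<^sup>2" using up by (intro power_mono) auto
    moreover have "(h * norm v)\<^sup>2 \<le> (s * norm (M *v v))\<^sup>2" using lo hs by (intro power_mono) auto
    ultimately show ?thesis
      using hs by (simp add: power_mult_distrib nv nM power_divide field_simps)
  qed
  define p q r where "p = a\<^sup>2 + c\<^sup>2" and "q = b\<^sup>2 + d\<^sup>2" and "r = a * b + c * d"
  have det: "det M = a * d - b * c" by (simp add: det_2 a_def b_def c_def d_def)
  have dsq: "(det M)\<^sup>2 = p * q - r\<^sup>2"
    by (simp add: det p_def q_def r_def power2_eq_square algebra_simps)
  have p: "(h / s)\<^sup>2 \<le> p" "p \<le> (s * h)\<^sup>2" using coord[of 1 0] by (simp_all add: p_def)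
  have q: "0 \<le> q" "q \<le> (s * h)\<^sup>2" using coord[of 0 1] by (simp_all add: q_def)
  have k: "0 < (h / s)\<^sup>2" using hs by simp
  have "(det M)\<^sup>2 \<le> p * q" by (simp add: dsq)
  also have "\<dots> \<le> (s * h)\<^sup>2 * (s * h)\<^sup>2" using p q by (intro mult_mono) auto
  finally have "\<bar>det M\<bar>\<^sup>2 \<le> ((s * h)\<^sup>2)\<^sup>2" by (simp add: power2_eq_square)
  then show "\<bar>det M\<bar> \<le> (s * h)\<^sup>2" by (rule power2_le_imp_le) simp
  \<comment> \<open>The test vector (-r, p) removes from the second column its component along the
    first; what remains has squared length p (det M)^2.\<close>
  have "(h / s)\<^sup>2 * (r\<^sup>2 + p\<^sup>2) \<le> (a * - r + b * p)\<^sup>2 + (c * - r + d * p)\<^sup>2"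
    using coord[of "- r" p] by simp
  also have "\<dots> = p * (p * q) - p * r\<^sup>2"
    unfolding p_def q_def r_def by algebra
  also have "\<dots> = p * (det M)\<^sup>2" by (simp add: dsq algebra_simps)
  finally have "(h / s)\<^sup>2 * (r\<^sup>2 + p\<^sup>2) \<le> p * (det M)\<^sup>2" .
  moreover have "(h / s)\<^sup>2 * p\<^sup>2 \<le> (h / s)\<^sup>2 * (r\<^sup>2 + p\<^sup>2)" by (intro mult_left_mono) auto
  ultimately have "p * ((h / s)\<^sup>2 * p) \<le> p * (det M)\<^sup>2" by (simp add: power2_eq_square mult_ac)
  then have "(h / s)\<^sup>2 * p \<le> (det M)\<^sup>2" using k p by simp
  moreover have "(h / s)\<^sup>2 * (h / s)\<^sup>2 \<le> (h / s)\<^sup>2 * p" using p by (intro mult_left_mono) auto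
  ultimately have "((h / s)\<^sup>2)\<^sup>2 \<le> \<bar>det M\<bar>\<^sup>2" by (simp add: power2_eq_square)
  then show "(h / s)\<^sup>2 \<le> \<bar>det M\<bar>" by (rule power2_le_imp_le) simp
  \<comment> \<open>The squared norm of M applied to (w2, -w1).\<close>
  have "cofin M w1 w2 w1 w2 = (a * w2 + b * - w1)\<^sup>2 + (c * w2 + d * - w1)\<^sup>2"
    by (simp add: cofin_def a_def b_def c_def d_def power2_eq_square algebra_simps)
  then show "(h / s)\<^sup>2 * (w1\<^sup>2 + w2\<^sup>2) \<le> cofin M w1 w2 w1 w2"
    "cofin M w1 w2 w1 w2 \<le> (s * h)\<^sup>2 * (w1\<^sup>2 + w2\<^sup>2)"
    using coord[of w2 "- w1"] by (simp_all add: add.commute)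
qed

lemma ref_square_eq: "ref_square = cbox 0 1"
  by (auto simp: ref_square_def cbox_def Basis_vec_def inner_axis)

lemma lebesgue_change_of_variables:
  fixes F :: "point \<Rightarrow> point" and f :: "point \<Rightarrow> real"
  assumes U: "U \<in> sets lebesgue"
    and der: "\<And>y. y \<in> U \<Longrightarrow> (F has_derivative (\<lambda>v. D y *v v)) (at y within U)"
    and inj: "inj_on F U"
    and int: "set_integrable lebesgue U (\<lambda>y. \<bar>det (D y)\<bar> * f (F y))"
  shows "set_integrable lebesgue (F ` U) f"
    "(LINT x:F ` U|lebesgue. f x) = (LINT y:U|lebesgue. \<bar>det (D y)\<bar> * f (F y))"
proof -
  \<comment> \<open>The change of variables theorem concerns vector-valued functions, hence the
    detour through \<open>real ^ 1\<close>.\<close>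
  define g where "g x = (vec (f x) :: real ^ 1)" for x
  have "(\<lambda>y. \<bar>det (matrix (\<lambda>v. D y *v v))\<bar> *\<^sub>R g (F y)) absolutely_integrable_on U
      \<and> integral U (\<lambda>y. \<bar>det (matrix (\<lambda>v. D y *v v))\<bar> *\<^sub>R g (F y)) = b
    \<longleftrightarrow> g absolutely_integrable_on (F ` U) \<and> integral (F ` U) g = b" for b
    by (rule has_absolute_integral_change_of_variables[OF U der inj])
  then have eq: "(\<lambda>y. \<bar>det (D y)\<bar> *\<^sub>R g (F y)) absolutely_integrable_on U
      \<and> integral U (\<lambda>y. \<bar>det (D y)\<bar> *\<^sub>R g (F y)) = b
    \<longleftrightarrow> g absolutely_integrable_on (F ` U) \<and> integral (F ` U) g = b" for b
    by simp
  have v: "(\<lambda>y. \<bar>det (D y)\<bar> *\<^sub>R g (F y)) absolutely_integrable_on U"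
    unfolding absolutely_integrable_on_1_iff using int by (simp add: g_def)
  with eq[of "integral U (\<lambda>y. \<bar>det (D y)\<bar> *\<^sub>R g (F y))"]
  have gi: "g absolutely_integrable_on (F ` U)"
    and ge: "integral (F ` U) g = integral U (\<lambda>y. \<bar>det (D y)\<bar> *\<^sub>R g (F y))" by auto
  show fi: "set_integrable lebesgue (F ` U) f"
    using gi unfolding absolutely_integrable_on_1_iff by (simp add: g_def)
  have "integral (F ` U) f = integral U (\<lambda>y. \<bar>det (D y)\<bar> * f (F y))"
    using ge unfolding integral_on_1_eq by (simp add: g_def vec_eq_iff)
  then show "(LINT x:F ` U|lebesgue. f x) = (LINT y:U|lebesgue. \<bar>det (D y)\<bar> * f (F y))"
    using set_lebesgue_integral_eq_integral(2)[OF fi] set_lebesgue_integral_eq_integral(2)[OF int] by simp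
qed

section \<open>The Dirichlet form on one mapped element\<close>

locale element =
  fixes F :: "point \<Rightarrow> point" and D :: "point \<Rightarrow> real ^ 2 ^ 2" and h s :: real
  assumes inj: "inj_on F ref_square"
    and cont: "continuous_on ref_square D"
    and der: "\<And>y. y \<in> ref_square \<Longrightarrow> (F has_derivative (\<lambda>v. D y *v v)) (at y within ref_square)"
    and hs: "0 < h" "0 < s"
    and up: "\<And>y v. y \<in> ref_square \<Longrightarrow> norm (D y *v v) \<le> s * h * norm v"
    and lo: "\<And>y v. y \<in> ref_square \<Longrightarrow> h * norm v \<le> s * norm (D y *v v)"
begin

lemma cont_F: "continuous_on ref_square F"
  using der by (meson continuous_on_eq_continuous_within has_derivative_continuous)

lemma det_nonzero: "y \<in> ref_square \<Longrightarrow> det (D y) \<noteq> 0"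
  using cofin_bounds(1)[OF hs up lo, of y] hs zero_less_power[of "h / s" 2] by force

lemma open_image: "open U \<Longrightarrow> U \<subseteq> ref_square \<Longrightarrow> open (F ` U)"
  using cont_F inj by (intro invariance_of_domain_gen) (auto intro: continuous_on_subset inj_on_subset)

text \<open>On the open image of U the function \<phi> is \<psi> composed with the inverse of F, so
  the chain rule applies. The inverse is differentiable because it is continuous on that image and
  the Jacobian matrix has the explicit left inverse \<open>B\<close>.\<close>

lemma grad_transport:
  assumes U: "open U" "U \<subseteq> ref_square" and y: "y \<in> U"
    and \<phi>: "\<And>z. z \<in> U \<Longrightarrow> \<phi> (F z) = \<psi> z"
    and \<psi>: "(\<psi> has_derivative (\<lambda>v. a1 * v $ 1 + a2 * v $ 2)) (at y)"
  shows "grad \<phi> (F y) $ 1 = (D y $ 2 $ 2 * a1 - D y $ 2 $ 1 * a2) / det (D y)"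
    "grad \<phi> (F y) $ 2 = (D y $ 1 $ 1 * a2 - D y $ 1 $ 2 * a1) / det (D y)"
proof -
  define M where "M = D y"
  define B :: "real ^ 2 ^ 2" where "B = vector [vector [M $ 2 $ 2 / det M, - M $ 1 $ 2 / det M],
    vector [- M $ 2 $ 1 / det M, M $ 1 $ 1 / det M]]"
  have yr: "y \<in> ref_square" using U y by auto
  have dM: "det M \<noteq> 0" using det_nonzero[OF yr] by (simp add: M_def)
  have B: "B $ 1 $ 1 = M $ 2 $ 2 / det M" "B $ 1 $ 2 = - M $ 1 $ 2 / det M"
    "B $ 2 $ 1 = - M $ 2 $ 1 / det M" "B $ 2 $ 2 = M $ 1 $ 1 / det M"
    by (simp_all add: B_def)
  have "B *v (M *v v) = v" for v
  proof -
    have "(B *v (M *v v)) $ 1 = (M $ 1 $ 1 * M $ 2 $ 2 - M $ 1 $ 2 * M $ 2 $ 1) / det M * v $ 1"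
      by (simp add: matrix_vector_2 B) (simp add: divide_simps algebra_simps)
    moreover have "(B *v (M *v v)) $ 2 = (M $ 1 $ 1 * M $ 2 $ 2 - M $ 1 $ 2 * M $ 2 $ 1) / det M * v $ 2"
      by (simp add: matrix_vector_2 B) (simp add: divide_simps algebra_simps)
    ultimately show ?thesis using dM by (simp add: vec_eq_iff forall_2 det_2)
  qed
  then have BM: "(\<lambda>v. B *v v) \<circ> (\<lambda>v. M *v v) = id" by (simp add: fun_eq_iff)
  define G where "G = inv_into ref_square F"
  have GF: "G (F z) = z" if "z \<in> ref_square" for z using that inj by (simp add: G_def)
  have contG: "continuous_on (F ` U) G"
  proof -
    have "continuous_on (F ` ref_square) G"
      using cont_F GF by (intro continuous_on_inv) (auto simp: ref_square_eq)
    then show ?thesis using U by (auto intro: continuous_on_subset)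
  qed
  have Fy: "(F has_derivative (\<lambda>v. M *v v)) (at y)"
    using has_derivative_subset[OF der[OF yr] U(2)] unfolding at_within_open[OF y U(1)] M_def .
  have "(G has_derivative (\<lambda>v. B *v v)) (at (F y))"
  proof (rule has_derivative_inverse_dieudonne[OF U(1) open_image[OF U] _ contG _ y Fy _ BM])
    show "continuous_on U F" using cont_F U(2) by (rule continuous_on_subset)
    show "\<And>x. x \<in> U \<Longrightarrow> G (F x) = x" using GF U by auto
    show "bounded_linear ((*v) B)" by simp
  qed
  moreover have "(\<psi> has_derivative (\<lambda>v. a1 * v $ 1 + a2 * v $ 2)) (at (G (F y)))"
    using \<psi> GF[OF yr] by simp
  ultimately have "((\<psi> \<circ> G) has_derivative (\<lambda>v. a1 * v $ 1 + a2 * v $ 2) \<circ> (\<lambda>v. B *v v)) (at (F y))"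
    by (rule diff_chain_at)
  then have "(\<phi> has_derivative (\<lambda>v. a1 * v $ 1 + a2 * v $ 2) \<circ> (\<lambda>v. B *v v)) (at (F y))"
  proof (rule has_derivative_transform_within_open[OF _ open_image[OF U]])
    show "F y \<in> F ` U" using y by simp
    fix x assume "x \<in> F ` U"
    then obtain z where z: "z \<in> U" "x = F z" by auto
    then show "(\<psi> \<circ> G) x = \<phi> x" using \<phi> GF U by auto
  qed
  then have "frechet_derivative \<phi> (at (F y)) = (\<lambda>v. a1 * v $ 1 + a2 * v $ 2) \<circ> (\<lambda>v. B *v v)"
    by (rule frechet_derivative_at[symmetric])
  then show "grad \<phi> (F y) $ 1 = (D y $ 2 $ 2 * a1 - D y $ 2 $ 1 * a2) / det (D y)"
    "grad \<phi> (F y) $ 2 = (D y $ 1 $ 1 * a2 - D y $ 1 $ 2 * a1) / det (D y)"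
    by (simp_all add: grad_def matrix_vector_2 B axis_def M_def[symmetric] diff_divide_distrib mult.commute)
qed

text \<open>After the substitution the integrand is \<open>cofin\<close> at the reference gradient
  divided by |det|. Bounds (s h)^2 for one and (h / s)^2 for the other leave s^4, and h cancels. The
  open box is the whole reference square for the spectral form and one refined cell for the
  piecewise linear form.\<close>

lemma element_form:
  fixes I :: "'i set" and f g :: "'i \<Rightarrow> real poly" and \<phi> :: "'i \<Rightarrow> point \<Rightarrow> real" and v :: "'i \<Rightarrow> real"
  assumes bd: "0 \<le> \<alpha>" "\<beta> \<le> 1" "0 \<le> \<alpha>'" "\<beta>' \<le> 1"
    and I: "finite I"
    and \<phi>: "\<And>d y. d \<in> I \<Longrightarrow> y \<in> obox \<alpha> \<beta> \<alpha>' \<beta>' \<Longrightarrow> \<phi> d (F y) = poly (f d) (y $ 1) * poly (g d) (y $ 2)"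
  defines "Q \<equiv> (\<Sum>d\<in>I. \<Sum>e\<in>I. v d * v e * (LINT x:F ` obox \<alpha> \<beta> \<alpha>' \<beta>'|lebesgue. grad (\<phi> d) x \<bullet> grad (\<phi> e) x))"
    and "R \<equiv> (\<Sum>d\<in>I. \<Sum>e\<in>I. v d * v e *
      (poly_integral \<alpha> \<beta> (pderiv (f d) * pderiv (f e)) * poly_integral \<alpha>' \<beta>' (g d * g e)
       + poly_integral \<alpha> \<beta> (f d * f e) * poly_integral \<alpha>' \<beta>' (pderiv (g d) * pderiv (g e))))"
  shows "Q \<le> s ^ 4 * R" "R \<le> s ^ 4 * Q"
proof -
  define U where "U = obox \<alpha> \<beta> \<alpha>' \<beta>'"
  have "open U" unfolding U_def by (rule open_obox)
  moreover have "U \<subseteq> ref_square"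
    using bd by (auto simp: U_def obox_def ref_square_def forall_2)
  ultimately have U: "open U" "U \<subseteq> ref_square" by auto
  have Us: "U \<in> sets lebesgue" using U(1) by (simp add: lebesgue_openin)
  define a1 a2 where "a1 d y = poly (pderiv (f d)) (y $ 1) * poly (g d) (y $ 2)"
    and "a2 d y = poly (f d) (y $ 1) * poly (pderiv (g d)) (y $ 2)" for d and y :: point
  have int_cont: "set_integrable lebesgue U w" if "continuous_on ref_square w" for w :: "point \<Rightarrow> real"
    using absolutely_integrable_continuous[of 0 1 w] that Us U(2)
    by (auto simp: ref_square_eq intro: set_integrable_subset)
  have contD: "continuous_on ref_square (\<lambda>y. D y $ i $ j)" for i j
    using cont by (intro continuous_intros)
  have cont_det: "continuous_on ref_square (\<lambda>y. det (D y))"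
    unfolding det_2 by (intro continuous_intros contD)
  have cont_poly: "continuous_on ref_square (\<lambda>y. poly k (y $ i))" for k :: "real poly" and i
    by (intro continuous_intros)
  have conta: "continuous_on ref_square (a1 d)" "continuous_on ref_square (a2 d)" for d
    unfolding a1_def[abs_def] a2_def[abs_def] by (intro continuous_intros cont_poly)+
  have cont_quot: "continuous_on ref_square (\<lambda>y. cofin (D y) (k1 y) (k2 y) (m1 y) (m2 y) / \<bar>det (D y)\<bar>)"
    if "continuous_on ref_square k1" "continuous_on ref_square k2"
      "continuous_on ref_square m1" "continuous_on ref_square m2" for k1 k2 m1 m2
  proof (rule continuous_on_divide)
    show "continuous_on ref_square (\<lambda>y. cofin (D y) (k1 y) (k2 y) (m1 y) (m2 y))"
      unfolding cofin_def
      by (rule continuous_on_add continuous_on_mult continuous_on_diff contD that)+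
    show "continuous_on ref_square (\<lambda>y. \<bar>det (D y)\<bar>)" by (rule continuous_on_rabs[OF cont_det])
    show "\<forall>y\<in>ref_square. \<bar>det (D y)\<bar> \<noteq> 0" using det_nonzero by simp
  qed
  \<comment> \<open>The substitution contributes |det|, the two gradients contribute 1 / det each;
    one determinant remains in the denominator.\<close>
  define G where "G d e y = cofin (D y) (a1 d y) (a2 d y) (a1 e y) (a2 e y) / \<bar>det (D y)\<bar>" for d e y
  have contG: "continuous_on ref_square (G d e)" for d e
    unfolding G_def[abs_def] by (rule cont_quot conta)+
  have pull: "\<bar>det (D y)\<bar> * (grad (\<phi> d) (F y) \<bullet> grad (\<phi> e) (F y)) = G d e y"
    if d: "d \<in> I" "e \<in> I" and y: "y \<in> U" for d e y
  proof -
    have \<psi>: "((\<lambda>y. poly (f d) (y $ 1) * poly (g d) (y $ 2)) has_derivative (\<lambda>v. a1 d y * v $ 1 + a2 d y * v $ 2)) (at y)" for d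
    proof -
      have pd: "((\<lambda>y :: point. poly k (y $ i)) has_derivative (\<lambda>v. poly (pderiv k) (y $ i) * v $ i)) (at y)" for k :: "real poly" and i
      proof -
        have "(poly k has_derivative (\<lambda>t. poly (pderiv k) (y $ i) * t)) (at (y $ i))"
          using poly_DERIV[of k "y $ i"] by (simp add: has_field_derivative_def)
        moreover have "((\<lambda>y :: point. y $ i) has_derivative (\<lambda>v. v $ i)) (at y)"
          by (rule bounded_linear.has_derivative[OF bounded_linear_vec_nth has_derivative_ident])
        ultimately show ?thesis using diff_chain_at[of "\<lambda>y. y $ i" _ y "poly k"] by (simp add: o_def)
      qed
      show ?thesis
        by (rule has_derivative_eq_rhs[OF has_derivative_mult[OF pd pd]])
          (simp add: a1_def a2_def fun_eq_iff algebra_simps)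
    qed
    have dy: "det (D y) \<noteq> 0" using det_nonzero U y by auto
    note g1 = grad_transport[OF U y _ \<psi>, of "\<phi> d" d, OF \<phi>[OF d(1)], folded U_def]
    note g2 = grad_transport[OF U y _ \<psi>, of "\<phi> e" e, OF \<phi>[OF d(2)], folded U_def]
    have "grad (\<phi> d) (F y) \<bullet> grad (\<phi> e) (F y)
      = grad (\<phi> d) (F y) $ 1 * grad (\<phi> e) (F y) $ 1 + grad (\<phi> d) (F y) $ 2 * grad (\<phi> e) (F y) $ 2"
      by (simp add: inner_vec_def sum_2)
    also have "\<dots> = cofin (D y) (a1 d y) (a2 d y) (a1 e y) (a2 e y) / (\<bar>det (D y)\<bar> * \<bar>det (D y)\<bar>)"
      using y g1 g2 by (simp add: cofin_def add_divide_distrib)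
    finally have eq: "grad (\<phi> d) (F y) \<bullet> grad (\<phi> e) (F y)
      = cofin (D y) (a1 d y) (a2 d y) (a1 e y) (a2 e y) / (\<bar>det (D y)\<bar> * \<bar>det (D y)\<bar>)" .
    have "t * (c / (t * t)) = c / t" if "t \<noteq> 0" for t c :: real using that by simp
    then show ?thesis unfolding eq G_def using dy by (metis abs_eq_0)
  qed
  have LG: "(LINT x:F ` U|lebesgue. grad (\<phi> d) x \<bullet> grad (\<phi> e) x) = (LINT y:U|lebesgue. G d e y)"
    if d: "d \<in> I" "e \<in> I" for d e
  proof -
    have eq: "set_integrable lebesgue U (\<lambda>y. \<bar>det (D y)\<bar> * (grad (\<phi> d) (F y) \<bullet> grad (\<phi> e) (F y)))
        \<longleftrightarrow> set_integrable lebesgue U (G d e)"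
      by (rule set_integrable_cong) (auto simp: pull d)
    have "(LINT x:F ` U|lebesgue. grad (\<phi> d) x \<bullet> grad (\<phi> e) x)
      = (LINT y:U|lebesgue. \<bar>det (D y)\<bar> * (grad (\<phi> d) (F y) \<bullet> grad (\<phi> e) (F y)))"
    proof (rule lebesgue_change_of_variables(2)[OF Us])
      show "(F has_derivative (\<lambda>v. D y *v v)) (at y within U)" if "y \<in> U" for y
        using der U that by (auto intro: has_derivative_subset)
      show "inj_on F U" using inj U(2) by (rule inj_on_subset)
      show "set_integrable lebesgue U (\<lambda>y. \<bar>det (D y)\<bar> * (grad (\<phi> d) (F y) \<bullet> grad (\<phi> e) (F y)))"
        unfolding eq by (rule int_cont[OF contG])
    qed
    also have "\<dots> = (LINT y:U|lebesgue. G d e y)"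
      by (rule set_lebesgue_integral_cong) (auto simp: Us pull d)
    finally show ?thesis .
  qed
  define A1 A2 where "A1 y = (\<Sum>d\<in>I. v d * a1 d y)" and "A2 y = (\<Sum>d\<in>I. v d * a2 d y)" for y
  define q where "q y = cofin (D y) (A1 y) (A2 y) (A1 y) (A2 y) / \<bar>det (D y)\<bar>" for y
  have contA: "continuous_on ref_square A1" "continuous_on ref_square A2"
    unfolding A1_def[abs_def] A2_def[abs_def] by (intro continuous_intros conta)+
  have contq: "continuous_on ref_square q"
    unfolding q_def[abs_def] by (rule cont_quot contA)+
  \<comment> \<open>\<open>cofin\<close> is bilinear, so the double sum is its value at the gradient
    of the combined function, where the definite bounds can be used.\<close>
  have cof_sum: "(\<Sum>d\<in>I. \<Sum>e\<in>I. v d * v e * cofin M (a1 d y) (a2 d y) (a1 e y) (a2 e y))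
    = cofin M (A1 y) (A2 y) (A1 y) (A2 y)" for M y
  proof -
    define X Y where "X d = M $ 2 $ 2 * a1 d y - M $ 2 $ 1 * a2 d y" and "Y d = M $ 1 $ 1 * a2 d y - M $ 1 $ 2 * a1 d y" for d
    have "(\<Sum>d\<in>I. \<Sum>e\<in>I. v d * v e * cofin M (a1 d y) (a2 d y) (a1 e y) (a2 e y))
      = (\<Sum>d\<in>I. \<Sum>e\<in>I. (v d * X d) * (v e * X e) + (v d * Y d) * (v e * Y e))"
      by (intro sum.cong refl) (simp add: cofin_def X_def Y_def algebra_simps)
    also have "\<dots> = (\<Sum>d\<in>I. v d * X d) * (\<Sum>e\<in>I. v e * X e) + (\<Sum>d\<in>I. v d * Y d) * (\<Sum>e\<in>I. v e * Y e)"
      by (simp only: sum.distrib sum_product)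
    also have "(\<Sum>d\<in>I. v d * X d) = M $ 2 $ 2 * A1 y - M $ 2 $ 1 * A2 y"
      by (simp add: X_def A1_def A2_def sum_distrib_left sum_subtractf algebra_simps)
    also have "(\<Sum>d\<in>I. v d * Y d) = M $ 1 $ 1 * A2 y - M $ 1 $ 2 * A1 y"
      by (simp add: Y_def A1_def A2_def sum_distrib_left sum_subtractf algebra_simps)
    finally show ?thesis by (simp add: cofin_def)
  qed
  have set_sum: "(LINT y:U|lebesgue. (\<Sum>d\<in>I. \<Sum>e\<in>I. c d e * w d e y)) = (\<Sum>d\<in>I. \<Sum>e\<in>I. c d e * (LINT y:U|lebesgue. w d e y))"
    if "\<And>d e. set_integrable lebesgue U (w d e)" for c :: "'i \<Rightarrow> 'i \<Rightarrow> real" and w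
  proof -
    define k where "k d e y = indicator U y *\<^sub>R w d e y" for d e y
    have k: "integrable lebesgue (k d e)" for d e
      using that unfolding set_integrable_def k_def[abs_def] .
    have eq: "(\<lambda>y. indicator U y *\<^sub>R (\<Sum>d\<in>I. \<Sum>e\<in>I. c d e * w d e y)) = (\<lambda>y. \<Sum>d\<in>I. \<Sum>e\<in>I. c d e * k d e y)"
      by (simp add: fun_eq_iff k_def sum_distrib_left mult.left_commute)
    show ?thesis
      unfolding set_lebesgue_integral_def eq k_def[symmetric] using k by simp
  qed
  have Qq: "Q = (LINT y:U|lebesgue. q y)"
  proof -
    have "Q = (\<Sum>d\<in>I. \<Sum>e\<in>I. v d * v e * (LINT y:U|lebesgue. G d e y))"
      unfolding Q_def U_def[symmetric] by (intro sum.cong refl) (simp add: LG)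
    also have "\<dots> = (LINT y:U|lebesgue. (\<Sum>d\<in>I. \<Sum>e\<in>I. v d * v e * G d e y))"
      by (rule set_sum[symmetric]) (rule int_cont[OF contG])
    also have "(\<lambda>y. \<Sum>d\<in>I. \<Sum>e\<in>I. v d * v e * G d e y) = q"
      unfolding q_def[abs_def] G_def cof_sum[symmetric] by (simp add: sum_divide_distrib)
    finally show ?thesis .
  qed
  have RA: "R = (LINT y:U|lebesgue. (A1 y)\<^sup>2 + (A2 y)\<^sup>2)"
  proof -
    define w where "w d e y = poly (pderiv (f d) * pderiv (f e)) (y $ 1) * poly (g d * g e) (y $ 2)
      + poly (f d * f e) (y $ 1) * poly (pderiv (g d) * pderiv (g e)) (y $ 2)" for d e and y :: point
    have wi: "set_integrable lebesgue U (w d e)"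
      "(LINT y:U|lebesgue. w d e y) = poly_integral \<alpha> \<beta> (pderiv (f d) * pderiv (f e)) * poly_integral \<alpha>' \<beta>' (g d * g e)
       + poly_integral \<alpha> \<beta> (f d * f e) * poly_integral \<alpha>' \<beta>' (pderiv (g d) * pderiv (g e))" for d e
      unfolding w_def[abs_def] U_def
      by (intro set_integral_add obox_integral) (subst set_integral_add(2), (rule obox_integral)+, simp only: obox_integral)
    have "R = (\<Sum>d\<in>I. \<Sum>e\<in>I. v d * v e * (LINT y:U|lebesgue. w d e y))"
      unfolding R_def wi ..
    also have "\<dots> = (LINT y:U|lebesgue. (\<Sum>d\<in>I. \<Sum>e\<in>I. v d * v e * w d e y))"
      by (rule set_sum[symmetric]) (rule wi)
    also have "(\<lambda>y. \<Sum>d\<in>I. \<Sum>e\<in>I. v d * v e * w d e y) = (\<lambda>y. (A1 y)\<^sup>2 + (A2 y)\<^sup>2)"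
    proof
      fix y
      have "(\<Sum>d\<in>I. \<Sum>e\<in>I. v d * v e * w d e y)
        = (\<Sum>d\<in>I. \<Sum>e\<in>I. (v d * a1 d y) * (v e * a1 e y) + (v d * a2 d y) * (v e * a2 e y))"
        by (intro sum.cong refl) (simp add: w_def a1_def a2_def algebra_simps)
      then show "(\<Sum>d\<in>I. \<Sum>e\<in>I. v d * v e * w d e y) = (A1 y)\<^sup>2 + (A2 y)\<^sup>2"
        by (simp only: sum.distrib power2_eq_square A1_def A2_def sum_product)
    qed
    finally show ?thesis .
  qed
  define N where "N y = (A1 y)\<^sup>2 + (A2 y)\<^sup>2" for y
  have contN: "continuous_on ref_square N" unfolding N_def[abs_def] by (intro continuous_intros contA)
  have pw: "q y \<le> s ^ 4 * N y" "N y \<le> s ^ 4 * q y" if y: "y \<in> U" for y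
  proof -
    have yr: "y \<in> ref_square" using U y by auto
    note b = cofin_bounds[OF hs up[OF yr] lo[OF yr]]
    have k: "0 < (h / s)\<^sup>2" using hs by simp
    then have dp: "0 < \<bar>det (D y)\<bar>" using b(1) by linarith
    have N0: "0 \<le> N y" by (simp add: N_def)
    define cq where "cq = cofin (D y) (A1 y) (A2 y) (A1 y) (A2 y)"
    have b3: "(h / s)\<^sup>2 * N y \<le> cq" and b4: "cq \<le> (s * h)\<^sup>2 * N y"
      unfolding N_def cq_def by (rule b)+
    have s4: "s ^ 4 * (h / s)\<^sup>2 = (s * h)\<^sup>2"
      using hs by (simp add: power_divide power_mult_distrib eval_nat_numeral)
    have "cq \<le> s ^ 4 * (h / s)\<^sup>2 * N y" using b4 by (simp add: s4)
    also have "\<dots> \<le> s ^ 4 * \<bar>det (D y)\<bar> * N y"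
      using b(1) N0 hs by (intro mult_right_mono mult_left_mono) auto
    finally show "q y \<le> s ^ 4 * N y" using dp by (simp add: q_def cq_def[symmetric] field_simps)
    have "\<bar>det (D y)\<bar> * N y \<le> (s * h)\<^sup>2 * N y" using b(2) N0 by (intro mult_right_mono) auto
    also have "\<dots> = s ^ 4 * ((h / s)\<^sup>2 * N y)" by (simp add: s4[symmetric])
    also have "\<dots> \<le> s ^ 4 * cq" using b3 hs by (intro mult_left_mono) auto
    finally show "N y \<le> s ^ 4 * q y" using dp by (simp add: q_def cq_def[symmetric] field_simps)
  qed
  have iq: "set_integrable lebesgue U q" "set_integrable lebesgue U N" by (rule int_cont, fact)+
  have "(LINT y:U|lebesgue. q y) \<le> (LINT y:U|lebesgue. s ^ 4 * N y)"
    using iq by (intro set_integral_mono) (auto simp: pw)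
  then show "Q \<le> s ^ 4 * R" by (simp add: Qq RA N_def)
  have "(LINT y:U|lebesgue. N y) \<le> (LINT y:U|lebesgue. s ^ 4 * q y)"
    using iq by (intro set_integral_mono) (auto simp: pw)
  then show "R \<le> s ^ 4 * Q" by (simp add: Qq RA N_def)
qed

end

section \<open>Assembly over the mesh\<close>

lemma grad_zero:
  assumes "open V" "x \<in> V" "\<And>z. z \<in> V \<Longrightarrow> f z = 0"
  shows "grad f x = 0"
proof -
  have "(f has_derivative (\<lambda>_. 0)) (at x)"
    by (rule has_derivative_transform_within_open[OF has_derivative_const[of 0] assms(1,2)])
      (simp add: assms(3))
  then have "frechet_derivative f (at x) = (\<lambda>_. 0)" by (rule frechet_derivative_at[symmetric])
  then show ?thesis by (simp add: grad_def vec_eq_iff)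
qed

lemma obox_unit: "obox 0 1 0 1 = box 0 1"
  by (auto simp: obox_def mem_box Basis_2 inner_axis)

text \<open>Invariance of domain in both directions: the image of the open square is open, and the
  preimage of the interior is an open subset of the closed square. The spectral form integrates over
  interiors of elements and is pulled back through this.\<close>

lemma (in element) interior_image: "interior (F ` ref_square) = F ` obox 0 1 0 1"
proof
  have "obox 0 1 0 1 \<subseteq> ref_square" by (auto simp: obox_def ref_square_def forall_2)
  then show "F ` obox 0 1 0 1 \<subseteq> interior (F ` ref_square)"
    by (intro interior_maximal open_image open_obox) auto
  define V where "V = interior (F ` ref_square)"
  define G where "G = inv_into ref_square F"
  have V: "open V" "V \<subseteq> F ` ref_square" by (simp_all add: V_def interior_subset)
  have GF: "G (F z) = z" if "z \<in> ref_square" for z using that inj by (simp add: G_def)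
  have "continuous_on (F ` ref_square) G"
    using cont_F GF by (intro continuous_on_inv) (auto simp: ref_square_eq)
  moreover have injG: "inj_on G V"
    unfolding G_def using V(2) by (rule inj_on_inv_into)
  ultimately have "open (G ` V)"
    using V by (intro invariance_of_domain_gen) (auto intro: continuous_on_subset)
  moreover have "G ` V \<subseteq> cbox 0 1" using V GF by (auto simp: ref_square_eq[symmetric])
  ultimately have "G ` V \<subseteq> obox 0 1 0 1"
    unfolding obox_unit interior_cbox[symmetric] by (rule interior_maximal[rotated])
  moreover have "F (G x) = x" if "x \<in> V" for x using V GF that by auto
  ultimately show "interior (F ` ref_square) \<subseteq> F ` obox 0 1 0 1"
    unfolding V_def[symmetric] by (metis image_eqI image_subset_iff subsetI)
qed

lemma (in element) image_subset_closure: "F ` ref_square \<subseteq> closure (interior (F ` ref_square))"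
proof -
  have ne: "box (0 :: point) 1 \<noteq> {}" by (simp add: box_ne_empty Basis_2 inner_axis)
  have "F ` closure (box 0 1) \<subseteq> closure (F ` box 0 1)"
    using cont_F by (intro image_closure_subset) (auto simp: closure_box[OF ne] ref_square_eq closure_subset)
  then show ?thesis by (simp add: closure_box[OF ne] ref_square_eq[symmetric] interior_image obox_unit)
qed

text \<open>Positivity of \<sigma> and of the diameter comes from the invertible Jacobian at one
  corner: it does not annihilate a unit vector, so their product is positive, and a diameter is
  never negative.\<close>

lemma mesh_element:
  assumes mesh: "hp_mesh \<Omega> \<T> T p" and qu: "quasi_uniform \<sigma> \<T> T" and \<kappa>: "\<kappa> \<in> \<T>"
  shows "0 < \<sigma>" "\<exists>D. element (T \<kappa>) D (diameter \<kappa>) \<sigma>"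
proof -
  define h where "h = diameter \<kappa>"
  have em: "element_map (T \<kappa>) \<kappa>" using mesh \<kappa> by (simp add: hp_mesh_def)
  then obtain D where D: "continuous_on ref_square D" "\<And>y. y \<in> ref_square \<Longrightarrow> invertible (D y)"
    "\<And>y. y \<in> ref_square \<Longrightarrow> (T \<kappa> has_derivative (\<lambda>v. D y *v v)) (at y within ref_square)"
    by (auto simp: element_map_def)
  have bounds: "norm (D y *v v) \<le> \<sigma> * h * norm v" "h * norm v \<le> \<sigma> * norm (D y *v v)" if "y \<in> ref_square" for y v
    using qu \<kappa> D(3)[OF that] that unfolding quasi_uniform_def h_def by blast+
  have zero: "0 \<in> ref_square" by (simp add: ref_square_def)
  define e where "e = (axis 1 1 :: point)"
  have e: "norm e = 1" by (simp add: e_def)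
  have "D 0 *v e \<noteq> 0"
  proof
    assume "D 0 *v e = 0"
    moreover obtain B where "B ** D 0 = mat 1" using D(2)[OF zero] by (auto simp: invertible_def)
    ultimately have "e = 0" by (metis matrix_vector_mul_assoc matrix_vector_mul_lid matrix_vector_mult_0_right)
    then show False using e by simp
  qed
  then have pos: "0 < \<sigma> * h" using bounds(1)[OF zero, of e] e by (metis mult.right_neutral order_less_le_trans zero_less_norm_iff)
  have "continuous_on ref_square (T \<kappa>)"
    using D(3) by (meson continuous_on_eq_continuous_within has_derivative_continuous)
  then have "compact (T \<kappa> ` ref_square)" by (intro compact_continuous_image) (simp_all add: ref_square_eq)
  then have "bounded \<kappa>" using em by (simp add: element_map_def compact_imp_bounded)
  then have "0 \<le> h" unfolding h_def by (rule diameter_ge_0)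
  then have hs: "0 < h" "0 < \<sigma>" using pos by (auto simp: zero_less_mult_iff)
  then show "0 < \<sigma>" by simp
  have "element (T \<kappa>) D h \<sigma>"
    using em D bounds hs by unfold_locales (auto simp: element_map_def)
  then show "\<exists>D. element (T \<kappa>) D (diameter \<kappa>) \<sigma>" by (auto simp: h_def)
qed

lemma quad_form_restrict:
  "quad_form J (restrict_matrix I P A) u
    = (\<Sum>d\<in>I. \<Sum>e\<in>I. (\<Sum>a\<in>J. P d a * u a) * (\<Sum>a\<in>J. P e a * u a) * A d e)"
proof -
  have "(\<Sum>a\<in>J. P d a * u a) * (\<Sum>a\<in>J. P e a * u a) * A d e
    = (\<Sum>a\<in>J. \<Sum>b\<in>J. u a * (P d a * A d e * P e b) * u b)" for d e
    by (simp only: sum_product) (simp add: sum_distrib_left mult_ac)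
  then have "(\<Sum>d\<in>I. \<Sum>e\<in>I. (\<Sum>a\<in>J. P d a * u a) * (\<Sum>a\<in>J. P e a * u a) * A d e)
    = (\<Sum>d\<in>I. \<Sum>e\<in>I. \<Sum>a\<in>J. \<Sum>b\<in>J. u a * (P d a * A d e * P e b) * u b)"
    by simp
  also have "\<dots> = (\<Sum>d\<in>I. \<Sum>a\<in>J. \<Sum>e\<in>I. \<Sum>b\<in>J. u a * (P d a * A d e * P e b) * u b)"
    by (intro sum.cong refl sum.swap)
  also have "\<dots> = (\<Sum>d\<in>I. \<Sum>a\<in>J. \<Sum>b\<in>J. \<Sum>e\<in>I. u a * (P d a * A d e * P e b) * u b)"
    by (intro sum.cong refl sum.swap)
  also have "\<dots> = (\<Sum>a\<in>J. \<Sum>d\<in>I. \<Sum>b\<in>J. \<Sum>e\<in>I. u a * (P d a * A d e * P e b) * u b)"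
    by (rule sum.swap)
  also have "\<dots> = (\<Sum>a\<in>J. \<Sum>b\<in>J. \<Sum>d\<in>I. \<Sum>e\<in>I. u a * (P d a * A d e * P e b) * u b)"
    by (intro sum.cong refl sum.swap)
  also have "\<dots> = quad_form J (restrict_matrix I P A) u"
    by (simp add: quad_form_def restrict_matrix_def sum_distrib_left sum_distrib_right)
  finally show ?thesis by simp
qed

lemma sum_tensor:
  "(\<Sum>d\<in>{0..p} \<times> {0..p}. \<Sum>e\<in>{0..p} \<times> {0..p}. v d * v e * (A (fst d) (fst e) * B (snd d) (snd e)))
    = tensor p A B (\<lambda>i j. v (i, j))"
proof -
  have "(\<Sum>d\<in>{0..p} \<times> {0..p}. w d) = (\<Sum>i\<le>p. \<Sum>j\<le>p. w (i, j))" for w :: "nat \<times> nat \<Rightarrow> real"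
    unfolding atLeast0AtMost sum.cartesian_product by simp
  then show ?thesis by (simp add: tensor_def)
qed

section \<open>Splitting of both forms into element contributions\<close>

context
  fixes \<Omega> :: "point set" and \<T> :: "element set" and T :: "element \<Rightarrow> point \<Rightarrow> point" and p :: "element \<Rightarrow> nat"
    and \<sigma> :: real
  assumes mesh: "hp_mesh \<Omega> \<T> T p" and qu: "quasi_uniform \<sigma> \<T> T"
begin

lemma element_image: "\<kappa> \<in> \<T> \<Longrightarrow> T \<kappa> ` ref_square = \<kappa>"
  using mesh by (simp add: hp_mesh_def element_map_def)

lemma push_forward_image:
  assumes "\<kappa> \<in> \<T>" "y \<in> ref_square"
  shows "push_forward T \<kappa> f (T \<kappa> y) = f y"
proof -
  have "inj_on (T \<kappa>) ref_square" using mesh assms by (simp add: hp_mesh_def element_map_def)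
  moreover have "T \<kappa> y \<in> \<kappa>" using element_image assms by blast
  ultimately show ?thesis using assms by (simp add: push_forward_def)
qed

lemma interior_element: "\<kappa> \<in> \<T> \<Longrightarrow> interior \<kappa> = T \<kappa> ` obox 0 1 0 1"
  using mesh_element[OF mesh qu] element.interior_image element_image by metis

text \<open>Disjointness of the interiors extends to the boundary, because an element lies in the
  closure of its interior and an open set that misses a set misses its closure.\<close>

lemma interior_disjoint:
  assumes "\<kappa> \<in> \<T>" "\<kappa>' \<in> \<T>" "\<kappa> \<noteq> \<kappa>'"
  shows "interior \<kappa>' \<inter> \<kappa> = {}"
proof -
  have "interior \<kappa>' \<inter> interior \<kappa> = {}" using mesh assms unfolding hp_mesh_def by blast
  then have "interior \<kappa>' \<inter> closure (interior \<kappa>) = {}" by (simp add: open_Int_closure_eq_empty)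
  moreover have "\<kappa> \<subseteq> closure (interior \<kappa>)"
    using mesh_element[OF mesh qu assms(1)] element.image_subset_closure element_image[OF assms(1)] by metis
  ultimately show ?thesis by blast
qed

text \<open>In the interior of any other element the transported function vanishes on a whole
  neighbourhood, so its classical gradient is 0 there.\<close>

lemma broken_grad_push_forward:
  assumes \<kappa>: "\<kappa> \<in> \<T>"
  shows "broken_grad \<T> (push_forward T \<kappa> f) x = (if x \<in> interior \<kappa> then grad (push_forward T \<kappa> f) x else 0)"
proof (cases "x \<in> interior \<kappa>")
  case False
  have "grad (push_forward T \<kappa> f) x = 0" if \<kappa>': "\<kappa>' \<in> \<T>" "x \<in> interior \<kappa>'" for \<kappa>'
  proof (rule grad_zero[of "interior \<kappa>'"])
    have "\<kappa> \<noteq> \<kappa>'" using that False by auto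
    from interior_disjoint[OF \<kappa> \<kappa>'(1) this]
    show "\<And>z. z \<in> interior \<kappa>' \<Longrightarrow> push_forward T \<kappa> f z = 0" by (auto simp: push_forward_def)
  qed (use that in auto)
  then show ?thesis using False by (auto simp: broken_grad_def)
qed (use \<kappa> in \<open>auto simp: broken_grad_def\<close>)

lemma nodal_basis_push:
  "nodal_basis T p d = push_forward T (fst d)
    (\<lambda>y. lagrange (p (fst d)) (fst (snd d)) (y $ 1) * lagrange (p (fst d)) (snd (snd d)) (y $ 2))"
  by (cases d) simp

lemma lor_basis_push:
  "lor_basis T p d = push_forward T (fst d)
    (\<lambda>y. hat (p (fst d)) (fst (snd d)) (y $ 1) * hat (p (fst d)) (snd (snd d)) (y $ 2))"
  by (cases d) simp

lemma A_hat_same: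
  assumes "\<kappa> \<in> \<T>"
  shows "A_hat \<Omega> \<T> T p (\<kappa>, d) (\<kappa>, e)
    = (LINT x:interior \<kappa>|lebesgue. grad (nodal_basis T p (\<kappa>, d)) x \<bullet> grad (nodal_basis T p (\<kappa>, e)) x)"
proof -
  have "interior \<kappa> \<subseteq> \<Omega>" using mesh assms by (simp add: hp_mesh_def)
  then show ?thesis
    unfolding A_hat_def set_lebesgue_integral_def nodal_basis_push fst_conv broken_grad_push_forward[OF assms]
    by (intro Bochner_Integration.integral_cong) (auto simp: indicator_def)
qed

lemma A_hat_different:
  assumes "fst d \<in> \<T>" "fst e \<in> \<T>" "fst d \<noteq> fst e"
  shows "A_hat \<Omega> \<T> T p d e = 0"
proof -
  have "interior (fst d) \<inter> interior (fst e) = {}"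
    using mesh assms unfolding hp_mesh_def by blast
  then have "broken_grad \<T> (nodal_basis T p d) x \<bullet> broken_grad \<T> (nodal_basis T p e) x = 0" for x
    unfolding nodal_basis_push broken_grad_push_forward[OF assms(1)] broken_grad_push_forward[OF assms(2)]
    by auto
  then show ?thesis by (simp add: A_hat_def set_lebesgue_integral_def)
qed

lemma block_sum:
  fixes A :: "dof \<Rightarrow> dof \<Rightarrow> real"
  assumes "\<And>d e. fst d \<in> \<T> \<Longrightarrow> fst e \<in> \<T> \<Longrightarrow> fst d \<noteq> fst e \<Longrightarrow> A d e = 0"
  shows "(\<Sum>d\<in>dofs \<T> p. \<Sum>e\<in>dofs \<T> p. v d * v e * A d e)
    = (\<Sum>\<kappa>\<in>\<T>. \<Sum>d\<in>{0..p \<kappa>} \<times> {0..p \<kappa>}. \<Sum>e\<in>{0..p \<kappa>} \<times> {0..p \<kappa>}. v (\<kappa>, d) * v (\<kappa>, e) * A (\<kappa>, d) (\<kappa>, e))"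
proof -
  have fin: "finite \<T>" using mesh by (simp add: hp_mesh_def)
  have S: "(\<Sum>d\<in>dofs \<T> p. w d) = (\<Sum>\<kappa>\<in>\<T>. \<Sum>d\<in>{0..p \<kappa>} \<times> {0..p \<kappa>}. w (\<kappa>, d))" for w :: "dof \<Rightarrow> real"
    unfolding dofs_def by (subst sum.Sigma) (auto simp: fin case_prod_unfold)
  show ?thesis
    unfolding S
  proof (intro sum.cong refl)
    fix \<kappa> d assume \<kappa>: "\<kappa> \<in> \<T>" and "d \<in> {0..p \<kappa>} \<times> {0..p \<kappa>}"
    have "(\<Sum>\<kappa>'\<in>\<T>. \<Sum>e\<in>{0..p \<kappa>'} \<times> {0..p \<kappa>'}. v (\<kappa>, d) * v (\<kappa>', e) * A (\<kappa>, d) (\<kappa>', e))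
      = (\<Sum>\<kappa>'\<in>{\<kappa>}. \<Sum>e\<in>{0..p \<kappa>'} \<times> {0..p \<kappa>'}. v (\<kappa>, d) * v (\<kappa>', e) * A (\<kappa>, d) (\<kappa>', e))"
    proof (rule sum.mono_neutral_right)
      show "\<forall>\<kappa>'\<in>\<T> - {\<kappa>}. (\<Sum>e\<in>{0..p \<kappa>'} \<times> {0..p \<kappa>'}. v (\<kappa>, d) * v (\<kappa>', e) * A (\<kappa>, d) (\<kappa>', e)) = 0"
      proof (intro ballI sum.neutral)
        fix \<kappa>' e assume "\<kappa>' \<in> \<T> - {\<kappa>}"
        then have "A (\<kappa>, d) (\<kappa>', e) = 0" using \<kappa> assms[of "(\<kappa>, d)" "(\<kappa>', e)"] by auto
        then show "v (\<kappa>, d) * v (\<kappa>', e) * A (\<kappa>, d) (\<kappa>', e) = 0" by simp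
      qed
    qed (use \<kappa> fin in auto)
    then show "(\<Sum>\<kappa>'\<in>\<T>. \<Sum>e\<in>{0..p \<kappa>'} \<times> {0..p \<kappa>'}. v (\<kappa>, d) * v (\<kappa>', e) * A (\<kappa>, d) (\<kappa>', e))
      = (\<Sum>e\<in>{0..p \<kappa>} \<times> {0..p \<kappa>}. v (\<kappa>, d) * v (\<kappa>, e) * A (\<kappa>, d) (\<kappa>, e))"
      by simp
  qed
qed

lemma A_hat_element:
  fixes v :: "nat \<times> nat \<Rightarrow> real"
  assumes \<kappa>: "\<kappa> \<in> \<T>"
  defines "I \<equiv> {0..p \<kappa>} \<times> {0..p \<kappa>}"
  defines "Q \<equiv> (\<Sum>d\<in>I. \<Sum>e\<in>I. v d * v e * A_hat \<Omega> \<T> T p (\<kappa>, d) (\<kappa>, e))"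
    and "R \<equiv> tensor (p \<kappa>) (stiff_gl (p \<kappa>)) (mass_gl (p \<kappa>)) (\<lambda>i j. v (i, j)) + tensor (p \<kappa>) (mass_gl (p \<kappa>)) (stiff_gl (p \<kappa>)) (\<lambda>i j. v (i, j))"
  shows "Q \<le> \<sigma> ^ 4 * R" "R \<le> \<sigma> ^ 4 * Q"
proof -
  obtain D where "element (T \<kappa>) D (diameter \<kappa>) \<sigma>" using mesh_element[OF mesh qu \<kappa>] by blast
  then interpret element "T \<kappa>" D "diameter \<kappa>" \<sigma> .
  have sub: "obox 0 1 0 1 \<subseteq> ref_square" by (auto simp: obox_def ref_square_def forall_2)
  have \<phi>: "nodal_basis T p (\<kappa>, d) (T \<kappa> y) = poly (lagp (p \<kappa>) (fst d)) (y $ 1) * poly (lagp (p \<kappa>) (snd d)) (y $ 2)"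
    if "d \<in> I" "y \<in> obox 0 1 0 1" for d y
    unfolding nodal_basis_push fst_conv snd_conv using sub that by (subst push_forward_image) (auto simp: \<kappa> poly_lagp)
  have "R = (\<Sum>d\<in>I. \<Sum>e\<in>I. v d * v e *
      (poly_integral 0 1 (pderiv (lagp (p \<kappa>) (fst d)) * pderiv (lagp (p \<kappa>) (fst e))) * poly_integral 0 1 (lagp (p \<kappa>) (snd d) * lagp (p \<kappa>) (snd e))
       + poly_integral 0 1 (lagp (p \<kappa>) (fst d) * lagp (p \<kappa>) (fst e)) * poly_integral 0 1 (pderiv (lagp (p \<kappa>) (snd d)) * pderiv (lagp (p \<kappa>) (snd e)))))"
    unfolding R_def sum_tensor[symmetric] I_def
    by (simp add: stiff_gl_def mass_gl_def gram_def distrib_left sum.distrib)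
  moreover have "finite I" by (simp add: I_def)
  moreover have "Q = (\<Sum>d\<in>I. \<Sum>e\<in>I. v d * v e *
      (LINT x:T \<kappa> ` obox 0 1 0 1|lebesgue. grad (nodal_basis T p (\<kappa>, d)) x \<bullet> grad (nodal_basis T p (\<kappa>, e)) x))"
    unfolding Q_def A_hat_same[OF \<kappa>] interior_element[OF \<kappa>] ..
  ultimately show "Q \<le> \<sigma> ^ 4 * R" "R \<le> \<sigma> ^ 4 * Q"
    using element_form[of 0 1 0 1 I "\<lambda>d. nodal_basis T p (\<kappa>, d)" "\<lambda>d. lagp (p \<kappa>) (fst d)" "\<lambda>d. lagp (p \<kappa>) (snd d)" v] \<phi>
    by auto
qed

lemma A_tilde_element:
  fixes v :: "nat \<times> nat \<Rightarrow> real"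
  assumes \<kappa>: "\<kappa> \<in> \<T>"
  defines "I \<equiv> {0..p \<kappa>} \<times> {0..p \<kappa>}"
  defines "Q \<equiv> (\<Sum>d\<in>I. \<Sum>e\<in>I. v d * v e * A_tilde T p (\<kappa>, d) (\<kappa>, e))"
    and "R \<equiv> tensor (p \<kappa>) (stiff_pl (p \<kappa>)) (mass_pl (p \<kappa>)) (\<lambda>i j. v (i, j)) + tensor (p \<kappa>) (mass_pl (p \<kappa>)) (stiff_pl (p \<kappa>)) (\<lambda>i j. v (i, j))"
  shows "Q \<le> \<sigma> ^ 4 * R" "R \<le> \<sigma> ^ 4 * Q"
proof -
  obtain D where "element (T \<kappa>) D (diameter \<kappa>) \<sigma>" using mesh_element[OF mesh qu \<kappa>] by blast
  then interpret element "T \<kappa>" D "diameter \<kappa>" \<sigma> .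
  define n where "n = p \<kappa>"
  have n: "1 \<le> n" using mesh \<kappa> by (simp add: hp_mesh_def n_def)
  define t where "t = gl_node n"
  define q where "q a b = (\<Sum>d\<in>I. \<Sum>e\<in>I. v d * v e *
      (LINT x:T \<kappa> ` obox (t a) (t (Suc a)) (t b) (t (Suc b))|lebesgue. grad (lor_basis T p (\<kappa>, d)) x \<bullet> grad (lor_basis T p (\<kappa>, e)) x))" for a b
  define r where "r a b = (\<Sum>d\<in>I. \<Sum>e\<in>I. v d * v e *
      (poly_integral (t a) (t (Suc a)) (pderiv (hatp n a (fst d)) * pderiv (hatp n a (fst e))) * poly_integral (t b) (t (Suc b)) (hatp n b (snd d) * hatp n b (snd e))
       + poly_integral (t a) (t (Suc a)) (hatp n a (fst d) * hatp n a (fst e)) * poly_integral (t b) (t (Suc b)) (pderiv (hatp n b (snd d)) * pderiv (hatp n b (snd e)))))" for a b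
  have qr: "q a b \<le> \<sigma> ^ 4 * r a b \<and> r a b \<le> \<sigma> ^ 4 * q a b" if ab: "a < n" "b < n" for a b
  proof -
    have bd: "0 \<le> t a" "t (Suc a) \<le> 1" "0 \<le> t b" "t (Suc b) \<le> 1"
      using gl_node_bounds[OF n] ab by (auto simp: t_def)
    have sub: "obox (t a) (t (Suc a)) (t b) (t (Suc b)) \<subseteq> ref_square"
      using bd by (auto simp: obox_def ref_square_def forall_2)
    have \<phi>: "lor_basis T p (\<kappa>, d) (T \<kappa> y) = poly (hatp n a (fst d)) (y $ 1) * poly (hatp n b (snd d)) (y $ 2)"
      if d: "d \<in> I" and y: "y \<in> obox (t a) (t (Suc a)) (t b) (t (Suc b))" for d y
    proof -
      have "fst d \<le> n" "snd d \<le> n" using d by (auto simp: I_def n_def)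
      then have "hat n (fst d) (y $ 1) = poly (hatp n a (fst d)) (y $ 1)"
        "hat n (snd d) (y $ 2) = poly (hatp n b (snd d)) (y $ 2)"
        using y ab by (auto simp: obox_def t_def intro!: hat_eq_hatp[OF n])
      then show ?thesis
        unfolding lor_basis_push fst_conv snd_conv using sub y by (subst push_forward_image) (auto simp: \<kappa> n_def)
    qed
    have "finite I" by (simp add: I_def)
    then show ?thesis unfolding q_def r_def
      using element_form[of "t a" "t (Suc a)" "t b" "t (Suc b)" I "\<lambda>d. lor_basis T p (\<kappa>, d)"
          "\<lambda>d. hatp n a (fst d)" "\<lambda>d. hatp n b (snd d)" v] \<phi> bd
      by auto
  qed
  have swap: "(\<Sum>d\<in>I. \<Sum>e\<in>I. v d * v e * (\<Sum>a<n. \<Sum>b<n. w a b d e)) = (\<Sum>a<n. \<Sum>b<n. \<Sum>d\<in>I. \<Sum>e\<in>I. v d * v e * w a b d e)"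
    for w :: "nat \<Rightarrow> nat \<Rightarrow> nat \<times> nat \<Rightarrow> nat \<times> nat \<Rightarrow> real"
  proof -
    have s1: "(\<Sum>e\<in>I. \<Sum>a<n. g e a) = (\<Sum>a<n. \<Sum>e\<in>I. g e a)" for g :: "nat \<times> nat \<Rightarrow> nat \<Rightarrow> real"
      by (rule sum.swap)
    show ?thesis unfolding sum_distrib_left s1 ..
  qed
  have "Q = (\<Sum>a<n. \<Sum>b<n. q a b)"
    unfolding q_def swap[symmetric] Q_def A_tilde_def
    by (simp add: lor_cell_def obox_def t_def n_def)
  moreover have "R = (\<Sum>a<n. \<Sum>b<n. r a b)"
  proof -
    have "R = (\<Sum>d\<in>I. \<Sum>e\<in>I. v d * v e * (\<Sum>a<n. \<Sum>b<n.
      (poly_integral (t a) (t (Suc a)) (pderiv (hatp n a (fst d)) * pderiv (hatp n a (fst e))) * poly_integral (t b) (t (Suc b)) (hatp n b (snd d) * hatp n b (snd e))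
       + poly_integral (t a) (t (Suc a)) (hatp n a (fst d) * hatp n a (fst e)) * poly_integral (t b) (t (Suc b)) (pderiv (hatp n b (snd d)) * pderiv (hatp n b (snd e))))))"
      unfolding R_def sum_tensor[symmetric] n_def[symmetric] I_def
      by (simp add: stiff_pl_def mass_pl_def gram_def t_def distrib_left sum.distrib sum_product)
    also have "\<dots> = (\<Sum>a<n. \<Sum>b<n. r a b)"
      unfolding r_def by (rule swap)
    finally show ?thesis .
  qed
  ultimately show "Q \<le> \<sigma> ^ 4 * R" "R \<le> \<sigma> ^ 4 * Q"
    using qr by (auto simp: sum_distrib_left intro!: sum_mono)
qed

text \<open>\<sigma>^4 is paid twice, on the way to the reference square for one form and back for
  the other, and Cref^2 once in between.\<close>

lemma element_equivalence:
  fixes v :: "nat \<times> nat \<Rightarrow> real"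
  assumes \<kappa>: "\<kappa> \<in> \<T>"
  defines "I \<equiv> {0..p \<kappa>} \<times> {0..p \<kappa>}"
  defines "Q1 \<equiv> (\<Sum>d\<in>I. \<Sum>e\<in>I. v d * v e * A_hat \<Omega> \<T> T p (\<kappa>, d) (\<kappa>, e))"
    and "Q2 \<equiv> (\<Sum>d\<in>I. \<Sum>e\<in>I. v d * v e * A_tilde T p (\<kappa>, d) (\<kappa>, e))"
  shows "Q1 \<le> (\<sigma> ^ 4 * Cref)\<^sup>2 * Q2" "Q2 \<le> (\<sigma> ^ 4 * Cref)\<^sup>2 * Q1"
proof -
  have n: "1 \<le> p \<kappa>" using mesh \<kappa> by (simp add: hp_mesh_def)
  define v' where "v' = (\<lambda>i j. v (i, j))"
  define R1 R2 where "R1 = tensor (p \<kappa>) (stiff_gl (p \<kappa>)) (mass_gl (p \<kappa>)) v' + tensor (p \<kappa>) (mass_gl (p \<kappa>)) (stiff_gl (p \<kappa>)) v'"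
    and "R2 = tensor (p \<kappa>) (stiff_pl (p \<kappa>)) (mass_pl (p \<kappa>)) v' + tensor (p \<kappa>) (mass_pl (p \<kappa>)) (stiff_pl (p \<kappa>)) v'"
  have 1: "Q1 \<le> \<sigma> ^ 4 * R1" "R1 \<le> \<sigma> ^ 4 * Q1"
    using A_hat_element[OF \<kappa>, of v] by (simp_all add: Q1_def R1_def I_def v'_def)
  have 2: "Q2 \<le> \<sigma> ^ 4 * R2" "R2 \<le> \<sigma> ^ 4 * Q2"
    using A_tilde_element[OF \<kappa>, of v] by (simp_all add: Q2_def R2_def I_def v'_def)
  have 3: "R1 \<le> Cref\<^sup>2 * R2" "R2 \<le> Cref\<^sup>2 * R1"
    using reference_equivalence[OF n, of v'] by (simp_all add: R1_def R2_def)
  have chain: "x \<le> (\<sigma> ^ 4 * Cref)\<^sup>2 * w" if "x \<le> \<sigma> ^ 4 * y" "y \<le> Cref\<^sup>2 * z" "z \<le> \<sigma> ^ 4 * w" for x y z w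
  proof -
    have "x \<le> \<sigma> ^ 4 * y" by fact
    also have "\<dots> \<le> \<sigma> ^ 4 * (Cref\<^sup>2 * (\<sigma> ^ 4 * w))"
    proof (rule mult_left_mono)
      have "Cref\<^sup>2 * z \<le> Cref\<^sup>2 * (\<sigma> ^ 4 * w)" using that(3) by (rule mult_left_mono) simp
      then show "y \<le> Cref\<^sup>2 * (\<sigma> ^ 4 * w)" using that(2) by linarith
    qed simp
    also have "\<dots> = (\<sigma> ^ 4 * Cref)\<^sup>2 * w" by (simp only: power2_eq_square mult_ac)
    finally show ?thesis .
  qed
  show "Q1 \<le> (\<sigma> ^ 4 * Cref)\<^sup>2 * Q2" using 1(1) 3(1) 2(2) by (rule chain)
  show "Q2 \<le> (\<sigma> ^ 4 * Cref)\<^sup>2 * Q1" using 2(1) 3(2) 1(2) by (rule chain)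
qed

lemma mesh_equivalence:
  fixes P :: "dof \<Rightarrow> nat \<Rightarrow> real" and J :: "nat set" and u :: "nat \<Rightarrow> real"
  defines "Q1 \<equiv> quad_form J (restrict_matrix (dofs \<T> p) P (A_hat \<Omega> \<T> T p)) u"
    and "Q2 \<equiv> quad_form J (restrict_matrix (dofs \<T> p) P (A_tilde T p)) u"
  shows "Q1 \<le> (\<sigma> ^ 4 * Cref)\<^sup>2 * Q2" "Q2 \<le> (\<sigma> ^ 4 * Cref)\<^sup>2 * Q1"
proof -
  define v where "v d = (\<Sum>a\<in>J. P d a * u a)" for d
  define q1 q2 where "q1 \<kappa> = (\<Sum>d\<in>{0..p \<kappa>} \<times> {0..p \<kappa>}. \<Sum>e\<in>{0..p \<kappa>} \<times> {0..p \<kappa>}. v (\<kappa>, d) * v (\<kappa>, e) * A_hat \<Omega> \<T> T p (\<kappa>, d) (\<kappa>, e))"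
    and "q2 \<kappa> = (\<Sum>d\<in>{0..p \<kappa>} \<times> {0..p \<kappa>}. \<Sum>e\<in>{0..p \<kappa>} \<times> {0..p \<kappa>}. v (\<kappa>, d) * v (\<kappa>, e) * A_tilde T p (\<kappa>, d) (\<kappa>, e))" for \<kappa>
  have "Q1 = (\<Sum>\<kappa>\<in>\<T>. q1 \<kappa>)"
    unfolding Q1_def quad_form_restrict v_def[symmetric] q1_def by (rule block_sum) (rule A_hat_different)
  moreover have "Q2 = (\<Sum>\<kappa>\<in>\<T>. q2 \<kappa>)"
    unfolding Q2_def quad_form_restrict v_def[symmetric] q2_def by (rule block_sum) (simp add: A_tilde_def)
  moreover have "q1 \<kappa> \<le> (\<sigma> ^ 4 * Cref)\<^sup>2 * q2 \<kappa>" "q2 \<kappa> \<le> (\<sigma> ^ 4 * Cref)\<^sup>2 * q1 \<kappa>" if "\<kappa> \<in> \<T>" for \<kappa>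
    unfolding q1_def q2_def by (rule element_equivalence[OF that])+
  ultimately show "Q1 \<le> (\<sigma> ^ 4 * Cref)\<^sup>2 * Q2" "Q2 \<le> (\<sigma> ^ 4 * Cref)\<^sup>2 * Q1"
    by (simp_all add: sum_distrib_left sum_mono)
qed

end

theorem proposition1:
  fixes \<sigma> \<rho> :: real and l :: nat
  shows "\<exists>C>0. \<forall>(\<Omega> :: point set) (\<T> :: element set) (T :: element \<Rightarrow> point \<Rightarrow> point)
            (p :: element \<Rightarrow> nat) (m :: nat) (\<phi> :: nat \<Rightarrow> point \<Rightarrow> real) (P :: dof \<Rightarrow> nat \<Rightarrow> real).
     hp_mesh \<Omega> \<T> T p \<longrightarrow> quasi_uniform \<sigma> \<T> T \<longrightarrow>
     irregularity_le l \<T> T \<longrightarrow> degree_ratio_le \<rho> \<T> T p \<longrightarrow>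
     is_basis \<Omega> (V_C \<Omega> \<T> T p) m \<phi> \<longrightarrow> injection_matrix \<Omega> \<T> T p m \<phi> P \<longrightarrow>
     (let A_C = restrict_matrix (dofs \<T> p) P (A_hat \<Omega> \<T> T p);
          A_C_lor = restrict_matrix (dofs \<T> p) P (A_tilde T p)
      in \<forall>u :: nat \<Rightarrow> real.
           quad_form {..<m} A_C u \<le> C * quad_form {..<m} A_C_lor u \<and>
           quad_form {..<m} A_C_lor u \<le> C * quad_form {..<m} A_C u)"
proof (cases "\<sigma> = 0")
  case True
  \<comment> \<open>For \<sigma> = 0 the general constant would be 0. By \<open>mesh_element\<close>
    no element can then exist, both forms vanish and any positive constant serves.\<close>
  have zero: "quad_form {..<m} (restrict_matrix (dofs {} p) P A) u = 0" for m p P A and u :: "nat \<Rightarrow> real"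
    by (simp add: quad_form_restrict dofs_def)
  have empty: "\<T> = {}" if "hp_mesh \<Omega> \<T> T p" "quasi_uniform \<sigma> \<T> T" for \<Omega> \<T> T p
    using mesh_element(1)[OF that] True by blast
  show ?thesis
    unfolding Let_def by (rule exI[of _ 1], intro conjI allI impI) (simp, (drule empty, assumption, simp add: zero)+)
next
  case False
  moreover have "0 < Cref" unfolding Cref_def by (rule add_nonneg_pos) simp_all
  ultimately have "0 < (\<sigma> ^ 4 * Cref)\<^sup>2" by simp
  then show ?thesis
    unfolding Let_def
    by (intro exI[of _ "(\<sigma> ^ 4 * Cref)\<^sup>2"] conjI allI impI) (assumption, (rule mesh_equivalence; assumption)+)
qed

end
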